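(* Let $X\subset\mathbb{C}^m$ be an unbounded algebraic set of pure dimension $k$. Suppose that the tangent cone at infinity $C_{5,\infty}(X)\subset\mathbb{C}^m$ has pure dimension $k$. Then $X$ is an affine linear subspace of $\mathbb{C}^m$.
   Context: For an unbounded pure $k$-dimensional (complex, closed) algebraic set $X\subset\mathbb{C}^m$, the Whitney tangent cone $C_{5,\infty}(X)$ of $X$ at infinity is the set of $v\in\mathbb{C}^m$ for which there exist sequences $(p_j)_j$ and $(q_j)_j$ in $X$ and $(t_j)_j$ in $\mathbb{C}$ such that $\lim_{j\to\infty}\|p_j\|=\lim_{j\to\infty}\|q_j\|=\infty$ and $\lim_{j\to\infty}t_j(p_j-q_j)=v$. The set $C_{5,\infty}(X)$ is known to be an algebraic subset of $\mathbb{C}^m$, so its dimension makes sense. *)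

theory Defs
  imports "HOL-Analysis.Analysis" "HOL-Library.Extended_Nat"
begin

section \<open>Algebraic subsets of complex affine space\<close>

text \<open>The polynomial functions with complex coefficients in the coordinates \<open>z $ i\<close>. The library's
  \<^const>\<open>polynomial_function\<close> is a notion over the reals (it includes complex conjugation) and
  cannot be used here.\<close>

inductive complex_poly_fun :: "(complex ^ 'm \<Rightarrow> complex) \<Rightarrow> bool" where
  const: "complex_poly_fun (\<lambda>z. c)"
| coord: "complex_poly_fun (\<lambda>z. z $ i)"
| add: "complex_poly_fun f \<Longrightarrow> complex_poly_fun g \<Longrightarrow> complex_poly_fun (\<lambda>z. f z + g z)"
| mult: "complex_poly_fun f \<Longrightarrow> complex_poly_fun g \<Longrightarrow> complex_poly_fun (\<lambda>z. f z * g z)"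

text \<open>Arbitrary families of equations are allowed; by Hilbert's basis theorem finite families define
  the same sets.\<close>

definition algebraic_set :: "(complex ^ 'm) set \<Rightarrow> bool" where
  "algebraic_set V \<longleftrightarrow>
     (\<exists>P. (\<forall>f\<in>P. complex_poly_fun f) \<and> V = {z. \<forall>f\<in>P. f z = 0})"

definition zariski :: "(complex ^ 'm) topology" where
  "zariski = topology (\<lambda>U. algebraic_set (- U))"

lemma algebraic_set_UNIV: "algebraic_set UNIV"
  unfolding algebraic_set_def by (rule exI[of _ "{}"]) auto

lemma algebraic_set_empty: "algebraic_set {}"
  unfolding algebraic_set_def
  by (rule exI[of _ "{\<lambda>z. 1}"]) (auto intro: complex_poly_fun.const)

lemma algebraic_set_Un:
  assumes "algebraic_set V" "algebraic_set W"
  shows "algebraic_set (V \<union> W)"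
proof -
  obtain P Q where P: "\<forall>f\<in>P. complex_poly_fun f" "V = {z. \<forall>f\<in>P. f z = 0}"
    and Q: "\<forall>f\<in>Q. complex_poly_fun f" "W = {z. \<forall>f\<in>Q. f z = 0}"
    using assms unfolding algebraic_set_def by blast
  let ?R = "(\<lambda>(f, g) z. f z * g z) ` (P \<times> Q)"
  have "\<forall>f\<in>?R. complex_poly_fun f"
    using P(1) Q(1) by (auto intro: complex_poly_fun.mult)
  moreover have "V \<union> W = {z. \<forall>f\<in>?R. f z = 0}"
    unfolding P(2) Q(2) by auto
  ultimately show ?thesis
    unfolding algebraic_set_def by blast
qed

lemma algebraic_set_Inter:
  assumes "\<And>V. V \<in> \<V> \<Longrightarrow> algebraic_set V"
  shows "algebraic_set (\<Inter>\<V>)"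
proof -
  let ?P = "{f. complex_poly_fun f \<and> (\<forall>z\<in>\<Inter>\<V>. f z = 0)}"
  have "z \<in> V" if z: "\<forall>f\<in>?P. f z = 0" and V: "V \<in> \<V>" for z V
  proof -
    obtain P where P: "\<forall>f\<in>P. complex_poly_fun f" and VP: "V = {z. \<forall>f\<in>P. f z = 0}"
      using assms[OF V] unfolding algebraic_set_def by blast
    have "P \<subseteq> ?P"
    proof
      fix f assume f: "f \<in> P"
      have "f w = 0" if "w \<in> \<Inter>\<V>" for w
      proof -
        have "w \<in> V" using that V by (rule InterD)
        then show ?thesis using f by (simp add: VP)
      qed
      then show "f \<in> ?P" using P f by simp
    qed
    then show ?thesis using z by (auto simp: VP)
  qed
  then have "\<Inter>\<V> = {z. \<forall>f\<in>?P. f z = 0}"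
    by (intro equalityI subsetI) simp_all
  then show ?thesis
    unfolding algebraic_set_def by (intro exI[of _ ?P]) simp
qed

lemma istopology_zariski: "istopology (\<lambda>U :: (complex ^ 'm) set. algebraic_set (- U))"
  unfolding istopology_def
proof (intro conjI allI impI)
  fix S T :: "(complex ^ 'm) set"
  assume "algebraic_set (- S)" "algebraic_set (- T)"
  then show "algebraic_set (- (S \<inter> T))"
    by (simp add: algebraic_set_Un)
next
  fix \<K> :: "(complex ^ 'm) set set"
  assume "\<forall>K\<in>\<K>. algebraic_set (- K)"
  then have "algebraic_set (\<Inter>(uminus ` \<K>))"
    by (intro algebraic_set_Inter) auto
  moreover have "\<Inter>(uminus ` \<K>) = - \<Union>\<K>"
    by auto
  ultimately show "algebraic_set (- \<Union>\<K>)"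
    by simp
qed

lemma openin_zariski: "openin zariski U \<longleftrightarrow> algebraic_set (- U)"
  unfolding zariski_def by (simp add: topology_inverse'[OF istopology_zariski])

lemma topspace_zariski [simp]: "topspace zariski = UNIV"
  unfolding topspace_def using openin_zariski[of UNIV] algebraic_set_empty by auto

lemma closedin_zariski: "closedin zariski V \<longleftrightarrow> algebraic_set V"
  by (simp add: closedin_def openin_zariski double_complement flip: Compl_eq_Diff_UNIV)


section \<open>Dimension\<close>

definition irreducible_in :: "'a topology \<Rightarrow> 'a set \<Rightarrow> bool" where
  "irreducible_in T A \<longleftrightarrow>
     A \<subseteq> topspace T \<and> A \<noteq> {} \<and>
     (\<forall>C D. closedin T C \<and> closedin T D \<and> A \<subseteq> C \<union> D \<longrightarrow> A \<subseteq> C \<or> A \<subseteq> D)"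

definition irreducible_component_of :: "'a topology \<Rightarrow> 'a set \<Rightarrow> bool" where
  "irreducible_component_of T A \<longleftrightarrow>
     irreducible_in T A \<and> (\<forall>B. irreducible_in T B \<and> A \<subseteq> B \<longrightarrow> B = A)"

text \<open>The supremum of the lengths \<open>n\<close> of chains \<open>Z 0 \<subset> \<dots> \<subset> Z n\<close> of irreducible
  closed subsets. The empty space gets dimension \<open>0\<close>.\<close>

definition krull_dim :: "'a topology \<Rightarrow> enat" where
  "krull_dim T =
     Sup {enat n | n. \<exists>Z. (\<forall>i\<le>n. closedin T (Z i) \<and> irreducible_in T (Z i)) \<and>
                          (\<forall>i<n. Z i \<subset> Z (Suc i))}"

definition pure_dim :: "'a topology \<Rightarrow> nat \<Rightarrow> bool" where
  "pure_dim T k \<longleftrightarrow>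
     (\<forall>A. irreducible_component_of T A \<longrightarrow> krull_dim (subtopology T A) = enat k)"

text \<open>For an algebraic set \<open>X\<close> the closed sets of the subspace topology are the algebraic subsets
  of \<open>X\<close>, so this is the usual notion.\<close>

definition has_pure_dim :: "(complex ^ 'm) set \<Rightarrow> nat \<Rightarrow> bool" where
  "has_pure_dim X k \<longleftrightarrow> pure_dim (subtopology zariski X) k"


section \<open>The Whitney tangent cone at infinity and affine linear subspaces\<close>

definition C5_infinity :: "(complex ^ 'm) set \<Rightarrow> (complex ^ 'm) set" where
  "C5_infinity X =
     {v. \<exists>p q :: nat \<Rightarrow> complex ^ 'm. \<exists>t :: nat \<Rightarrow> complex.
           (\<forall>j. p j \<in> X) \<and> (\<forall>j. q j \<in> X) \<and>
           filterlim (\<lambda>j. norm (p j)) at_top sequentially \<and>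
           filterlim (\<lambda>j. norm (q j)) at_top sequentially \<and>
           (\<lambda>j. t j *s (p j - q j)) \<longlonglongrightarrow> v}"

text \<open>Linearity is over the complex numbers, whereas the library's \<^const>\<open>affine\<close> is over the reals.\<close>

definition complex_affine_subspace :: "(complex ^ 'm) set \<Rightarrow> bool" where
  "complex_affine_subspace X \<longleftrightarrow> (\<exists>a V. vec.subspace V \<and> X = (\<lambda>v. a + v) ` V)"

end

theory Submission
  imports Defs "Jordan_Normal_Form.Char_Poly"
begin

text \<open>Cutting the cone \<open>C\<^sub>5\<close> by \<open>k\<close> generic hyperplanes gives a linear map of rank \<open>\<le> k\<close> whose kernel
  meets the cone only in \<open>0\<close>; a compactness argument then shows that far out on \<open>X\<close> this map is
  injective with a Lipschitz inverse. This property survives small perturbations, so Noether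
  normalisation along nearby directions yields a projection \<open>P\<close> of rank \<open>\<le> k\<close> that is finite on \<open>X\<close>
  and injective far out. Since every component of \<open>X\<close> has dimension \<open>k\<close>, it is mapped by \<open>P\<close> onto
  a \<open>k\<close>-dimensional space, and injectivity leaves room for only one component. Each coordinate is then a
  rational function \<open>b / a\<close> of the projection, because its minimal equation has a single root over
  distant points, and it grows at most linearly; restricting to lines shows that it is affine.\<close>

text \<open>The hyperplanes yield a linear map that is injective far out, but an estimate does not
  show that the functions on \<open>X\<close> are finite over it. Finiteness is therefore never
  deduced from growth: it is built in by eliminating one direction at a time, starting from the
  identity, while the estimate is carried along. This is why injectivity is kept as a Lipschitz
  bound, a condition that is open in the linear map; the same bound later gives the linear growth of
  the coordinates. The two dimension hypotheses act in opposite directions. The cone bounds the rank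
  of the projection by \<open>k\<close> from above; a component of \<open>X\<close> of dimension
  \<open>k\<close> forces the rank to be at least \<open>k\<close> and excludes relations between
  the projected coordinates. Unboundedness makes the projection nonzero, so that there are distant
  points to compare. The passage from distant points to all points uses norms: a polynomial
  vanishing on the far part of an irreducible set would have a nonzero norm in the projected
  coordinates that vanishes far out.\<close>

no_notation vec_index (infixl "$" 100)

subsection \<open>Rings of functions and finitely generated modules\<close>

definition fun_subring :: "('p \<Rightarrow> complex) set \<Rightarrow> bool" where
  "fun_subring R \<longleftrightarrow> (\<forall>c. (\<lambda>_. c) \<in> R) \<and>
     (\<forall>f\<in>R. \<forall>g\<in>R. (\<lambda>z. f z + g z) \<in> R \<and> (\<lambda>z. f z * g z) \<in> R)"

lemma fun_subringD:
  assumes "fun_subring R"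
  shows fun_subring_const: "(\<lambda>_. c) \<in> R"
    and fun_subring_add: "f \<in> R \<Longrightarrow> g \<in> R \<Longrightarrow> (\<lambda>z. f z + g z) \<in> R"
    and fun_subring_mult: "f \<in> R \<Longrightarrow> g \<in> R \<Longrightarrow> (\<lambda>z. f z * g z) \<in> R"
  using assms unfolding fun_subring_def by auto

lemma fun_subring_uminus:
  assumes R: "fun_subring R" and "f \<in> R" shows "(\<lambda>z. - f z) \<in> R"
  using fun_subring_mult[OF R fun_subring_const[OF R, of "-1"] assms(2)] by simp

lemma fun_subring_diff:
  assumes R: "fun_subring R" and "f \<in> R" "g \<in> R" shows "(\<lambda>z. f z - g z) \<in> R"
  using fun_subring_add[OF R assms(2) fun_subring_uminus[OF R assms(3)]] by simp

lemma fun_subring_sum: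
  assumes R: "fun_subring R" and "\<And>i. i \<in> I \<Longrightarrow> f i \<in> R"
  shows "(\<lambda>z. \<Sum>i\<in>I. f i z) \<in> R"
  using assms(2)
  by (induction I rule: infinite_finite_induct)
     (auto intro: fun_subring_const[OF R] fun_subring_add[OF R])

lemma fun_subring_power:
  assumes R: "fun_subring R" and "f \<in> R" shows "(\<lambda>z. f z ^ n) \<in> R"
  by (induction n) (auto intro: fun_subring_const[OF R] fun_subring_mult[OF R assms(2)])

text \<open>The \<open>R\<close>-module spanned by \<open>G\<close>; over all polynomial functions,
  the ideal generated by \<open>G\<close>. Membership is handled by induction, and explicit
  coefficients are recovered by \<open>gen_coeffs\<close> for finite \<open>G\<close>.\<close>

inductive_set gen :: "('p \<Rightarrow> complex) set \<Rightarrow> ('p \<Rightarrow> complex) set \<Rightarrow> ('p \<Rightarrow> complex) set"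
  for R G where
  zero: "(\<lambda>_. 0) \<in> gen R G"
| step: "h \<in> gen R G \<Longrightarrow> r \<in> R \<Longrightarrow> g \<in> G \<Longrightarrow> (\<lambda>z. h z + r z * g z) \<in> gen R G"

lemma gen_add:
  assumes "f \<in> gen R G" "g \<in> gen R G" shows "(\<lambda>z. f z + g z) \<in> gen R G"
  using assms(2)
proof induction
  case zero
  then show ?case using assms(1) by simp
next
  case (step h r g)
  from gen.step[OF step(4,2,3)] show ?case by (simp add: add.assoc)
qed

lemma gen_smult:
  assumes R: "fun_subring R" and "f \<in> gen R G" "r \<in> R" shows "(\<lambda>z. r z * f z) \<in> gen R G"
  using assms(2)
proof induction
  case zero
  then show ?case using gen.zero by simp
next
  case (step h s g)
  from gen.step[OF step(4) fun_subring_mult[OF R assms(3) step(2)] step(3)]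
  show ?case by (simp add: algebra_simps)
qed

lemma gen_incl:
  assumes R: "fun_subring R" and "g \<in> G" shows "g \<in> gen R G"
  using gen.step[OF gen.zero fun_subring_const[OF R, of 1] assms(2)] by simp

lemma gen_sum:
  assumes R: "fun_subring R" and "\<And>i. i \<in> I \<Longrightarrow> f i \<in> gen R G"
  shows "(\<lambda>z. \<Sum>i\<in>I. f i z) \<in> gen R G"
  using assms(2)
  by (induction I rule: infinite_finite_induct) (auto intro: gen.zero gen_add)

lemma gen_uminus:
  assumes R: "fun_subring R" and "f \<in> gen R G" shows "(\<lambda>z. - f z) \<in> gen R G"
  using gen_smult[OF R assms(2) fun_subring_const[OF R, of "-1"]] by simp

lemma gen_diff:
  assumes R: "fun_subring R" and "f \<in> gen R G" "g \<in> gen R G" shows "(\<lambda>z. f z - g z) \<in> gen R G"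
  using gen_add[OF assms(2) gen_uminus[OF R assms(3)]] by simp

lemma gen_trans:
  assumes R: "fun_subring R" and "f \<in> gen R G" "\<And>g. g \<in> G \<Longrightarrow> g \<in> gen R H"
  shows "f \<in> gen R H"
  using assms(2)
proof induction
  case zero
  show ?case by (rule gen.zero)
next
  case (step h r g)
  show ?case
    using gen_add[OF step(4) gen_smult[OF R assms(3)[OF step(3)] step(2)]] .
qed

lemma gen_mono:
  assumes "f \<in> gen R G" "R \<subseteq> R'" "G \<subseteq> H" shows "f \<in> gen R' H"
  using assms(1) by induction (use assms in \<open>auto intro: gen.intros\<close>)

lemma gen_coeffs:
  assumes R: "fun_subring R" and E: "finite E" and "f \<in> gen R E"
  obtains c where "\<And>e. c e \<in> R" "f = (\<lambda>z. \<Sum>e\<in>E. c e z * e z)"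
proof -
  have "\<exists>c. (\<forall>e. c e \<in> R) \<and> f = (\<lambda>z. \<Sum>e\<in>E. c e z * e z)"
    using assms(3)
  proof induction
    case zero
    show ?case by (intro exI[of _ "\<lambda>_ _. 0"]) (simp add: fun_subring_const[OF R])
  next
    case (step h r g)
    then obtain c where c: "\<And>e. c e \<in> R" "h = (\<lambda>z. \<Sum>e\<in>E. c e z * e z)" by blast
    have "h z + r z * g z = (\<Sum>e\<in>E. (c(g := (\<lambda>z. c g z + r z))) e z * e z)" for z
      using E step(3) by (simp add: c(2) sum.remove[of E g] algebra_simps)
    moreover have "\<forall>e. (c(g := (\<lambda>z. c g z + r z))) e \<in> R"
      using c(1) step(2) by (auto intro: fun_subring_add[OF R])
    ultimately show ?case by (intro exI[of _ "c(g := (\<lambda>z. c g z + r z))"]) auto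
  qed
  then show thesis using that by blast
qed

subsection \<open>Characteristic polynomials\<close>

text \<open>By the Leibniz formula the coefficients are built from the entries by sums and products.
  \<open>good\<close> speaks of all coefficients of a polynomial-valued function at once, which is
  what products need.\<close>

lemma char_poly_coeff_in_subring:
  assumes R: "fun_subring R" and M: "\<And>i j. i < n \<Longrightarrow> j < n \<Longrightarrow> M i j \<in> R"
  shows "(\<lambda>z. coeff (char_poly (mat n n (\<lambda>(i, j). M i j z))) k) \<in> R"
proof -
  define good :: "('a \<Rightarrow> complex poly) \<Rightarrow> bool" where "good F \<longleftrightarrow> (\<forall>k. (\<lambda>z. coeff (F z) k) \<in> R)" for F
  have const: "good (\<lambda>_. c)" for c unfolding good_def by (simp add: fun_subring_const[OF R])
  have mult: "good (\<lambda>z. F z * G z)" if "good F" "good G" for F G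
    using that unfolding good_def coeff_mult
    by (auto intro!: fun_subring_sum[OF R] fun_subring_mult[OF R])
  have sum: "good (\<lambda>z. \<Sum>i\<in>I. F i z)" if "\<And>i. i \<in> I \<Longrightarrow> good (F i)" for F and I :: "(nat \<Rightarrow> nat) set"
    using that unfolding good_def coeff_sum by (auto intro!: fun_subring_sum[OF R])
  have prod: "good (\<lambda>z. \<Prod>i\<in>I. F i z)" if "\<And>i. i \<in> I \<Longrightarrow> good (F i)" for F and I :: "nat set"
    using that by (induction I rule: infinite_finite_induct) (auto intro: const mult)
  have entry: "good (\<lambda>z. char_poly_matrix (mat n n (\<lambda>(i, j). M i j z)) $$ (i, j))" if "i < n" "j < n" for i j
    unfolding good_def
  proof
    fix k
    show "(\<lambda>z. coeff (char_poly_matrix (mat n n (\<lambda>(i, j). M i j z)) $$ (i, j)) k) \<in> R"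
      using that M[OF that] fun_subring_const[OF R] fun_subring_uminus[OF R, of "M i j"]
      by (cases k) (auto simp: char_poly_matrix_def)
  qed
  have "char_poly (mat n n (\<lambda>(i, j). M i j z)) = (\<Sum>p\<in>{p. p permutes {0..<n}}.
      signof p * (\<Prod>i = 0..<n. char_poly_matrix (mat n n (\<lambda>(i, j). M i j z)) $$ (i, p i)))" for z
    unfolding char_poly_def by (rule det_def') auto
  moreover have "good (\<lambda>z. \<Sum>p\<in>{p. p permutes {0..<n}}.
      signof p * (\<Prod>i = 0..<n. char_poly_matrix (mat n n (\<lambda>(i, j). M i j z)) $$ (i, p i)))"
    by (intro sum mult prod entry const) (auto simp: permutes_in_image)
  ultimately show ?thesis unfolding good_def by simp
qed

text \<open>The determinant trick, read pointwise: an eigenvalue is a root of the characteristic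
  polynomial. The last clause, where the matrix vanishes and the polynomial is \<open>t ^ n\<close>,
  is what turns the trick into Nakayama's lemma in \<open>lying_over\<close>.\<close>

lemma monic_annihilator:
  assumes R: "fun_subring R" and M: "\<And>i j. i < n \<Longrightarrow> j < n \<Longrightarrow> M i j \<in> R"
  obtains a where "\<And>i. a i \<in> R"
    "\<And>z t v. \<lbrakk>\<And>i. i < n \<Longrightarrow> t * v i = (\<Sum>j<n. M i j z * v j); \<exists>i<n. v i \<noteq> 0\<rbrakk>
       \<Longrightarrow> t ^ n + (\<Sum>i<n. a i z * t ^ i) = 0"
    "\<And>z i. \<lbrakk>\<And>i j. i < n \<Longrightarrow> j < n \<Longrightarrow> M i j z = 0; i < n\<rbrakk> \<Longrightarrow> a i z = 0"
proof -
  define A where "A z = mat n n (\<lambda>(i, j). M i j z)" for z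
  have A: "A z \<in> carrier_mat n n" for z unfolding A_def by simp
  define a where "a i z = coeff (char_poly (A z)) i" for i z
  have aR: "a i \<in> R" for i
    using char_poly_coeff_in_subring[OF R, of n M i] M unfolding a_def A_def by blast
  have poly: "poly (char_poly (A z)) t = t ^ n + (\<Sum>i<n. a i z * t ^ i)" for z t
    using degree_monic_char_poly[OF A[of z]]
    by (simp add: poly_altdef a_def lessThan_Suc_atMost[symmetric])
  have "t ^ n + (\<Sum>i<n. a i z * t ^ i) = 0"
    if "\<And>i. i < n \<Longrightarrow> t * v i = (\<Sum>j<n. M i j z * v j)" "\<exists>i<n. v i \<noteq> 0" for z t v
  proof -
    have "A z *\<^sub>v Matrix.vec n v = t \<cdot>\<^sub>v Matrix.vec n v"
      using that(1) by (intro eq_vecI) (auto simp: A_def scalar_prod_def lessThan_atLeast0)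
    moreover have "Matrix.vec n v \<noteq> 0\<^sub>v n"
      using that(2) by (metis index_vec index_zero_vec(1))
    ultimately have "eigenvalue (A z) t"
      unfolding eigenvalue_def eigenvector_def using A[of z] by (intro exI[of _ "Matrix.vec n v"]) auto
    then show ?thesis using eigenvalue_root_char_poly[OF A] poly by simp
  qed
  moreover have "a i z = 0" if "\<And>i j. i < n \<Longrightarrow> j < n \<Longrightarrow> M i j z = 0" "i < n" for z i
  proof -
    have "A z = 0\<^sub>m n n" unfolding A_def using that by (intro eq_matI) auto
    moreover have "diag_mat (0\<^sub>m n n :: complex mat) = replicate n 0"
      by (intro nth_equalityI) (auto simp: diag_mat_def)
    ultimately have "char_poly (A z) = (\<Prod>a \<leftarrow> replicate n 0. [:- a, 1:])"
      by (subst char_poly_upper_triangular[of _ n]) auto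
    then have "char_poly (A z) = monom 1 n"
      by (simp add: monom_altdef)
    then show ?thesis using that(2) by (simp add: a_def)
  qed
  ultimately show thesis using that aR by blast
qed

subsection \<open>Finite modules over rings of polynomial functions\<close>

lemma fun_subring_complex_poly_fun: "fun_subring (Collect complex_poly_fun)"
  unfolding fun_subring_def by (auto intro: complex_poly_fun.intros)

lemmas complex_poly_fun_diff = fun_subring_diff[OF fun_subring_complex_poly_fun, simplified]
lemmas complex_poly_fun_sum = fun_subring_sum[OF fun_subring_complex_poly_fun, simplified]
lemmas complex_poly_fun_power = fun_subring_power[OF fun_subring_complex_poly_fun, simplified]

text \<open>Module-finiteness of the coordinate ring of \<open>X\<close> over \<open>R\<close>.
  Agreement is asked only on \<open>X\<close>, which replaces the quotient by the vanishing ideal,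
  while \<open>R\<close> and \<open>E\<close> consist of functions on the whole space.\<close>

definition finite_over :: "(complex ^ 'm \<Rightarrow> complex) set \<Rightarrow> (complex ^ 'm) set \<Rightarrow> bool" where
  "finite_over R X \<longleftrightarrow> (\<exists>E. finite E \<and> (\<forall>e\<in>E. complex_poly_fun e) \<and>
     (\<forall>f. complex_poly_fun f \<longrightarrow> (\<exists>h\<in>gen R E. \<forall>z\<in>X. f z = h z)))"

lemma finite_over_mono:
  assumes "finite_over R X" "R \<subseteq> R'" "Y \<subseteq> X" shows "finite_over R' Y"
proof -
  obtain E where E: "finite E" "\<forall>e\<in>E. complex_poly_fun e"
    and h: "\<forall>f. complex_poly_fun f \<longrightarrow> (\<exists>h\<in>gen R E. \<forall>z\<in>X. f z = h z)"
    using assms(1) unfolding finite_over_def by blast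
  have "\<exists>h\<in>gen R' E. \<forall>z\<in>Y. f z = h z" if "complex_poly_fun f" for f
    using h that gen_mono[OF _ assms(2) order.refl] assms(3) by (meson subsetD)
  then show ?thesis unfolding finite_over_def using E by blast
qed

text \<open>Multiplication by \<open>f\<close> acts on the generators by a matrix over
  \<open>R\<close>; at a point of \<open>X\<close> the values of the generators form an eigenvector
  with eigenvalue \<open>f z\<close>.\<close>

lemma finite_over_integral:
  assumes R: "fun_subring R" and fin: "finite_over R X" and f: "complex_poly_fun f"
  obtains n a where "\<And>i. a i \<in> R" "\<And>z. z \<in> X \<Longrightarrow> f z ^ n + (\<Sum>i<n. a i z * f z ^ i) = 0"
proof -
  obtain E where E: "finite E" "\<forall>e\<in>E. complex_poly_fun e"
    and h: "\<forall>f. complex_poly_fun f \<longrightarrow> (\<exists>h\<in>gen R E. \<forall>z\<in>X. f z = h z)"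
    using fin unfolding finite_over_def by blast
  have ex: "\<exists>c. (\<forall>e'. c e' \<in> R) \<and> (\<forall>z\<in>X. g z = (\<Sum>e'\<in>E. c e' z * e' z))"
    if g: "complex_poly_fun g" for g
  proof -
    obtain k where k: "k \<in> gen R E" "\<forall>z\<in>X. g z = k z" using h g by blast
    obtain c where "\<And>e. c e \<in> R" "k = (\<lambda>z. \<Sum>e\<in>E. c e z * e z)"
      using gen_coeffs[OF R E(1) k(1)] by blast
    with k(2) show ?thesis by (intro exI[of _ c]) simp
  qed
  have "\<forall>e\<in>E. \<exists>c. (\<forall>e'. c e' \<in> R) \<and> (\<forall>z\<in>X. f z * e z = (\<Sum>e'\<in>E. c e' z * e' z))"
    using ex E(2) f by (auto intro: complex_poly_fun.mult)
  from bchoice[OF this] obtain c where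
    "\<forall>e\<in>E. (\<forall>e'. c e e' \<in> R) \<and> (\<forall>z\<in>X. f z * e z = (\<Sum>e'\<in>E. c e e' z * e' z))" ..
  then have c: "\<And>e e'. e \<in> E \<Longrightarrow> c e e' \<in> R"
    "\<And>e z. e \<in> E \<Longrightarrow> z \<in> X \<Longrightarrow> f z * e z = (\<Sum>e'\<in>E. c e e' z * e' z)"
    by blast+
  define n where "n = card E"
  obtain es where es: "bij_betw es {..<n} E"
    using ex_bij_betw_nat_finite[OF E(1)] unfolding n_def lessThan_atLeast0 by blast
  have esE: "es i \<in> E" if "i < n" for i using es that by (auto dest: bij_betwE)
  obtain a where aR: "\<And>i. a i \<in> R" and a:
    "\<And>z t v. \<lbrakk>\<And>i. i < n \<Longrightarrow> t * v i = (\<Sum>j<n. c (es i) (es j) z * v j); \<exists>i<n. v i \<noteq> 0\<rbrakk>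
       \<Longrightarrow> t ^ n + (\<Sum>i<n. a i z * t ^ i) = 0"
    by (rule monic_annihilator[OF R, where n = n and M = "\<lambda>i j. c (es i) (es j)"]) (use c(1) esE in blast)+
  have "f z ^ n + (\<Sum>i<n. a i z * f z ^ i) = 0" if z: "z \<in> X" for z
  proof (rule a[of "f z" "\<lambda>i. es i z"])
    show "f z * es i z = (\<Sum>j<n. c (es i) (es j) z * es j z)" if "i < n" for i
      using c(2)[OF esE[OF that] z] sum.reindex_bij_betw[OF es, of "\<lambda>e. c (es i) e z * e z"] by simp
    \<comment> \<open>The eigenvector is nonzero because the constant 1 is a combination of the
      generators at \<open>z\<close>.\<close>
    obtain d where d: "(1::complex) = (\<Sum>e\<in>E. d e z * e z)"
      using ex[OF complex_poly_fun.const[of 1]] z by blast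
    then obtain e where e: "e \<in> E" "e z \<noteq> 0"
      by (metis (no_types, lifting) mult_zero_right sum.neutral zero_neq_one)
    then show "\<exists>i<n. es i z \<noteq> 0"
      using es unfolding bij_betw_def by force
  qed
  with aR show thesis by (rule that)
qed

section \<open>Weak Nullstellensatz and lying over\<close>

lemma gen_insertE:
  assumes R: "fun_subring R" and "f \<in> gen R (insert g H)"
  obtains a b where "a \<in> gen R H" "b \<in> R" "f = (\<lambda>z. a z + b z * g z)"
proof -
  have "\<exists>a\<in>gen R H. \<exists>b\<in>R. f = (\<lambda>z. a z + b z * g z)"
    using assms(2)
  proof induction
    case zero
    show ?case by (rule bexI[OF _ gen.zero], rule bexI[of _ "\<lambda>_. 0"]) (auto intro: fun_subring_const[OF R])
  next
    case (step h r g')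
    then obtain a b where ab: "a \<in> gen R H" "b \<in> R" "h = (\<lambda>z. a z + b z * g z)" by blast
    show ?case
    proof (cases "g' = g")
      case True
      show ?thesis
        by (rule bexI[OF _ ab(1)], rule bexI[OF _ fun_subring_add[OF R ab(2) step(2)]])
           (simp add: ab(3) True algebra_simps)
    next
      case False
      then have "g' \<in> H" using step(3) by simp
      show ?thesis
        by (rule bexI[OF _ gen.step[OF ab(1) step(2) \<open>g' \<in> H\<close>]], rule bexI[OF _ ab(2)])
           (simp add: ab(3) algebra_simps)
    qed
  qed
  then show thesis using that by blast
qed

text \<open>If every \<open>z $ j - r\<close> generated 1 together with \<open>H\<close>, the linear
  factors of \<open>p\<close> could be removed one after another without leaving the ideal, until a
  nonzero constant remained in it.\<close>

lemma proper_ideal_extend: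
  assumes proper: "(\<lambda>_. 1) \<notin> gen (Collect complex_poly_fun) H"
    and p: "p \<noteq> 0" "(\<lambda>z. poly p (z $ j)) \<in> gen (Collect complex_poly_fun) H"
  shows "\<exists>r. (\<lambda>_. 1) \<notin> gen (Collect complex_poly_fun) (insert (\<lambda>z. z $ j - r) H)"
proof (rule ccontr)
  let ?I = "gen (Collect complex_poly_fun)"
  note R = fun_subring_complex_poly_fun
  assume contra: "\<nexists>r. (\<lambda>_. 1) \<notin> ?I (insert (\<lambda>z. z $ j - r) H)"
  have "(\<lambda>_. 1) \<in> ?I H"
    using p
  proof (induction "degree p" arbitrary: p)
    case 0
    then obtain c where "p = [:c:]" "c \<noteq> 0" by (metis degree_eq_zeroE pCons_0_0)
    then show ?case
      using gen_smult[OF R 0(3), of "\<lambda>_. 1 / c"] by (simp add: complex_poly_fun.const)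
  next
    case (Suc n)
    then have "\<not> constant (poly p)" by (metis constant_degree nat.distinct(1))
    then obtain r where "poly p r = 0" using fundamental_theorem_of_algebra by blast
    then obtain q where q: "p = [:-r, 1:] * q" by (auto simp: poly_eq_0_iff_dvd)
    obtain a b where ab: "a \<in> ?I H" "complex_poly_fun b" "(\<lambda>_. 1) = (\<lambda>z. a z + b z * (z $ j - r))"
      using contra gen_insertE[OF R, of "\<lambda>_. 1" "\<lambda>z. z $ j - r" H] by auto
    have q_poly: "complex_poly_fun (\<lambda>z. poly q (z $ j))"
      unfolding poly_altdef
      by (intro complex_poly_fun_sum complex_poly_fun.intros complex_poly_fun_power)
    \<comment> \<open>Multiplying \<open>1 = a + b (z $ j - r)\<close> by \<open>q\<close> and using
      \<open>p = (z $ j - r) q\<close> writes \<open>q\<close> through \<open>a\<close> and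
      \<open>p\<close>, both in the ideal.\<close>
    have "(\<lambda>z. poly q (z $ j) * a z + b z * poly p (z $ j)) \<in> ?I H"
      using ab Suc.prems q_poly by (auto intro!: gen_add gen_smult[OF R])
    moreover have "poly q (z $ j) * a z + b z * poly p (z $ j) = poly q (z $ j)" for z
    proof -
      have one: "a z + b z * (z $ j - r) = 1" using fun_cong[OF ab(3), of z] by simp
      have p_z: "poly p (z $ j) = (z $ j - r) * poly q (z $ j)" by (simp add: q algebra_simps)
      have "poly q (z $ j) * a z + b z * poly p (z $ j) = poly q (z $ j) * (a z + b z * (z $ j - r))"
        unfolding p_z by (simp only: algebra_simps)
      then show ?thesis using one by simp
    qed
    moreover have "q \<noteq> 0" using Suc.prems(1) q by auto
    moreover from this have "n = degree q"
      using Suc.hyps(2) degree_mult_eq[of "[:-r, 1:]" q] unfolding q by (simp del: mult_pCons_left)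
    ultimately show ?case using Suc.hyps(1)[of q] by simp
  qed
  with proper show False by blast
qed

lemma complex_poly_fun_diff_in_point_ideal:
  assumes "complex_poly_fun f"
  shows "(\<lambda>z. f z - f r) \<in> gen (Collect complex_poly_fun) (range (\<lambda>j z. z $ j - r $ j))"
  using assms
proof induction
  case (const c)
  then show ?case using gen.zero by simp
next
  case (coord i)
  show ?case by (rule gen_incl[OF fun_subring_complex_poly_fun]) simp
next
  case (add f g)
  from gen_add[OF add(3,4)] show ?case by (simp add: algebra_simps)
next
  case (mult f g)
  have "(\<lambda>z. g z * (f z - f r) + f r * (g z - g r))
      \<in> gen (Collect complex_poly_fun) (range (\<lambda>j z. z $ j - r $ j))"
    using mult by (intro gen_add gen_smult[OF fun_subring_complex_poly_fun])
      (auto intro: complex_poly_fun.intros)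
  then show ?case by (simp add: algebra_simps)
qed

text \<open>A weak Nullstellensatz: adjoining suitable \<open>z $ j - r $ j\<close> one coordinate at a time keeps
  the ideal proper.\<close>

lemma proper_ideal_has_zero:
  fixes G :: "(complex ^ 'm \<Rightarrow> complex) set"
  assumes G: "G \<subseteq> Collect complex_poly_fun" and proper: "(\<lambda>_. 1) \<notin> gen (Collect complex_poly_fun) G"
    and p: "\<And>j. \<exists>p. p \<noteq> 0 \<and> (\<lambda>z. poly p (z $ j)) \<in> gen (Collect complex_poly_fun) G"
  obtains r where "\<And>f. f \<in> G \<Longrightarrow> f r = 0"
proof -
  let ?I = "gen (Collect complex_poly_fun)"
  note R = fun_subring_complex_poly_fun
  have "\<exists>r :: complex ^ 'm. (\<lambda>_. 1) \<notin> ?I ((\<lambda>j z. z $ j - r $ j) ` S \<union> G)" if "finite S" for S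
    using that
  proof induction
    case empty
    then show ?case using proper by simp
  next
    case (insert j S)
    then obtain r :: "complex ^ 'm" where r: "(\<lambda>_. 1) \<notin> ?I ((\<lambda>j z. z $ j - r $ j) ` S \<union> G)" by blast
    obtain p where p: "p \<noteq> 0" "(\<lambda>z. poly p (z $ j)) \<in> ?I G" using p by blast
    have "(\<lambda>z. poly p (z $ j)) \<in> ?I ((\<lambda>j z. z $ j - r $ j) ` S \<union> G)"
      by (rule gen_mono[OF p(2)]) auto
    from proper_ideal_extend[OF r p(1) this] obtain s where
      s: "(\<lambda>_. 1) \<notin> ?I (insert (\<lambda>z. z $ j - s) ((\<lambda>j z. z $ j - r $ j) ` S \<union> G))" by blast
    define r' where "r' = (\<chi> i. if i = j then s else r $ i)"
    have "(\<lambda>j z. z $ j - r $ j) ` S = (\<lambda>j z. z $ j - r' $ j) ` S"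
      using insert.hyps(2) by (intro image_cong) (auto simp: r'_def)
    then have "insert (\<lambda>z. z $ j - s) ((\<lambda>j z. z $ j - r $ j) ` S \<union> G)
        = (\<lambda>j z. z $ j - r' $ j) ` (insert j S) \<union> G"
      by (simp add: r'_def)
    with s show ?case by metis
  qed
  from this[OF finite_class.finite_UNIV] obtain r :: "complex ^ 'm" where
    r: "(\<lambda>_. 1) \<notin> ?I (range (\<lambda>j z. z $ j - r $ j) \<union> G)" by blast
  have "f r = 0" if "f \<in> G" for f
  proof (rule ccontr)
    assume "f r \<noteq> 0"
    have "f \<in> ?I (range (\<lambda>j z. z $ j - r $ j) \<union> G)"
      using that by (intro gen_incl[OF R]) simp
    moreover have "(\<lambda>z. f z - f r) \<in> ?I (range (\<lambda>j z. z $ j - r $ j) \<union> G)"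
      using complex_poly_fun_diff_in_point_ideal[of f r] that G by (auto intro: gen_mono)
    ultimately have "(\<lambda>z. f z - (f z - f r)) \<in> ?I (range (\<lambda>j z. z $ j - r $ j) \<union> G)"
      by (rule gen_diff[OF R])
    from gen_smult[OF R this, of "\<lambda>_. 1 / f r"] r \<open>f r \<noteq> 0\<close> show False
      by (simp add: complex_poly_fun.const)
  qed
  then show thesis by (rule that)
qed

text \<open>Lying over in contrapositive form. If no point of \<open>X\<close> lies over
  \<open>z0\<close>, the maximal ideal \<open>M\<close> of \<open>z0\<close> in \<open>R\<close> and
  the equations of \<open>X\<close> have no common zero and so generate 1. Then the functions on
  \<open>X\<close> equal \<open>M\<close> times themselves, and Nakayama's lemma gives an element of
  \<open>R\<close> that is 1 at \<open>z0\<close> and 0 on \<open>X\<close>.\<close>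

lemma lying_over:
  fixes X :: "(complex ^ 'm) set"
  assumes R: "fun_subring R" and RP: "R \<subseteq> Collect complex_poly_fun" and fin: "finite_over R X"
    and X: "algebraic_set X" and none: "\<And>p. p \<in> X \<Longrightarrow> \<exists>g\<in>R. g p \<noteq> g z0"
  obtains g where "g \<in> R" "\<And>z. z \<in> X \<Longrightarrow> g z = 0" "g z0 \<noteq> 0"
proof -
  let ?I = "gen (Collect complex_poly_fun)"
  note P = fun_subring_complex_poly_fun
  define M where "M = {g \<in> R. g z0 = 0}"
  define V where "V = {f. complex_poly_fun f \<and> (\<forall>z\<in>X. f z = 0)}"
  have one: "(\<lambda>_. 1) \<in> ?I (M \<union> V)"
  proof (rule ccontr)
    assume proper: "(\<lambda>_. 1) \<notin> ?I (M \<union> V)"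
    have "\<exists>p. p \<noteq> 0 \<and> (\<lambda>z. poly p (z $ j)) \<in> ?I (M \<union> V)" for j
    proof -
      obtain n a where aR: "\<And>i. a i \<in> R"
        and a: "\<And>z. z \<in> X \<Longrightarrow> (z $ j) ^ n + (\<Sum>i<n. a i z * (z $ j) ^ i) = 0"
        using finite_over_integral[OF R fin complex_poly_fun.coord[of j]] by metis
      \<comment> \<open>The integral equation of the coordinate with its coefficients frozen at
        \<open>z0\<close>; the error is a combination of the \<open>a i z - a i z0\<close>, which
        belong to \<open>M\<close>.\<close>
      define p where "p = monom 1 n + (\<Sum>i<n. monom (a i z0) i)"
      have "coeff p n = 1" by (simp add: p_def coeff_sum)
      then have "p \<noteq> 0" by auto
      have "(\<lambda>z. (z $ j) ^ n + (\<Sum>i<n. a i z * (z $ j) ^ i)) \<in> V"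
        unfolding V_def using a aR RP
        by (auto intro!: complex_poly_fun.intros complex_poly_fun_sum complex_poly_fun_power)
      then have "(\<lambda>z. (z $ j) ^ n + (\<Sum>i<n. a i z * (z $ j) ^ i)) \<in> ?I (M \<union> V)"
        by (intro gen_incl[OF P]) simp
      moreover have "(\<lambda>z. \<Sum>i<n. (z $ j) ^ i * (a i z - a i z0)) \<in> ?I (M \<union> V)"
      proof (intro gen_sum[OF P] gen_smult[OF P])
        fix i
        show "(\<lambda>z. a i z - a i z0) \<in> ?I (M \<union> V)"
          by (rule gen_incl[OF P])
             (simp add: M_def fun_subring_diff[OF R aR fun_subring_const[OF R]])
      qed (auto intro: complex_poly_fun_power complex_poly_fun.intros)
      ultimately have "(\<lambda>z. ((z $ j) ^ n + (\<Sum>i<n. a i z * (z $ j) ^ i))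
          - (\<Sum>i<n. (z $ j) ^ i * (a i z - a i z0))) \<in> ?I (M \<union> V)"
        by (rule gen_diff[OF P])
      moreover have "((z $ j) ^ n + (\<Sum>i<n. a i z * (z $ j) ^ i))
          - (\<Sum>i<n. (z $ j) ^ i * (a i z - a i z0)) = poly p (z $ j)" for z
        by (simp add: p_def poly_monom poly_sum algebra_simps sum_subtractf flip: sum.distrib)
      ultimately show ?thesis using \<open>p \<noteq> 0\<close> by auto
    qed
    then obtain r where r: "\<And>f. f \<in> M \<union> V \<Longrightarrow> f r = 0"
      using proper_ideal_has_zero[OF _ proper] RP unfolding M_def V_def by blast
    obtain Q where "\<forall>f\<in>Q. complex_poly_fun f" "X = {z. \<forall>f\<in>Q. f z = 0}"
      using X unfolding algebraic_set_def by blast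
    then have "r \<in> X" using r unfolding V_def by blast
    then obtain g where g: "g \<in> R" "g r \<noteq> g z0" using none by blast
    have "(\<lambda>z. g z - g z0) \<in> M"
      by (simp add: M_def fun_subring_diff[OF R g(1) fun_subring_const[OF R]])
    with r[of "\<lambda>z. g z - g z0"] g(2) show False by simp
  qed
  obtain E where E: "finite E" "\<forall>e\<in>E. complex_poly_fun e"
    and span: "\<forall>f. complex_poly_fun f \<longrightarrow> (\<exists>h\<in>gen R E. \<forall>z\<in>X. f z = h z)"
    using fin unfolding finite_over_def by blast
  \<comment> \<open>A factor from \<open>M\<close> is absorbed into the coefficients by expanding
    the other factor over \<open>E\<close>; members of \<open>V\<close> contribute nothing on
    \<open>X\<close>.\<close>
  have comb: "\<exists>c. (\<forall>e. c e \<in> M) \<and> (\<forall>z\<in>X. h z = (\<Sum>e\<in>E. c e z * e z))" if "h \<in> ?I (M \<union> V)" for h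
    using that
  proof induction
    case zero
    have "(\<lambda>_. 0) \<in> M" by (simp add: M_def fun_subring_const[OF R])
    then show ?case by (intro exI[of _ "\<lambda>_ _. 0"]) simp
  next
    case (step h r g)
    then obtain c where c: "\<forall>e. c e \<in> M" "\<forall>z\<in>X. h z = (\<Sum>e\<in>E. c e z * e z)" by blast
    show ?case
    proof (cases "g \<in> V")
      case True
      then show ?thesis using c by (intro exI[of _ c]) (auto simp: V_def)
    next
      case False
      then have g: "g \<in> M" using step.hyps by blast
      obtain h' where h': "h' \<in> gen R E" "\<forall>z\<in>X. r z = h' z" using span step.hyps(2) by blast
      obtain d where d: "\<And>e. d e \<in> R" "h' = (\<lambda>z. \<Sum>e\<in>E. d e z * e z)"
        using gen_coeffs[OF R E(1) h'(1)] by blast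
      have "(\<lambda>z. c e z + g z * d e z) \<in> M" for e
        using c(1) g d(1)[of e] unfolding M_def
        by (auto intro!: fun_subring_add[OF R] fun_subring_mult[OF R])
      moreover have "\<forall>z\<in>X. h z + r z * g z = (\<Sum>e\<in>E. (c e z + g z * d e z) * e z)"
        using c(2) h'(2) by (simp add: d(2) algebra_simps sum.distrib sum_distrib_left sum_distrib_right)
      ultimately show ?thesis by (intro exI[of _ "\<lambda>e z. c e z + g z * d e z"]) simp
    qed
  qed
  have "e \<in> ?I (M \<union> V)" if "e \<in> E" for e
    using gen_smult[OF P one, of e] E(2) that by simp
  then have "\<forall>e\<in>E. \<exists>c. (\<forall>e'. c e' \<in> M) \<and> (\<forall>z\<in>X. e z = (\<Sum>e'\<in>E. c e' z * e' z))"
    using comb by blast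
  from bchoice[OF this] obtain c where
    "\<forall>e\<in>E. (\<forall>e'. c e e' \<in> M) \<and> (\<forall>z\<in>X. e z = (\<Sum>e'\<in>E. c e e' z * e' z))" ..
  then have c: "\<And>e e'. e \<in> E \<Longrightarrow> c e e' \<in> M"
    "\<And>e z. e \<in> E \<Longrightarrow> z \<in> X \<Longrightarrow> e z = (\<Sum>e'\<in>E. c e e' z * e' z)"
    by blast+
  define n where "n = card E"
  obtain es where es: "bij_betw es {..<n} E"
    using ex_bij_betw_nat_finite[OF E(1)] unfolding n_def lessThan_atLeast0 by blast
  have esE: "es i \<in> E" if "i < n" for i using es that by (auto dest: bij_betwE)
  obtain a where aR: "\<And>i. a i \<in> R" and a:
    "\<And>z t v. \<lbrakk>\<And>i. i < n \<Longrightarrow> t * v i = (\<Sum>j<n. c (es i) (es j) z * v j); \<exists>i<n. v i \<noteq> 0\<rbrakk>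
       \<Longrightarrow> t ^ n + (\<Sum>i<n. a i z * t ^ i) = 0"
    and a0: "\<And>z i. \<lbrakk>\<And>i j. i < n \<Longrightarrow> j < n \<Longrightarrow> c (es i) (es j) z = 0; i < n\<rbrakk> \<Longrightarrow> a i z = 0"
    by (rule monic_annihilator[OF R, where n = n and M = "\<lambda>i j. c (es i) (es j)"])
      (use c(1) esE in \<open>unfold M_def, blast\<close>)+
  show thesis
  \<comment> \<open>The characteristic polynomial at 1. On \<open>X\<close> the generators form an
    eigenvector for the eigenvalue 1, so it vanishes; at \<open>z0\<close> the matrix is zero and
    only the leading 1 remains.\<close>
  proof (rule that[of "\<lambda>z. 1 + (\<Sum>i<n. a i z)"])
    show "(\<lambda>z. 1 + (\<Sum>i<n. a i z)) \<in> R"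
      by (intro fun_subring_add[OF R] fun_subring_const[OF R] fun_subring_sum[OF R] aR)
    have "a i z0 = 0" if "i < n" for i
      using a0[OF _ that] c(1) esE unfolding M_def by blast
    then show "1 + (\<Sum>i<n. a i z0) \<noteq> 0" by simp
    fix z assume z: "z \<in> X"
    have "1 ^ n + (\<Sum>i<n. a i z * 1 ^ i) = 0"
    proof (rule a[of 1 "\<lambda>i. es i z"])
      show "1 * es i z = (\<Sum>j<n. c (es i) (es j) z * es j z)" if "i < n" for i
        using c(2)[OF esE[OF that] z] sum.reindex_bij_betw[OF es, of "\<lambda>e. c (es i) e z * e z"] by simp
      obtain h where h: "h \<in> gen R E" "1 = h z" using span complex_poly_fun.const[of 1] z by blast
      obtain d where "h = (\<lambda>z. \<Sum>e\<in>E. d e z * e z)"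
        using gen_coeffs[OF R E(1) h(1)] by blast
      then have "(1::complex) = (\<Sum>e\<in>E. d e z * e z)" using h(2) by simp
      then obtain e where e: "e \<in> E" "e z \<noteq> 0"
        by (metis (no_types, lifting) mult_zero_right sum.neutral zero_neq_one)
      then show "\<exists>i<n. es i z \<noteq> 0"
        using es unfolding bij_betw_def by force
    qed
    then show "1 + (\<Sum>i<n. a i z) = 0" by simp
  qed
qed

subsection \<open>Linear projections\<close>

definition clin :: "(complex ^ 'm \<Rightarrow> complex ^ 'n) \<Rightarrow> bool" where
  "clin P \<longleftrightarrow> (\<forall>x y. P (x + y) = P x + P y) \<and> (\<forall>c x. P (c *s x) = c *s P x)"

definition clform :: "(complex ^ 'm \<Rightarrow> complex) \<Rightarrow> bool" where
  "clform l \<longleftrightarrow> (\<forall>x y. l (x + y) = l x + l y) \<and> (\<forall>c x. l (c *s x) = c * l x)"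

lemma clinD:
  assumes "clin P" shows clin_add: "P (x + y) = P x + P y" and clin_scale: "P (c *s x) = c *s P x"
  using assms by (auto simp: clin_def)

lemma clformD:
  assumes "clform l" shows clform_add: "l (x + y) = l x + l y" and clform_scale: "l (c *s x) = c * l x"
  using assms by (auto simp: clform_def)

lemma clin_0: assumes "clin P" shows "P 0 = 0"
  using clin_scale[OF assms, of 0 0] by simp

lemma clform_0: assumes "clform l" shows "l 0 = 0"
  using clform_scale[OF assms, of 0 0] by simp

lemma clin_diff: assumes "clin P" shows "P (x - y) = P x - P y"
  using clin_add[OF assms, of "x - y" y] by simp

lemma clform_diff: assumes "clform l" shows "l (x - y) = l x - l y"
  using clform_add[OF assms, of "x - y" y] by simp

lemma clin_linear: "clin P \<Longrightarrow> Vector_Spaces.linear (*s) (*s) P"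
  by (simp add: Vector_Spaces.linear_iff clin_def vec.vector_space_axioms)

lemma clform_coord: "clform (\<lambda>z. z $ i)"
  by (simp add: clform_def)

lemma clform_comp: "clform l \<Longrightarrow> clin P \<Longrightarrow> clform (\<lambda>z. l (P z))"
  by (simp add: clform_def clin_def)

lemma clform_sum: assumes "clform l" shows "l (\<Sum>i\<in>I. f i) = (\<Sum>i\<in>I. l (f i))"
  by (induction I rule: infinite_finite_induct) (auto simp: clform_0[OF assms] clform_add[OF assms])

lemma clform_complex_poly_fun:
  assumes "clform l" shows "complex_poly_fun l"
proof -
  have "l = (\<lambda>z. \<Sum>i\<in>UNIV. z $ i * l (axis i 1))"
  proof
    show "l z = (\<Sum>i\<in>UNIV. z $ i * l (axis i 1))" for z
      using clform_sum[OF assms, of "\<lambda>i. z $ i *s axis i 1" UNIV]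
      by (simp add: basis_expansion clform_scale[OF assms])
  qed
  moreover have "complex_poly_fun (\<lambda>z. \<Sum>i\<in>UNIV. z $ i * l (axis i 1))"
    by (intro complex_poly_fun_sum complex_poly_fun.intros)
  ultimately show ?thesis by simp
qed

lemma complex_poly_fun_comp_clin:
  assumes "complex_poly_fun f" "clin P" shows "complex_poly_fun (\<lambda>z. f (P z))"
  using assms(1)
proof induction
  case (coord i)
  show ?case by (intro clform_complex_poly_fun clform_comp[OF clform_coord assms(2)])
qed (auto intro: complex_poly_fun.intros)

lemma subspace_range_clin: "clin P \<Longrightarrow> vec.subspace (range P)"
  unfolding vec.subspace_def by (auto simp: image_iff) (metis clin_0, metis clin_add, metis clin_scale)

text \<open>The polynomial ring of the image of \<open>P\<close>. Projections are endomorphisms of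
  one space, so the rank can drop during an induction while the type stays fixed.\<close>

definition pull :: "(complex ^ 'm \<Rightarrow> complex ^ 'm) \<Rightarrow> (complex ^ 'm \<Rightarrow> complex) set" where
  "pull P = {\<lambda>z. f (P z) | f. complex_poly_fun f}"

lemma fun_subring_pull: "fun_subring (pull P)"
  unfolding fun_subring_def pull_def
proof (intro conjI allI ballI)
  show "(\<lambda>_. c) \<in> {\<lambda>z. f (P z) | f. complex_poly_fun f}" for c
    by (intro CollectI exI[of _ "\<lambda>_. c"]) (simp add: complex_poly_fun.const)
next
  fix f g assume "f \<in> {\<lambda>z. f (P z) | f. complex_poly_fun f}" "g \<in> {\<lambda>z. f (P z) | f. complex_poly_fun f}"
  then obtain f' g' where "f = (\<lambda>z. f' (P z))" "complex_poly_fun f'" "g = (\<lambda>z. g' (P z))" "complex_poly_fun g'"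
    by blast
  then show "(\<lambda>z. f z + g z) \<in> {\<lambda>z. f (P z) | f. complex_poly_fun f}"
      "(\<lambda>z. f z * g z) \<in> {\<lambda>z. f (P z) | f. complex_poly_fun f}"
    by (auto intro: exI[of _ "\<lambda>z. f' z + g' z"] exI[of _ "\<lambda>z. f' z * g' z"]
        complex_poly_fun.add complex_poly_fun.mult)
qed

lemma pull_complex_poly_fun: "clin P \<Longrightarrow> pull P \<subseteq> Collect complex_poly_fun"
  unfolding pull_def using complex_poly_fun_comp_clin by blast

lemma pull_apply:
  assumes "r \<in> pull P" "P z = P w" shows "r z = r w"
  using assms by (auto simp: pull_def)

subsection \<open>Homogeneous components and expansion along a direction\<close>

inductive homog :: "nat \<Rightarrow> (complex ^ 'm \<Rightarrow> complex) \<Rightarrow> bool" where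
  zero: "homog n (\<lambda>_. 0)"
| const: "homog 0 (\<lambda>_. c)"
| coord: "homog 1 (\<lambda>z. z $ i)"
| add: "homog n f \<Longrightarrow> homog n g \<Longrightarrow> homog n (\<lambda>z. f z + g z)"
| mult: "homog n f \<Longrightarrow> homog m g \<Longrightarrow> homog (n + m) (\<lambda>z. f z * g z)"

lemma homog_sum: "(\<And>i. i \<in> I \<Longrightarrow> homog n (f i)) \<Longrightarrow> homog n (\<lambda>z. \<Sum>i\<in>I. f i z)"
  by (induction I rule: infinite_finite_induct) (auto intro: homog.zero homog.add)

lemma homog_scale: "homog n f \<Longrightarrow> f (t *s z) = t ^ n * f z"
  by (induction rule: homog.induct) (auto simp: algebra_simps power_add)

lemma homog_decomposition:
  assumes "complex_poly_fun f"
  shows "\<exists>D F. (\<forall>i. homog i (F i)) \<and> (\<forall>i>D. \<forall>z. F i z = 0) \<and> (\<forall>z. f z = (\<Sum>i\<le>D. F i z))"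
  using assms
proof induction
  case (const c)
  show ?case
    by (intro exI[of _ 0] exI[of _ "\<lambda>i. if i = 0 then (\<lambda>_. c) else (\<lambda>_. 0)"])
       (auto intro: homog.intros)
next
  case (coord j)
  show ?case
    by (intro exI[of _ 1] exI[of _ "\<lambda>i. if i = 1 then (\<lambda>z. z $ j) else (\<lambda>_. 0)"])
       (auto intro: homog.coord[unfolded One_nat_def] homog.zero)
next
  case (add f g)
  then obtain D F D' G where F: "\<forall>i. homog i (F i)" "\<forall>i>D. \<forall>z. F i z = 0" "\<forall>z. f z = (\<Sum>i\<le>D. F i z)"
    and G: "\<forall>i. homog i (G i)" "\<forall>i>D'. \<forall>z. G i z = 0" "\<forall>z. g z = (\<Sum>i\<le>D'. G i z)" by blast
  have "(\<Sum>i\<le>D. F i z) = (\<Sum>i\<le>max D D'. F i z)" for z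
    by (rule sum.mono_neutral_left) (use F(2) in auto)
  moreover have "(\<Sum>i\<le>D'. G i z) = (\<Sum>i\<le>max D D'. G i z)" for z
    by (rule sum.mono_neutral_left) (use G(2) in auto)
  ultimately show ?case
    using F G by (intro exI[of _ "max D D'"] exI[of _ "\<lambda>i z. F i z + G i z"])
      (auto intro: homog.add simp: sum.distrib)
next
  case (mult f g)
  then obtain D F D' G where F: "\<forall>i. homog i (F i)" "\<forall>i>D. \<forall>z. F i z = 0" "\<forall>z. f z = (\<Sum>i\<le>D. F i z)"
    and G: "\<forall>i. homog i (G i)" "\<forall>i>D'. \<forall>z. G i z = 0" "\<forall>z. g z = (\<Sum>i\<le>D'. G i z)" by blast
  define H where "H r z = (\<Sum>k\<le>r. F k z * G (r - k) z)" for r z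
  have "f z * g z = (\<Sum>r\<le>D + D'. H r z)" for z
    using polynomial_product[of D "\<lambda>i. F i z" D' "\<lambda>i. G i z" 1] F(2,3) G(2,3) by (simp add: H_def)
  moreover have "homog r (H r)" for r
    unfolding H_def
  proof (rule homog_sum)
    fix k assume "k \<in> {..r}"
    then show "homog r (\<lambda>z. F k z * G (r - k) z)"
      using homog.mult[of k "F k" "r - k" "G (r - k)"] F(1) G(1) by simp
  qed
  moreover have "H r z = 0" if "r > D + D'" for r z
    unfolding H_def
  proof (rule sum.neutral, rule ballI)
    fix k assume "k \<in> {..r}"
    then have "k > D \<or> r - k > D'" using that by auto
    then show "F k z * G (r - k) z = 0" using F(2) G(2) by auto
  qed
  ultimately show ?case by (intro exI[of _ "D + D'"] exI[of _ H]) auto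
qed

lemma coeff_mult_degree_bounds:
  fixes p q :: "complex poly"
  assumes "degree p \<le> n" "degree q \<le> m"
  shows "coeff (p * q) (n + m) = coeff p n * coeff q m"
proof -
  have "coeff (p * q) (n + m) = (\<Sum>i\<le>n + m. if i = n then coeff p n * coeff q m else 0)"
    unfolding coeff_mult
  proof (rule sum.cong)
    fix i assume "i \<in> {..n + m}"
    show "coeff p i * coeff q (n + m - i) = (if i = n then coeff p n * coeff q m else 0)"
    proof (cases i n rule: linorder_cases)
      case less
      then have "degree q < n + m - i" using assms(2) by simp
      then show ?thesis using less by (simp add: coeff_eq_0)
    next
      case greater
      then have "degree p < i" using assms(1) by simp
      then show ?thesis using greater by (simp add: coeff_eq_0)
    qed simp
  qed simp
  then show ?thesis by simp
qed

text \<open>Taylor expansion along \<open>v\<close> with \<open>D\<close> as a mere degree bound.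
  The coefficient in degree \<open>D\<close> is one constant \<open>c\<close> for all base points;
  when \<open>c\<close> is nonzero the expansion is monic up to a scalar, the form that Noether
  normalisation asks for.\<close>

definition expansion ::
    "(complex ^ 'm \<Rightarrow> complex) \<Rightarrow> complex ^ 'm \<Rightarrow> nat \<Rightarrow> complex \<Rightarrow> (complex ^ 'm \<Rightarrow> complex poly) \<Rightarrow> bool"
  where "expansion f v D c Q \<longleftrightarrow> (\<forall>k. complex_poly_fun (\<lambda>y. coeff (Q y) k)) \<and>
    (\<forall>y. degree (Q y) \<le> D \<and> coeff (Q y) D = c \<and> (\<forall>t. f (y + t *s v) = poly (Q y) t))"

lemma expansionD:
  assumes "expansion f v D c Q"
  shows "complex_poly_fun (\<lambda>y. coeff (Q y) k)" "degree (Q y) \<le> D" "coeff (Q y) D = c"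
    "f (y + t *s v) = poly (Q y) t"
  using assms unfolding expansion_def by blast+

lemma homog_expand:
  fixes v :: "complex ^ 'm"
  assumes "homog n f"
  shows "\<exists>Q. expansion f v n (f v) Q"
  using assms unfolding expansion_def
proof induction
  case (zero n)
  show ?case by (intro exI[of _ "\<lambda>_. 0"]) (auto intro: complex_poly_fun.const)
next
  case (const c)
  show ?case by (intro exI[of _ "\<lambda>_. [:c:]"]) (auto intro: complex_poly_fun.const)
next
  case (coord i)
  have "complex_poly_fun (\<lambda>y. coeff [:y $ i, v $ i:] k)" for k
    by (cases k) (auto simp: coeff_pCons split: nat.splits intro: complex_poly_fun.intros)
  then show ?case by (intro exI[of _ "\<lambda>y. [:y $ i, v $ i:]"]) auto
next
  case (add n f g)
  then obtain Q Q' where "\<forall>k. complex_poly_fun (\<lambda>y. coeff (Q y) k)"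
    "\<forall>y. degree (Q y) \<le> n \<and> coeff (Q y) n = f v \<and> (\<forall>t. f (y + t *s v) = poly (Q y) t)"
    "\<forall>k. complex_poly_fun (\<lambda>y. coeff (Q' y) k)"
    "\<forall>y. degree (Q' y) \<le> n \<and> coeff (Q' y) n = g v \<and> (\<forall>t. g (y + t *s v) = poly (Q' y) t)" by blast
  then show ?case
    by (intro exI[of _ "\<lambda>y. Q y + Q' y"]) (auto intro: complex_poly_fun.add degree_add_le)
next
  case (mult n f m g)
  then obtain Q Q' where Q: "\<forall>k. complex_poly_fun (\<lambda>y. coeff (Q y) k)"
    "\<forall>y. degree (Q y) \<le> n \<and> coeff (Q y) n = f v \<and> (\<forall>t. f (y + t *s v) = poly (Q y) t)"
    "\<forall>k. complex_poly_fun (\<lambda>y. coeff (Q' y) k)"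
    "\<forall>y. degree (Q' y) \<le> m \<and> coeff (Q' y) m = g v \<and> (\<forall>t. g (y + t *s v) = poly (Q' y) t)" by blast
  have "degree (Q y * Q' y) \<le> n + m" for y
    using Q by (meson add_mono degree_mult_le order_trans)
  moreover have "complex_poly_fun (\<lambda>y. coeff (Q y * Q' y) k)" for k
    unfolding coeff_mult using Q by (intro complex_poly_fun_sum complex_poly_fun.mult) auto
  ultimately show ?case
    using Q by (intro exI[of _ "\<lambda>y. Q y * Q' y"]) (auto simp: coeff_mult_degree_bounds)
qed

text \<open>\<open>h\<close> is the leading form: components of lower degree cannot reach
  \<open>t ^ D\<close>, so only \<open>F D\<close> contributes there.\<close>

lemma top_form:
  fixes f :: "complex ^ 'm \<Rightarrow> complex"
  assumes "complex_poly_fun f"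
  obtains D h where "homog D h" "(\<exists>z. f z \<noteq> 0) \<Longrightarrow> \<exists>v. h v \<noteq> 0"
    "\<And>v. \<exists>Q. expansion f v D (h v) Q"
proof -
  obtain D0 F where F: "\<forall>i. homog i (F i)" "\<forall>i>D0. \<forall>z. F i z = 0" "\<forall>z. f z = (\<Sum>i\<le>D0. F i z)"
    using homog_decomposition[OF assms] by blast
  define D where "D = (if \<exists>z. f z \<noteq> 0 then Max {i. i \<le> D0 \<and> (\<exists>z. F i z \<noteq> 0)} else D0)"
  have D: "f z = (\<Sum>i\<le>D. F i z) \<and> (f z \<noteq> 0 \<longrightarrow> (\<exists>v. F D v \<noteq> 0))" for z
  proof (cases "\<exists>z. f z \<noteq> 0")
    case True
    let ?S = "{i. i \<le> D0 \<and> (\<exists>z. F i z \<noteq> 0)}"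
    have "?S \<noteq> {}" using True F(3) by (metis (mono_tags, lifting) atMost_iff empty_Collect_eq sum.neutral)
    moreover have "finite ?S" by simp
    moreover have "D = Max ?S" using True by (simp add: D_def)
    ultimately have "D \<in> ?S" and "\<And>i. i \<in> ?S \<Longrightarrow> i \<le> D"
      using Max_in[of ?S] Max_ge[of ?S] by simp_all
    moreover have "(\<Sum>i\<le>D0. F i z) = (\<Sum>i\<le>D. F i z)" for z
      by (rule sum.mono_neutral_right) (use calculation in \<open>auto simp: not_le\<close>)
    ultimately show ?thesis using F(3) by auto
  qed (use F(3) in \<open>auto simp: D_def\<close>)
  have "\<exists>Q. expansion f v D (F D v) Q" for v
  proof -
    have "\<forall>i. \<exists>Q. expansion (F i) v i (F i v) Q"
      using homog_expand F(1) by blast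
    from choice[OF this] obtain Q where "\<forall>i. expansion (F i) v i (F i v) (Q i)" ..
    note Q = expansionD[OF this[rule_format]]
    have "coeff (\<Sum>i\<le>D. Q i y) D = F D v" for y
    proof -
      have "coeff (\<Sum>i\<le>D. Q i y) D = (\<Sum>i\<le>D. if i = D then F D v else 0)"
        unfolding coeff_sum
      proof (rule sum.cong)
        fix i assume "i \<in> {..D}"
        then show "coeff (Q i y) D = (if i = D then F D v else 0)"
          using Q(2)[of i y] Q(3)[of i y] by (cases "i = D") (auto intro!: coeff_eq_0)
      qed simp
      then show ?thesis by simp
    qed
    moreover have "degree (\<Sum>i\<le>D. Q i y) \<le> D" for y
      by (rule degree_sum_le) (auto intro: order_trans[OF Q(2)])
    moreover have "complex_poly_fun (\<lambda>y. coeff (\<Sum>i\<le>D. Q i y) k)" for k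
      unfolding coeff_sum using Q(1) by (rule complex_poly_fun_sum)
    moreover have "f (y + t *s v) = poly (\<Sum>i\<le>D. Q i y) t" for y t
      using D Q(4) by (simp add: poly_sum)
    ultimately show ?thesis unfolding expansion_def
      by (intro exI[of _ "\<lambda>y. \<Sum>i\<le>D. Q i y"]) auto
  qed
  with D F(1) show thesis by (intro that[of D "F D"]) auto
qed

subsection \<open>Noether normalisation\<close>

text \<open>On \<open>X\<close> the relation \<open>g\<close>, expanded along \<open>v\<close> from
  the base point \<open>P' z\<close>, is an equation for \<tau> that is monic up to \<open>c\<close>
  and has coefficients in \<open>pull P'\<close>. So finitely many powers of \<tau> suffice to pass
  from \<open>pull P\<close> to \<open>pull P'\<close>.\<close>

lemma finite_over_eliminate_direction:
  fixes X :: "(complex ^ 'm) set"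
  assumes P: "clin P" and PP: "\<And>z. P (P z) = P z" and fin: "finite_over (pull P) X"
    and gX: "\<And>z. z \<in> X \<Longrightarrow> g (P z) = 0"
    and expn: "expansion (\<lambda>z. g (P z)) v D c Q"
    and c: "c \<noteq> 0" and Pv: "P v = v" and l: "clform l"
  defines "P' \<equiv> \<lambda>z. P z - l (P z) *s v"
  shows "finite_over (pull P') X"
proof -
  note Q = expansionD[OF expn]
  define \<tau> where "\<tau> z = l (P z)" for z
  have \<tau>: "complex_poly_fun \<tau>" unfolding \<tau>_def by (intro clform_complex_poly_fun clform_comp[OF l P])
  have decomp: "P z = P' z + \<tau> z *s v" for z by (simp add: P'_def \<tau>_def)
  obtain E where E: "finite E" "\<forall>e\<in>E. complex_poly_fun e"
    and span: "\<forall>f. complex_poly_fun f \<longrightarrow> (\<exists>h\<in>gen (pull P) E. \<forall>z\<in>X. f z = h z)"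
    using fin unfolding finite_over_def by blast
  define E' where "E' = (\<lambda>(e, j) z. e z * \<tau> z ^ j) ` (E \<times> {..<D})"
  note R' = fun_subring_pull[of P']
  define spn where "spn f \<longleftrightarrow> (\<exists>h\<in>gen (pull P') E'. \<forall>z\<in>X. f z = h z)" for f
  have spn_add: "spn (\<lambda>z. f z + g z)" if "spn f" "spn g" for f g
    using that gen_add unfolding spn_def by (metis (no_types, lifting))
  have spn_smult: "spn (\<lambda>z. r z * f z)" if "spn f" "r \<in> pull P'" for f r
    using that gen_smult[OF R'] unfolding spn_def by (metis (no_types, lifting))
  have spn_zero: "spn (\<lambda>z. 0)" unfolding spn_def by (intro bexI[OF _ gen.zero]) simp
  have spn_sum: "spn (\<lambda>z. \<Sum>i\<in>I. f i z)" if "\<And>i. i \<in> I \<Longrightarrow> spn (f i)" for f and I :: "nat set"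
    using that by (induction I rule: infinite_finite_induct) (auto intro: spn_zero spn_add)
  have coeff_pull: "(\<lambda>z. coeff (q (P' z)) k) \<in> pull P'"
    if "complex_poly_fun (\<lambda>y. coeff (q y) k)" for q :: "_ \<Rightarrow> complex poly" and k
    unfolding pull_def using that by (intro CollectI exI[of _ "\<lambda>y. coeff (q y) k"]) simp
  have powers: "spn (\<lambda>z. e z * \<tau> z ^ i)" if e: "e \<in> E" for e i
  proof (induction i rule: less_induct)
    case (less i)
    show ?case
    proof (cases "i < D")
      case True
      then have "(\<lambda>z. e z * \<tau> z ^ i) \<in> E'" unfolding E'_def using e by force
      then show ?thesis unfolding spn_def by (intro bexI[OF _ gen_incl[OF R']]) auto
    next
      case False
      \<comment> \<open>Exponents from \<open>D\<close> on are lowered with the equation solved for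
        \<open>\<tau> z ^ D\<close>; every exponent \<open>i - D + j\<close> with
        \<open>j < D\<close> is smaller than \<open>i\<close>.\<close>
      have "spn (\<lambda>z. (-1 / c) * (\<Sum>j<D. coeff (Q (P' z)) j * (e z * \<tau> z ^ (i - D + j))))"
        by (rule spn_smult[OF spn_sum[OF spn_smult]])
           (use False in \<open>auto intro!: less.IH coeff_pull Q fun_subring_const[OF R']\<close>)
      moreover have "e z * \<tau> z ^ i = (-1 / c) * (\<Sum>j<D. coeff (Q (P' z)) j * (e z * \<tau> z ^ (i - D + j)))"
        if "z \<in> X" for z
      proof -
        have "P (P' z + \<tau> z *s v) = P z" using decomp PP by metis
        then have "0 = poly (Q (P' z)) (\<tau> z)" using Q(4)[of "P' z" "\<tau> z"] gX[OF that] by simp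
        also have "\<dots> = (\<Sum>j\<le>D. coeff (Q (P' z)) j * \<tau> z ^ j)"
          unfolding poly_altdef
          by (rule sum.mono_neutral_left) (use Q(2)[of "P' z"] in \<open>auto simp: coeff_eq_0 not_le\<close>)
        also have "\<dots> = (\<Sum>j<D. coeff (Q (P' z)) j * \<tau> z ^ j) + c * \<tau> z ^ D"
          by (simp add: Q(3) flip: lessThan_Suc_atMost)
        finally have "\<tau> z ^ D = (-1 / c) * (\<Sum>j<D. coeff (Q (P' z)) j * \<tau> z ^ j)"
          using c by (simp add: field_simps eq_neg_iff_add_eq_0 add.commute)
        moreover have "e z * \<tau> z ^ i = e z * \<tau> z ^ (i - D) * \<tau> z ^ D"
          using False by (simp flip: power_add)
        ultimately show ?thesis by (simp add: sum_distrib_left power_add mult_ac)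
      qed
      ultimately show ?thesis unfolding spn_def by simp
    qed
  qed
  have "spn h" if "h \<in> gen (pull P) E" for h
    using that
  proof induction
    case zero
    show ?case by (rule spn_zero)
  next
    case (step h r e)
    obtain r' where r': "r = (\<lambda>z. r' (P z))" "complex_poly_fun r'"
      using step(2) unfolding pull_def by blast
    obtain N c' q where "expansion r' v N c' q"
      using top_form[OF r'(2)] by metis
    note q = expansionD[OF this]
    have "r z * e z = (\<Sum>i\<le>N. coeff (q (P' z)) i * (e z * \<tau> z ^ i))" for z
    proof -
      have "r z = poly (q (P' z)) (\<tau> z)" unfolding r'(1) by (subst decomp) (rule q(4))
      also have "\<dots> = (\<Sum>i\<le>N. coeff (q (P' z)) i * \<tau> z ^ i)"
        unfolding poly_altdef
        by (rule sum.mono_neutral_left) (use q(2)[of "P' z"] in \<open>auto simp: coeff_eq_0 not_le\<close>)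
      finally show ?thesis by (simp add: sum_distrib_left mult_ac)
    qed
    moreover have "spn (\<lambda>z. \<Sum>i\<le>N. coeff (q (P' z)) i * (e z * \<tau> z ^ i))"
      by (intro spn_sum spn_smult powers step(3) coeff_pull q)
    ultimately show ?case using spn_add[OF step(4)] by simp
  qed
  then have "\<exists>h\<in>gen (pull P') E'. \<forall>z\<in>X. f z = h z" if "complex_poly_fun f" for f
    using span that unfolding spn_def by (metis (no_types, lifting))
  moreover have "finite E'" unfolding E'_def using E(1) by simp
  moreover have "\<forall>e\<in>E'. complex_poly_fun e"
    unfolding E'_def using E(2) \<tau> by (auto intro: complex_poly_fun.mult complex_poly_fun_power)
  ultimately show ?thesis unfolding finite_over_def by blast
qed

text \<open>The directions that can be eliminated are those on which the leading form
  \<open>h\<close> of the relation does not vanish. Keeping \<open>h\<close> in the conclusion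
  leaves the choice to the caller, who may want a direction near a prescribed one.\<close>

lemma normalization_step:
  fixes X :: "(complex ^ 'm) set"
  assumes P: "clin P" and PP: "\<And>z. P (P z) = P z" and fin: "finite_over (pull P) X"
    and g: "complex_poly_fun g" "\<exists>z. g (P z) \<noteq> 0" and gX: "\<And>z. z \<in> X \<Longrightarrow> g (P z) = 0"
  obtains D h w where "homog D h" "P w = w" "h w \<noteq> 0"
    "\<And>v l. P v = v \<Longrightarrow> h v \<noteq> 0 \<Longrightarrow> clform l \<Longrightarrow> finite_over (pull (\<lambda>z. P z - l (P z) *s v)) X"
proof -
  obtain D h where h: "homog D h" "(\<exists>z. g (P z) \<noteq> 0) \<Longrightarrow> \<exists>v. h v \<noteq> 0"
    and Q: "\<And>v. \<exists>Q. expansion (\<lambda>z. g (P z)) v D (h v) Q"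
    using top_form[OF complex_poly_fun_comp_clin[OF g(1) P]] by blast
  obtain u where u: "h u \<noteq> 0" using h(2) g(2) by blast
  \<comment> \<open>From the origin, \<open>u\<close> and \<open>P u\<close> give the same expansion
    because \<open>P\<close> is idempotent; so a good direction exists inside the range of
    \<open>P\<close>.\<close>
  have "h (P u) = h u"
  proof -
    obtain q1 where q1: "coeff q1 D = h u" "\<And>t. g (P (0 + t *s u)) = poly q1 t"
      using Q[of u] expansionD(3,4) by metis
    obtain q2 where q2: "coeff q2 D = h (P u)" "\<And>t. g (P (0 + t *s P u)) = poly q2 t"
      using Q[of "P u"] expansionD(3,4) by metis
    have "poly q1 t = poly q2 t" for t
      using q1(2)[of t] q2(2)[of t] by (simp add: clin_scale[OF P] PP)
    then have "q1 = q2" by (simp add: poly_eq_poly_eq_iff[symmetric] fun_eq_iff)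
    then show ?thesis using q1(1) q2(1) by simp
  qed
  moreover have "finite_over (pull (\<lambda>z. P z - l (P z) *s v)) X"
    if v: "P v = v" "h v \<noteq> 0" "clform l" for v l
  proof -
    obtain Qv where "expansion (\<lambda>z. g (P z)) v D (h v) Qv"
      using Q[of v] by blast
    then show ?thesis
      by (intro finite_over_eliminate_direction[where g = g, OF P PP fin])
         (use v gX in auto)
  qed
  ultimately show thesis using that[OF h(1), of "P u"] PP u by metis
qed

text \<open>The rank drops because \<open>l\<close> vanishes on the new range but not at
  \<open>v\<close>, which is in the old one.\<close>

lemma clin_eliminate_direction:
  assumes P: "clin P" and PP: "\<And>z. P (P z) = P z" and Pv: "P v = v" and l: "clform l" and lv: "l v = 1"
  defines "P' \<equiv> \<lambda>z. P z - l (P z) *s v"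
  shows "clin P'" "P' (P' z) = P' z" "P (P' z) = P' z" "l (P (P' z)) = 0"
    "vec.dim (range P') < vec.dim (range P)"
proof -
  show clin: "clin P'"
    unfolding clin_def P'_def
    by (simp add: clin_add[OF P] clin_scale[OF P] clform_add[OF l] clform_scale[OF l] vec.scale_left_distrib vec.scale_right_diff_distrib)
  have PP': "P (P' z) = P' z" for z
    by (simp add: P'_def clin_diff[OF P] clin_scale[OF P] PP Pv)
  have lP': "l (P' z) = 0" for z
    by (simp add: P'_def clform_diff[OF l] clform_scale[OF l] lv)
  show "P (P' z) = P' z" "l (P (P' z)) = 0" using PP' lP' by auto
  show "P' (P' z) = P' z"
    unfolding P'_def[of] using PP'[of z] lP'[of z] by (simp add: P'_def)
  have "range P' \<subseteq> range P" using PP' by (metis image_subsetI rangeI)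
  moreover have "v \<in> range P" using Pv by (metis rangeI)
  moreover have "v \<notin> range P'" using lP' lv by (metis imageE zero_neq_one)
  ultimately show "vec.dim (range P') < vec.dim (range P)"
    using vec.subspace_dim_equal[OF subspace_range_clin[OF clin] subspace_range_clin[OF P]]
    by (metis not_less)
qed

subsection \<open>Irreducible sets and their dimension\<close>

text \<open>Primality of the vanishing ideal; it agrees with topological irreducibility by
  \<open>irreducible_in_zariski_iff\<close>.\<close>

definition irred :: "(complex ^ 'm) set \<Rightarrow> bool" where
  "irred A \<longleftrightarrow> A \<noteq> {} \<and> (\<forall>f g. complex_poly_fun f \<longrightarrow> complex_poly_fun g \<longrightarrow>
     (\<forall>z\<in>A. f z * g z = 0) \<longrightarrow> (\<forall>z\<in>A. f z = 0) \<or> (\<forall>z\<in>A. g z = 0))"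

lemma irredD:
  "irred A \<Longrightarrow> complex_poly_fun f \<Longrightarrow> complex_poly_fun g \<Longrightarrow> (\<And>z. z \<in> A \<Longrightarrow> f z * g z = 0) \<Longrightarrow>
     (\<forall>z\<in>A. f z = 0) \<or> (\<forall>z\<in>A. g z = 0)"
  unfolding irred_def by blast

text \<open>The constant term of a monic equation of least degree plays the role of the norm of \<open>f\<close>.\<close>

lemma irred_norm:
  assumes R: "fun_subring R" "R \<subseteq> Collect complex_poly_fun" and Z: "irred Z" and fin: "finite_over R Z"
    and f: "complex_poly_fun f" "\<exists>z\<in>Z. f z \<noteq> 0"
  obtains a where "a \<in> R" "\<exists>z\<in>Z. a z \<noteq> 0" "\<And>z. z \<in> Z \<Longrightarrow> f z = 0 \<Longrightarrow> a z = 0"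
proof -
  define monic where "monic n \<longleftrightarrow>
    (\<exists>a. (\<forall>i. a i \<in> R) \<and> (\<forall>z\<in>Z. f z ^ n + (\<Sum>i<n. a i z * f z ^ i) = 0))" for n
  have "\<exists>n. monic n"
    using finite_over_integral[OF R(1) fin f(1)] unfolding monic_def by metis
  then obtain n where n: "monic n" and least: "\<And>k. monic k \<Longrightarrow> n \<le> k"
    by (metis Least_le LeastI)
  obtain a where a: "\<And>i. a i \<in> R" "\<And>z. z \<in> Z \<Longrightarrow> f z ^ n + (\<Sum>i<n. a i z * f z ^ i) = 0"
    using n unfolding monic_def by blast
  have "n \<noteq> 0"
  proof
    assume "n = 0"
    then show False using a(2) f(2) by fastforce
  qed
  then obtain m where m: "n = Suc m" by (cases n) auto
  have eq: "f z * (f z ^ m + (\<Sum>i<m. a (Suc i) z * f z ^ i)) + a 0 z = 0" if "z \<in> Z" for z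
    using a(2)[OF that] unfolding m by (subst (asm) sum.lessThan_Suc_shift) (simp add: algebra_simps sum_distrib_left)
  show thesis
  proof (rule that[OF a(1)[of 0]])
    show "a 0 z = 0" if "z \<in> Z" "f z = 0" for z using eq[OF that(1)] that(2) by simp
    show "\<exists>z\<in>Z. a 0 z \<noteq> 0"
    proof (rule ccontr)
      assume "\<not> (\<exists>z\<in>Z. a 0 z \<noteq> 0)"
      \<comment> \<open>Without the constant term, irreducibility cancels the factor
        \<open>f\<close> and a monic equation of degree \<open>m\<close> is left, against
        minimality.\<close>
      then have "f z * (f z ^ m + (\<Sum>i<m. a (Suc i) z * f z ^ i)) = 0" if "z \<in> Z" for z
        using eq[OF that] that by simp
      moreover have "complex_poly_fun (\<lambda>z. f z ^ m + (\<Sum>i<m. a (Suc i) z * f z ^ i))"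
        using a(1) R(2) f(1)
        by (intro complex_poly_fun.intros complex_poly_fun_sum complex_poly_fun_power) auto
      ultimately have "\<forall>z\<in>Z. f z ^ m + (\<Sum>i<m. a (Suc i) z * f z ^ i) = 0"
        using irredD[OF Z f(1)] f(2) by blast
      then have "monic m" unfolding monic_def using a(1) by (intro exI[of _ "\<lambda>i. a (Suc i)"]) auto
      then show False using least m by force
    qed
  qed
qed

text \<open>Strictness is witnessed by a polynomial: the Zariski closures differ. The ambient space
  does not enter, so one chain can be read in several of them.\<close>

definition irred_chain :: "nat \<Rightarrow> (nat \<Rightarrow> (complex ^ 'm) set) \<Rightarrow> bool" where
  "irred_chain n Z \<longleftrightarrow> (\<forall>i\<le>n. irred (Z i)) \<and>
     (\<forall>i<n. Z i \<subseteq> Z (Suc i) \<and>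
        (\<exists>f. complex_poly_fun f \<and> (\<forall>z\<in>Z i. f z = 0) \<and> (\<exists>z\<in>Z (Suc i). f z \<noteq> 0)))"

text \<open>Dimension is bounded by rank, with equality only for a dominant projection. A relation
  on the image allows a normalisation step, which lowers the rank; passing to the next smaller
  member of the chain produces such a relation as the norm of a separating polynomial.\<close>

lemma irred_chain_bound:
  fixes Z :: "nat \<Rightarrow> (complex ^ 'm) set"
  assumes "clin P" "\<And>z. P (P z) = P z" "irred_chain n Z" "finite_over (pull P) (Z n)"
  shows "n \<le> vec.dim (range P) \<and>
    (n = vec.dim (range P) \<longrightarrow> (\<forall>f. complex_poly_fun f \<longrightarrow> (\<forall>z\<in>Z n. f (P z) = 0) \<longrightarrow> (\<forall>z. f (P z) = 0)))"
  using assms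
proof (induction "vec.dim (range P)" arbitrary: P n rule: less_induct)
  case less
  note P = less.prems(1,2)
  have strict: "n' < vec.dim (range P)"
    if chain: "irred_chain n' Z" and fin: "finite_over (pull P) (Z n')" and f: "complex_poly_fun f"
      "\<forall>z\<in>Z n'. f (P z) = 0" "\<exists>z. f (P z) \<noteq> 0" for n' f
  proof -
    obtain D h w where h: "homog D h" "P w = w" "h w \<noteq> 0"
      and el: "\<And>v l. P v = v \<Longrightarrow> h v \<noteq> 0 \<Longrightarrow> clform l \<Longrightarrow>
          finite_over (pull (\<lambda>z. P z - l (P z) *s v)) (Z n')"
      using normalization_step[OF P fin f(1,3)] f(2) by blast
    have "\<exists>v l. P v = v \<and> h v \<noteq> 0 \<and> clform l \<and> l v = 1"
    proof (cases "w = 0")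
      \<comment> \<open>\<open>w = 0\<close> forces \<open>h\<close> to be a constant, so any
        nonzero vector in the range of \<open>P\<close> can serve as direction.\<close>
      case True
      have "\<exists>v. P v = v \<and> v \<noteq> 0"
      proof (rule ccontr)
        assume "\<nexists>v. P v = v \<and> v \<noteq> 0"
        then have P0: "P z = 0" for z using P(2) by blast
        obtain z0 where "z0 \<in> Z n'" using chain unfolding irred_chain_def irred_def by blast
        then show False using f(2,3) P0 by auto
      qed
      then obtain v where v: "P v = v" "v \<noteq> 0" by blast
      have "D = 0"
        using homog_scale[OF h(1), of 0 0] h(3) True by (cases D) auto
      then have "h v \<noteq> 0"
        using homog_scale[OF h(1), of 0 v] h(3) True by simp
      moreover obtain i where "v $ i \<noteq> 0" using v(2) by (auto simp: Finite_Cartesian_Product.vec_eq_iff)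
      ultimately show ?thesis using v
        by (intro exI[of _ v] exI[of _ "\<lambda>z. z $ i / v $ i"]) (auto simp: clform_def field_simps)
    next
      case False
      then obtain i where "w $ i \<noteq> 0" by (auto simp: Finite_Cartesian_Product.vec_eq_iff)
      then show ?thesis using h
        by (intro exI[of _ w] exI[of _ "\<lambda>z. z $ i / w $ i"]) (auto simp: clform_def field_simps)
    qed
    then obtain v l where v: "P v = v" "h v \<noteq> 0" "clform l" "l v = 1" by blast
    note P' = clin_eliminate_direction[OF P v(1,3,4)]
    have "n' \<le> vec.dim (range (\<lambda>z. P z - l (P z) *s v))"
      using less.hyps[OF P'(5) P'(1,2) chain el[OF v(1-3)]] by blast
    then show ?thesis using P'(5) by simp
  qed
  have "n \<le> vec.dim (range P)"
  proof (cases n)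
    case (Suc m)
    obtain f where f: "complex_poly_fun f" "\<forall>z\<in>Z m. f z = 0" "\<exists>z\<in>Z n. f z \<noteq> 0"
      using less.prems(3) unfolding irred_chain_def Suc by blast
    have sub: "Z m \<subseteq> Z n" using less.prems(3) unfolding irred_chain_def Suc by blast
    have "irred (Z n)" using less.prems(3) unfolding irred_chain_def by blast
    from irred_norm[OF fun_subring_pull pull_complex_poly_fun[OF P(1)] this less.prems(4) f(1,3)]
    obtain a where a: "a \<in> pull P" "\<exists>z\<in>Z n. a z \<noteq> 0" "\<And>z. z \<in> Z n \<Longrightarrow> f z = 0 \<Longrightarrow> a z = 0"
      by blast
    then obtain a' where a': "complex_poly_fun a'" "a = (\<lambda>z. a' (P z))" unfolding pull_def by blast
    have "irred_chain m Z" using less.prems(3) unfolding irred_chain_def Suc by auto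
    then have "m < vec.dim (range P)"
      using a f(2) sub a'
      by (intro strict[OF _ finite_over_mono[OF less.prems(4) order.refl sub] a'(1)]) auto
    then show ?thesis using Suc by simp
  qed simp
  moreover have "\<forall>z. f (P z) = 0"
    if "n = vec.dim (range P)" "complex_poly_fun f" "\<forall>z\<in>Z n. f (P z) = 0" for f
    using strict[OF less.prems(3,4) that(2,3)] that(1) by auto
  ultimately show ?case by blast
qed

subsection \<open>Hilbert's basis theorem\<close>

lemma sum_shift_power:
  fixes a :: "nat \<Rightarrow> complex"
  assumes "d \<le> N"
  shows "(\<Sum>i\<le>N. (if i < d then 0 else a (i - d)) * t ^ i) = t ^ d * (\<Sum>i\<le>N - d. a i * t ^ i)"
proof -
  have "(\<Sum>i\<le>N. (if i < d then 0 else a (i - d)) * t ^ i) = (\<Sum>i\<in>{d..N}. a (i - d) * t ^ i)"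
    by (rule sum.mono_neutral_cong_right) auto
  also have "\<dots> = (\<Sum>i\<le>N - d. a i * t ^ (i + d))"
    using assms by (intro sum.reindex_bij_witness[of _ "\<lambda>i. i + d" "\<lambda>i. i - d"]) auto
  finally show ?thesis by (simp add: sum_distrib_left power_add mult_ac)
qed

text \<open>The function \<open>t\<close> may be algebraic over \<open>R\<close>, so coefficients
  are not determined by the element; degrees and leading coefficients below belong to a chosen
  representation.\<close>

definition adjoin :: "('p \<Rightarrow> complex) set \<Rightarrow> ('p \<Rightarrow> complex) \<Rightarrow> ('p \<Rightarrow> complex) set" where
  "adjoin R t = {\<lambda>z. \<Sum>i\<le>N. a i z * t z ^ i | N a. \<forall>i. a i \<in> R}"

lemma adjoin_extend_degree:
  assumes R: "fun_subring R" and a: "\<forall>i. a i \<in> R" and "N \<le> M"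
  obtains b where "\<forall>i. b i \<in> R" "\<forall>i>N. b i = (\<lambda>_. 0)"
    "(\<lambda>z. \<Sum>i\<le>N. a i z * t z ^ i) = (\<lambda>z. \<Sum>i\<le>M. b i z * t z ^ i)"
proof
  let ?b = "\<lambda>i. if i \<le> N then a i else (\<lambda>_. 0)"
  show "\<forall>i. ?b i \<in> R" using a fun_subring_const[OF R] by auto
  show "\<forall>i>N. ?b i = (\<lambda>_. 0)" by auto
  show "(\<lambda>z. \<Sum>i\<le>N. a i z * t z ^ i) = (\<lambda>z. \<Sum>i\<le>M. ?b i z * t z ^ i)"
    by (rule ext, rule sum.mono_neutral_cong_left) (use \<open>N \<le> M\<close> in auto)
qed

lemma adjoin_incl: assumes R: "fun_subring R" shows "R \<subseteq> adjoin R t"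
proof
  fix f assume "f \<in> R"
  then show "f \<in> adjoin R t"
    unfolding adjoin_def by (intro CollectI exI[of _ 0] exI[of _ "\<lambda>_. f"]) simp
qed

lemma adjoin_gen: assumes R: "fun_subring R" shows "t \<in> adjoin R t"
  unfolding adjoin_def
  by (intro CollectI exI[of _ 1] exI[of _ "\<lambda>i. if i = 0 then (\<lambda>_. 0) else (\<lambda>_. 1)"])
     (auto simp: fun_subring_const[OF R])

lemma fun_subring_adjoin:
  assumes R: "fun_subring R" shows "fun_subring (adjoin R t)"
  unfolding fun_subring_def
proof (intro conjI allI ballI)
  show "(\<lambda>_. c) \<in> adjoin R t" for c
    using adjoin_incl[OF R] fun_subring_const[OF R] by blast
next
  fix f g assume "f \<in> adjoin R t" "g \<in> adjoin R t"
  then obtain N a M b where f: "f = (\<lambda>z. \<Sum>i\<le>N. a i z * t z ^ i)" "\<forall>i. a i \<in> R"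
    and g: "g = (\<lambda>z. \<Sum>i\<le>M. b i z * t z ^ i)" "\<forall>i. b i \<in> R" unfolding adjoin_def by blast
  obtain a' where a': "\<forall>i. a' i \<in> R" "\<forall>i>N. a' i = (\<lambda>_. 0)"
    "(\<lambda>z. \<Sum>i\<le>N. a i z * t z ^ i) = (\<lambda>z. \<Sum>i\<le>N + M. a' i z * t z ^ i)"
    by (rule adjoin_extend_degree[OF R f(2) le_add1[of N M], where t = t])
  obtain b' where b': "\<forall>i. b' i \<in> R" "\<forall>i>M. b' i = (\<lambda>_. 0)"
    "(\<lambda>z. \<Sum>i\<le>M. b i z * t z ^ i) = (\<lambda>z. \<Sum>i\<le>N + M. b' i z * t z ^ i)"
    by (rule adjoin_extend_degree[OF R g(2) le_add2[of M N], where t = t])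
  show "(\<lambda>z. f z + g z) \<in> adjoin R t"
    unfolding adjoin_def f(1) g(1) fun_cong[OF a'(3)] fun_cong[OF b'(3)]
    using a'(1) b'(1)
    by (intro CollectI exI[of _ "N + M"] exI[of _ "\<lambda>i z. a' i z + b' i z"])
       (auto simp: sum.distrib algebra_simps intro: fun_subring_add[OF R])
  obtain a'' where a'': "\<forall>i. a'' i \<in> R" "\<forall>i>N. a'' i = (\<lambda>_. 0)"
    "(\<lambda>z. \<Sum>i\<le>N. a i z * t z ^ i) = (\<lambda>z. \<Sum>i\<le>N. a'' i z * t z ^ i)"
    by (rule adjoin_extend_degree[OF R f(2) order.refl, where t = t])
  obtain b'' where b'': "\<forall>i. b'' i \<in> R" "\<forall>i>M. b'' i = (\<lambda>_. 0)"
    "(\<lambda>z. \<Sum>i\<le>M. b i z * t z ^ i) = (\<lambda>z. \<Sum>i\<le>M. b'' i z * t z ^ i)"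
    by (rule adjoin_extend_degree[OF R g(2) order.refl, where t = t])
  have "f z * g z = (\<Sum>r\<le>N + M. (\<Sum>k\<le>r. a'' k z * b'' (r - k) z) * t z ^ r)" for z
    unfolding f(1) g(1) fun_cong[OF a''(3)] fun_cong[OF b''(3)]
    by (rule polynomial_product) (use a''(2) b''(2) in auto)
  moreover have "(\<lambda>z. \<Sum>k\<le>r. a'' k z * b'' (r - k) z) \<in> R" for r
    using a''(1) b''(1) by (intro fun_subring_sum[OF R] fun_subring_mult[OF R]) auto
  ultimately show "(\<lambda>z. f z * g z) \<in> adjoin R t"
    unfolding adjoin_def
    by (intro CollectI exI[of _ "N + M"] exI[of _ "\<lambda>r z. \<Sum>k\<le>r. a'' k z * b'' (r - k) z"]) auto
qed

text \<open>The ascending chain condition in the form in which it is both proved and applied: no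
  infinite sequence in which every term is new.\<close>

definition noetherian :: "('p \<Rightarrow> complex) set \<Rightarrow> bool" where
  "noetherian R \<longleftrightarrow> (\<forall>f :: nat \<Rightarrow> _. (\<forall>n. f n \<in> R) \<longrightarrow> (\<exists>n. f n \<in> gen R (f ` {..<n})))"

lemma noetherian_constants: "noetherian (range (\<lambda>c (_ :: 'p). c))"
  unfolding noetherian_def
proof (intro allI impI)
  fix f :: "nat \<Rightarrow> 'p \<Rightarrow> complex" assume f: "\<forall>n. f n \<in> range (\<lambda>c _. c)"
  let ?R = "range (\<lambda>c (_ :: 'p). c) :: ('p \<Rightarrow> complex) set"
  obtain c where c: "f 0 = (\<lambda>_. c)" using f by blast
  obtain d where d: "f (Suc 0) = (\<lambda>_. d)" using f by blast
  show "\<exists>n. f n \<in> gen ?R (f ` {..<n})"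
  proof (cases "c = 0")
    case True
    then have "f 0 \<in> gen ?R (f ` {..<0})" using c gen.zero by simp
    then show ?thesis ..
  next
    case False
    have "(\<lambda>z. 0 + (\<lambda>_. d / c) z * f 0 z) \<in> gen ?R (f ` {..<Suc 0})"
      by (rule gen.step[OF gen.zero]) auto
    then have "f (Suc 0) \<in> gen ?R (f ` {..<Suc 0})" using False by (simp add: c d)
    then show ?thesis ..
  qed
qed

text \<open>Hilbert's argument: generators are picked greedily, each of least degree outside the
  ideal of its predecessors. Degrees never fall, so once a leading coefficient depends on the
  earlier ones, a combination of earlier generators cancels it and yields a smaller degree.\<close>

lemma noetherian_adjoin:
  fixes R :: "('p \<Rightarrow> complex) set"
  assumes R: "fun_subring R" and noeth: "noetherian R"
  shows "noetherian (adjoin R t)"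
  unfolding noetherian_def
proof (intro allI impI, rule ccontr)
  fix f :: "nat \<Rightarrow> 'p \<Rightarrow> complex"
  let ?A = "adjoin R t"
  note A = fun_subring_adjoin[OF R, of t]
  assume fA: "\<forall>n. f n \<in> ?A" and bad: "\<nexists>n. f n \<in> gen ?A (f ` {..<n})"
  define J where "J = gen ?A (range f)"
  define rep where "rep g N a \<longleftrightarrow> (\<forall>i. a i \<in> R) \<and> g = (\<lambda>z. \<Sum>i\<le>N. a i z * t z ^ i)" for g N a
  have JA: "J \<subseteq> ?A"
  proof
    fix g assume "g \<in> J"
    then show "g \<in> ?A" unfolding J_def
    proof induction
      case (step h r g)
      have "g \<in> ?A" using step(3) fA by blast
      then show ?case using fun_subring_add[OF A step(4) fun_subring_mult[OF A step(2)]] by simp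
    qed (rule fun_subring_const[OF A])
  qed
  have J_finite: "\<exists>m. g \<in> gen ?A (f ` {..<m})" if "g \<in> J" for g
    using that unfolding J_def
  proof induction
    case (step h r g)
    then obtain m k where m: "h \<in> gen ?A (f ` {..<m})" and k: "g = f k" by blast
    have "h \<in> gen ?A (f ` {..<max m (Suc k)})" by (rule gen_mono[OF m]) auto
    moreover have "g \<in> f ` {..<max m (Suc k)}" using k by auto
    ultimately show ?case using gen.step step(2) by blast
  qed (auto intro: gen.zero)
  \<comment> \<open>A finite \<open>G\<close> inside \<open>J\<close> needs only finitely many of
    the \<open>f n\<close>, so if it generated \<open>J\<close>, some \<open>f m\<close> would be a
    combination of its predecessors.\<close>
  have not_fg: "\<exists>g\<in>J. g \<notin> gen ?A G" if G: "finite G" "G \<subseteq> J" for G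
  proof (rule ccontr)
    assume contra: "\<not> ?thesis"
    have "\<exists>m. \<forall>g\<in>G. g \<in> gen ?A (f ` {..<m})"
      using G
    proof (induction rule: finite_induct)
      case (insert g G)
      then obtain m k where "\<forall>g\<in>G. g \<in> gen ?A (f ` {..<m})" "g \<in> gen ?A (f ` {..<k})"
        using J_finite by (metis insert_subset)
      then have "\<forall>g\<in>insert g G. g \<in> gen ?A (f ` {..<max m k})"
        by (auto intro: gen_mono[OF _ order.refl image_mono])
      then show ?case ..
    qed simp
    then obtain m where m: "\<forall>g\<in>G. g \<in> gen ?A (f ` {..<m})" ..
    have "f m \<in> J" unfolding J_def by (rule gen_incl[OF A]) simp
    then have "f m \<in> gen ?A G" using contra by blast
    then have "f m \<in> gen ?A (f ` {..<m})" by (rule gen_trans[OF A]) (use m in blast)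
    then show False using bad by blast
  qed
  define cand where "cand G N a g \<longleftrightarrow> g \<in> J \<and> g \<notin> gen ?A G \<and> rep g N a" for G N a g
  define deg where "deg G = (LEAST N. \<exists>g a. cand G N a g)" for G
  have ex_cand: "\<exists>g a. cand G (deg G) a g" if G: "finite G" "G \<subseteq> J" for G
  proof -
    obtain g where "g \<in> J" "g \<notin> gen ?A G" using not_fg[OF G] by blast
    moreover from this obtain N a where "rep g N a" using JA unfolding adjoin_def rep_def by blast
    ultimately have "\<exists>N g a. cand G N a g" unfolding cand_def by blast
    then show ?thesis unfolding deg_def by (rule LeastI_ex)
  qed
  define sel where "sel G = (SOME g. \<exists>a. cand G (deg G) a g)" for G
  have sel: "\<exists>a. cand G (deg G) a (sel G)" if "finite G" "G \<subseteq> J" for G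
    unfolding sel_def using someI_ex[OF ex_cand[OF that]] .
  define Gs where "Gs = rec_nat {} (\<lambda>_ G. insert (sel G) G)"
  have Gs_Suc: "Gs (Suc n) = insert (sel (Gs n)) (Gs n)" for n by (simp add: Gs_def)
  have Gs: "finite (Gs n) \<and> Gs n \<subseteq> J" for n
  proof (induction n)
    case 0
    show ?case by (simp add: Gs_def)
  next
    case (Suc n)
    then show ?case using sel[of "Gs n"] unfolding Gs_Suc cand_def by blast
  qed
  define g where "g n = sel (Gs n)" for n
  have Gs_eq: "Gs n = g ` {..<n}" for n
  proof (induction n)
    case 0
    show ?case by (simp add: Gs_def)
  qed (simp add: Gs_Suc g_def lessThan_Suc)
  define d where "d n = deg (Gs n)" for n
  have "\<forall>n. \<exists>a. cand (Gs n) (d n) a (g n)" using sel Gs unfolding g_def d_def by blast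
  from choice[OF this] obtain a where a: "\<And>n. cand (Gs n) (d n) (a n) (g n)" by blast
  have d_least: "d n \<le> N" if "cand (Gs n) N b h" for n N b h
    unfolding d_def deg_def by (rule Least_le) (use that in blast)
  have d_mono: "d i \<le> d n" if "i \<le> n" for i n
  proof (rule d_least)
    have "Gs i \<subseteq> Gs n" unfolding Gs_eq using that by (intro image_mono) auto
    then have "gen ?A (Gs i) \<subseteq> gen ?A (Gs n)"
      using gen_mono[OF _ order.refl] by blast
    then show "cand (Gs i) (d n) (a n) (g n)" using a[of n] unfolding cand_def by blast
  qed
  define lc where "lc n = a n (d n)" for n
  have "\<forall>n. lc n \<in> R" using a unfolding lc_def cand_def rep_def by blast
  then obtain n where n: "lc n \<in> gen R (lc ` {..<n})" using noeth unfolding noetherian_def by blast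
  \<comment> \<open>Every \<open>R\<close>-combination of earlier leading coefficients is the degree
    \<open>d n\<close> coefficient of an element of the ideal of \<open>Gs n\<close>: earlier
    generators are shifted up to degree \<open>d n\<close>, which \<open>d_mono\<close>
    permits.\<close>
  have "\<exists>q b. q \<in> gen ?A (Gs n) \<and> rep q (d n) b \<and> b (d n) = h" if "h \<in> gen R (lc ` {..<n})" for h
    using that
  proof induction
    case zero
    have "rep (\<lambda>_. 0) (d n) (\<lambda>_ _. 0)" unfolding rep_def by (simp add: fun_subring_const[OF R])
    then show ?case using gen.zero by blast
  next
    case (step h r c)
    then obtain q b where q: "q \<in> gen ?A (Gs n)" "\<forall>i. b i \<in> R"
      "q = (\<lambda>z. \<Sum>i\<le>d n. b i z * t z ^ i)" "b (d n) = h"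
      unfolding rep_def by blast
    obtain i where i: "i < n" "c = lc i" using step(3) by blast
    have di: "d i \<le> d n" using d_mono i by simp
    have ai: "\<forall>j. a i j \<in> R" "g i = (\<lambda>z. \<Sum>j\<le>d i. a i j z * t z ^ j)"
      using a[of i] unfolding cand_def rep_def by blast+
    define b' where "b' j z = b j z + (if j < d n - d i then 0 else r z * a i (j - (d n - d i)) z)" for j z
    have b'R: "b' j \<in> R" for j
    proof (cases "j < d n - d i")
      case True
      then show ?thesis using q(2) unfolding b'_def by simp
    next
      case False
      then show ?thesis unfolding b'_def
        using q(2) ai(1) step(2) by (simp add: fun_subring_add[OF R] fun_subring_mult[OF R])
    qed
    have "(\<Sum>j\<le>d n. (if j < d n - d i then 0 else r z * a i (j - (d n - d i)) z) * t z ^ j)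
       = (r z * t z ^ (d n - d i)) * g i z" for z
      using sum_shift_power[of "d n - d i" "d n" "\<lambda>j. r z * a i j z" "t z"] di
      by (simp add: ai(2) sum_distrib_left mult_ac)
    then have sum: "(\<Sum>j\<le>d n. b' j z * t z ^ j) = q z + (r z * t z ^ (d n - d i)) * g i z" for z
      by (simp add: b'_def distrib_right sum.distrib q(3))
    have "(\<lambda>z. q z + (r z * t z ^ (d n - d i)) * g i z) \<in> gen ?A (Gs n)"
    proof (rule gen.step[OF q(1)])
      show "(\<lambda>z. r z * t z ^ (d n - d i)) \<in> ?A"
        using step(2) adjoin_incl[OF R, of t]
        by (intro fun_subring_mult[OF A] fun_subring_power[OF A] adjoin_gen[OF R]) blast
      show "g i \<in> Gs n" using i by (auto simp: Gs_eq)
    qed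
    moreover have "rep (\<lambda>z. q z + (r z * t z ^ (d n - d i)) * g i z) (d n) b'"
      unfolding rep_def using b'R sum by auto
    moreover have "b' (d n) = (\<lambda>z. h z + r z * c z)"
      using q(4) i(2) di by (simp add: b'_def lc_def fun_eq_iff)
    ultimately show ?case by blast
  qed
  from this[OF n] obtain q b where q: "q \<in> gen ?A (Gs n)" "rep q (d n) b" "b (d n) = lc n" by blast
  have gn: "g n \<in> J" "g n \<notin> gen ?A (Gs n)" "rep (g n) (d n) (a n)"
    using a[of n] unfolding cand_def by blast+
  have qJ: "q \<in> J"
    unfolding J_def by (rule gen_trans[OF A q(1)]) (use Gs[of n] in \<open>auto simp: J_def\<close>)
  \<comment> \<open>The degree \<open>d n\<close> coefficients of \<open>g n\<close> and
    \<open>q\<close> cancel, so \<open>e\<close> is a candidate of smaller degree, or zero if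
    \<open>d n\<close> is 0.\<close>
  define e where "e z = g n z - q z" for z
  have eJ: "e \<in> J" using gen_diff[OF A] gn(1) qJ unfolding J_def e_def by blast
  have e_notin: "e \<notin> gen ?A (Gs n)"
  proof
    assume "e \<in> gen ?A (Gs n)"
    from gen_add[OF this q(1)] gn(2) show False by (simp add: e_def)
  qed
  have e_eq: "e z = (\<Sum>i\<le>d n. (a n i z - b i z) * t z ^ i)" for z
    using gn(3) q(2) unfolding rep_def e_def by (simp add: algebra_simps sum_subtractf)
  show False
  proof (cases "d n")
    case 0
    then have "e = (\<lambda>_. 0)" using e_eq q(3) by (simp add: fun_eq_iff lc_def)
    then show False using e_notin gen.zero by metis
  next
    case (Suc k)
    have "rep e k (\<lambda>i z. a n i z - b i z)"
      unfolding rep_def using gn(3) q(2,3) Suc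
      by (auto simp: rep_def e_eq lc_def fun_eq_iff intro: fun_subring_diff[OF R])
    then have "d n \<le> k" using d_least[of n k] eJ e_notin unfolding cand_def by blast
    then show False using Suc by simp
  qed
qed

lemma noetherian_complex_poly_fun:
  fixes f :: "nat \<Rightarrow> complex ^ 'm \<Rightarrow> complex"
  assumes "\<And>n. complex_poly_fun (f n)"
  obtains n where "f n \<in> gen (Collect complex_poly_fun) (f ` {..<n})"
proof -
  have "\<exists>R. fun_subring R \<and> noetherian R \<and> R \<subseteq> Collect complex_poly_fun \<and> (\<forall>i\<in>I. (\<lambda>z. z $ i) \<in> R)"
    if "finite I" for I :: "'m set"
    using that
  proof induction
    case empty
    show ?case
      by (rule exI[of _ "range (\<lambda>c _. c)"])
         (auto simp: noetherian_constants fun_subring_def intro: complex_poly_fun.const)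
  next
    case (insert i I)
    then obtain R where R: "fun_subring R" "noetherian R" "R \<subseteq> Collect complex_poly_fun"
      "\<forall>i\<in>I. (\<lambda>z. z $ i) \<in> R" by blast
    have "adjoin R (\<lambda>z. z $ i) \<subseteq> Collect complex_poly_fun"
      unfolding adjoin_def using R(3)
      by (auto intro!: complex_poly_fun_sum complex_poly_fun.mult complex_poly_fun_power complex_poly_fun.coord)
    then show ?case
      using fun_subring_adjoin[OF R(1), of "\<lambda>z. z $ i"] noetherian_adjoin[OF R(1,2), of "\<lambda>z. z $ i"]
        adjoin_gen[OF R(1), of "\<lambda>z. z $ i"] adjoin_incl[OF R(1), of "\<lambda>z. z $ i"] R(4)
      by (intro exI[of _ "adjoin R (\<lambda>z. z $ i)"]) auto
  qed
  from this[OF finite_class.finite_UNIV] obtain R where R: "fun_subring R" "noetherian R"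
    "R \<subseteq> Collect complex_poly_fun" "\<And>i. (\<lambda>z :: complex ^ 'm. z $ i) \<in> R" by auto
  have "g \<in> R" if "complex_poly_fun g" for g
    using that by induction (auto intro: R(4) fun_subring_const[OF R(1)] fun_subring_add[OF R(1)] fun_subring_mult[OF R(1)])
  then have "R = Collect complex_poly_fun" using R(3) by blast
  with R(2) assms that show thesis unfolding noetherian_def by blast
qed

subsection \<open>Irreducible closed sets in the Zariski topology\<close>

lemma algebraic_set_zeros: "complex_poly_fun f \<Longrightarrow> algebraic_set {z. f z = 0}"
  unfolding algebraic_set_def by (intro exI[of _ "{f}"]) auto

lemma algebraic_setI:
  assumes "\<And>i. complex_poly_fun (f i)" shows "algebraic_set {z. \<forall>i. f i z = 0}"
  unfolding algebraic_set_def using assms by (intro exI[of _ "range f"]) auto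

lemma algebraic_set_separate:
  assumes "algebraic_set V" "z \<notin> V"
  obtains f where "complex_poly_fun f" "\<And>w. w \<in> V \<Longrightarrow> f w = 0" "f z \<noteq> 0"
  using assms unfolding algebraic_set_def by blast

lemma closedin_zariski_subspace:
  "closedin (subtopology zariski S) A \<longleftrightarrow> (\<exists>V. algebraic_set V \<and> A = V \<inter> S)"
  by (simp add: closedin_subtopology closedin_zariski)

lemma closedin_zariski_separate:
  assumes "closedin (subtopology zariski S) A" "z \<in> S" "z \<notin> A"
  obtains f where "complex_poly_fun f" "\<And>w. w \<in> A \<Longrightarrow> f w = 0" "f z \<noteq> 0"
proof -
  obtain V where V: "algebraic_set V" "A = V \<inter> S"
    using assms(1) unfolding closedin_zariski_subspace by blast
  then have "z \<notin> V" using assms by blast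
  show thesis
  proof (rule algebraic_set_separate[OF V(1) \<open>z \<notin> V\<close>])
    fix f assume "complex_poly_fun f" "\<And>w. w \<in> V \<Longrightarrow> f w = 0" "f z \<noteq> 0"
    then show thesis using V(2) by (intro that[of f]) auto
  qed
qed

lemma irreducible_in_zariski_iff:
  "irreducible_in (subtopology zariski S) A \<longleftrightarrow> A \<subseteq> S \<and> irred A"
proof (intro iffI conjI)
  assume irr: "irreducible_in (subtopology zariski S) A"
  then show AS: "A \<subseteq> S" unfolding irreducible_in_def by simp
  show "irred A"
    unfolding irred_def
  proof (intro conjI allI impI)
    show "A \<noteq> {}" using irr unfolding irreducible_in_def by simp
    fix f g :: "complex ^ 'a \<Rightarrow> complex"
    assume f: "complex_poly_fun f" and g: "complex_poly_fun g" and fg: "\<forall>z\<in>A. f z * g z = 0"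
    have "closedin (subtopology zariski S) ({z. f z = 0} \<inter> S)"
      "closedin (subtopology zariski S) ({z. g z = 0} \<inter> S)"
      unfolding closedin_zariski_subspace using algebraic_set_zeros f g by blast+
    moreover have "A \<subseteq> ({z. f z = 0} \<inter> S) \<union> ({z. g z = 0} \<inter> S)" using fg AS by auto
    ultimately have "A \<subseteq> {z. f z = 0} \<inter> S \<or> A \<subseteq> {z. g z = 0} \<inter> S"
      using irr unfolding irreducible_in_def by blast
    then show "(\<forall>z\<in>A. f z = 0) \<or> (\<forall>z\<in>A. g z = 0)" by blast
  qed
next
  assume A: "A \<subseteq> S \<and> irred A"
  show "irreducible_in (subtopology zariski S) A"
    unfolding irreducible_in_def
  proof (intro conjI allI impI)
    show "A \<subseteq> topspace (subtopology zariski S)" using A by simp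
    show "A \<noteq> {}" using A unfolding irred_def by blast
    fix C D assume CD: "closedin (subtopology zariski S) C \<and> closedin (subtopology zariski S) D \<and> A \<subseteq> C \<union> D"
    show "A \<subseteq> C \<or> A \<subseteq> D"
    proof (rule ccontr)
      assume "\<not> (A \<subseteq> C \<or> A \<subseteq> D)"
      then obtain a b where ab: "a \<in> A" "a \<notin> C" "b \<in> A" "b \<notin> D" by blast
      have abS: "a \<in> S" "b \<in> S" using ab A by blast+
      obtain f where f: "complex_poly_fun f" "\<And>w. w \<in> C \<Longrightarrow> f w = 0" "f a \<noteq> 0"
        using closedin_zariski_separate[of S C a] CD abS ab by blast
      obtain g where g: "complex_poly_fun g" "\<And>w. w \<in> D \<Longrightarrow> g w = 0" "g b \<noteq> 0"
        using closedin_zariski_separate[of S D b] CD abS ab by blast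
      have "f z * g z = 0" if "z \<in> A" for z using that CD f(2) g(2) by auto
      then show False using irredD[of A f g] A f(1,3) g(1,3) ab by blast
    qed
  qed
qed

lemma irred_subset_finite_Union:
  assumes A: "irred A" "A \<subseteq> S" and F: "finite F" "\<And>W. W \<in> F \<Longrightarrow> closedin (subtopology zariski S) W" "A \<subseteq> \<Union>F"
  shows "\<exists>W\<in>F. A \<subseteq> W"
  using F
proof (induction rule: finite_induct)
  case empty
  then show ?case using A unfolding irred_def by blast
next
  case (insert W F)
  have "irreducible_in (subtopology zariski S) A" using A by (simp add: irreducible_in_zariski_iff)
  moreover have "closedin (subtopology zariski S) (\<Union>F)"
    using insert by (intro closedin_Union) auto
  ultimately have "A \<subseteq> W \<or> A \<subseteq> \<Union>F"
    using insert.prems unfolding irreducible_in_def by (simp add: insertCI)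
  then show ?case using insert by blast
qed

text \<open>Polynomials separating consecutive members of a descending chain cannot all be new; but
  a combination of the earlier ones vanishes on all of \<open>s n\<close>, where \<open>f n\<close>
  does not.\<close>

lemma wf_closedin_zariski:
  fixes S :: "(complex ^ 'm) set"
  shows "wf {(B, A). closedin (subtopology zariski S) A \<and> closedin (subtopology zariski S) B \<and> B \<subset> A}"
  unfolding wf_iff_no_infinite_down_chain
proof
  assume "\<exists>s. \<forall>i. (s (Suc i), s i) \<in> {(B, A). closedin (subtopology zariski S) A \<and> closedin (subtopology zariski S) B \<and> B \<subset> A}"
  then obtain s where s0: "\<forall>i. (s (Suc i), s i) \<in>
      {(B, A). closedin (subtopology zariski S) A \<and> closedin (subtopology zariski S) B \<and> B \<subset> A}" ..
  have s: "closedin (subtopology zariski S) (s i)" "s (Suc i) \<subset> s i" for i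
    using s0[rule_format, of i] by simp_all
  have "\<exists>f. complex_poly_fun f \<and> (\<forall>z\<in>s (Suc i). f z = 0) \<and> (\<exists>z\<in>s i. f z \<noteq> 0)" for i
  proof -
    obtain z where z: "z \<in> s i" "z \<notin> s (Suc i)" using s(2) by blast
    then have "z \<in> S" using closedin_subset[OF s(1)[of i]] by auto
    from closedin_zariski_separate[OF s(1) this z(2)] z(1) show ?thesis by metis
  qed
  then obtain f where f: "\<And>i. complex_poly_fun (f i)" "\<And>i z. z \<in> s (Suc i) \<Longrightarrow> f i z = 0"
    "\<And>i. \<exists>z\<in>s i. f i z \<noteq> 0" by metis
  have mono: "s j \<subseteq> s i" if "i \<le> j" for i j
    using lift_Suc_antimono_le[of s] s(2) that by blast
  obtain n where n: "f n \<in> gen (Collect complex_poly_fun) (f ` {..<n})"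
    by (rule noetherian_complex_poly_fun[where f = f, OF f(1)])
  have "h z = 0" if "h \<in> gen (Collect complex_poly_fun) (f ` {..<n})" "z \<in> s n" for h z
    using that(1)
  proof induction
    case (step h r g)
    then obtain i where "i < n" "g = f i" by blast
    then have "g z = 0" using f(2) mono[of "Suc i" n] that(2) by auto
    then show ?case using step by simp
  qed simp
  with n f(3) show False by blast
qed

lemma closedin_zariski_decomposition:
  fixes S :: "(complex ^ 'm) set"
  assumes "closedin (subtopology zariski S) A"
  shows "\<exists>F. finite F \<and> A = \<Union>F \<and> (\<forall>Z\<in>F. irred Z \<and> closedin (subtopology zariski S) Z)"
  using wf_closedin_zariski[of S] assms
proof (induction A rule: wf_induct_rule)
  case (less A)
  consider "A = {}" | "irred A" | "A \<noteq> {}" "\<not> irred A" by blast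
  then show ?case
  proof cases
    case 1
    then show ?thesis by (intro exI[of _ "{}"]) auto
  next
    case 2
    then show ?thesis using less.prems by (intro exI[of _ "{A}"]) auto
  next
    case 3
    then obtain f g where fg: "complex_poly_fun f" "complex_poly_fun g" "\<forall>z\<in>A. f z * g z = 0"
      "\<not> (\<forall>z\<in>A. f z = 0)" "\<not> (\<forall>z\<in>A. g z = 0)" unfolding irred_def by blast
    obtain V where V: "algebraic_set V" "A = V \<inter> S"
      using less.prems unfolding closedin_zariski_subspace by blast
    have sub: "\<exists>F. finite F \<and> A \<inter> {z. h z = 0} = \<Union>F \<and> (\<forall>Z\<in>F. irred Z \<and> closedin (subtopology zariski S) Z)"
      if h: "complex_poly_fun h" "\<not> (\<forall>z\<in>A. h z = 0)" for h
    proof (rule less.IH)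
      have "A \<inter> {z. h z = 0} = \<Inter>{V, {z. h z = 0}} \<inter> S" using V by auto
      moreover have "algebraic_set (\<Inter>{V, {z. h z = 0}})"
        using V algebraic_set_zeros[OF h(1)] by (intro algebraic_set_Inter) auto
      ultimately show "closedin (subtopology zariski S) (A \<inter> {z. h z = 0})"
        unfolding closedin_zariski_subspace by blast
      then show "(A \<inter> {z. h z = 0}, A) \<in> {(B, A). closedin (subtopology zariski S) A \<and> closedin (subtopology zariski S) B \<and> B \<subset> A}"
        using less.prems h by auto
    qed
    obtain F where F: "finite F" "A \<inter> {z. f z = 0} = \<Union>F" "\<forall>Z\<in>F. irred Z \<and> closedin (subtopology zariski S) Z"
      using sub[OF fg(1,4)] by blast
    obtain G where G: "finite G" "A \<inter> {z. g z = 0} = \<Union>G" "\<forall>Z\<in>G. irred Z \<and> closedin (subtopology zariski S) Z"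
      using sub[OF fg(2,5)] by blast
    have "A = (A \<inter> {z. f z = 0}) \<union> (A \<inter> {z. g z = 0})" using fg(3) by auto
    then have "A = \<Union>(F \<union> G)" using F(2) G(2) by simp
    then show ?thesis using F G by (intro exI[of _ "F \<union> G"]) auto
  qed
qed

lemma irreducible_component_exists:
  assumes "irred A" "A \<subseteq> S"
  obtains B where "irreducible_component_of (subtopology zariski S) B" "A \<subseteq> B"
proof -
  define \<A> where "\<A> = {B. A \<subseteq> B \<and> B \<subseteq> S \<and> irred B}"
  have "\<exists>M\<in>\<A>. \<forall>X\<in>\<A>. M \<subseteq> X \<longrightarrow> X = M"
  proof (rule subset_Zorn_nonempty)
    show "\<A> \<noteq> {}" using assms unfolding \<A>_def by blast
    fix \<C> assume \<C>: "\<C> \<noteq> {}" "subset.chain \<A> \<C>"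
    then have sub: "\<C> \<subseteq> \<A>" and lin: "\<And>B C. B \<in> \<C> \<Longrightarrow> C \<in> \<C> \<Longrightarrow> B \<subseteq> C \<or> C \<subseteq> B"
      unfolding subset_chain_def by auto
    have "irred (\<Union>\<C>)"
      unfolding irred_def
    proof (intro conjI allI impI)
      show "\<Union>\<C> \<noteq> {}" using \<C>(1) sub unfolding \<A>_def irred_def by blast
      fix f g :: "complex ^ 'a \<Rightarrow> complex"
      assume f: "complex_poly_fun f" and g: "complex_poly_fun g" and fg: "\<forall>z\<in>\<Union>\<C>. f z * g z = 0"
      show "(\<forall>z\<in>\<Union>\<C>. f z = 0) \<or> (\<forall>z\<in>\<Union>\<C>. g z = 0)"
      proof (rule ccontr)
        assume "\<not> ?thesis"
        then obtain a b B C where ab: "a \<in> B" "B \<in> \<C>" "f a \<noteq> 0" "b \<in> C" "C \<in> \<C>" "g b \<noteq> 0" by blast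
        define D where "D = (if B \<subseteq> C then C else B)"
        have D: "D \<in> \<C>" "a \<in> D" "b \<in> D" using ab lin[of B C] unfolding D_def by auto
        then have "irred D" using sub unfolding \<A>_def by blast
        from irredD[OF this f g] show False using fg D ab by blast
      qed
    qed
    moreover have "A \<subseteq> \<Union>\<C>" "\<Union>\<C> \<subseteq> S" using \<C>(1) sub unfolding \<A>_def by blast+
    ultimately show "\<Union>\<C> \<in> \<A>" unfolding \<A>_def by blast
  qed
  then obtain M where M: "A \<subseteq> M" "M \<subseteq> S" "irred M" "\<forall>X\<in>\<A>. M \<subseteq> X \<longrightarrow> X = M"
    unfolding \<A>_def by blast
  have "B = M" if "B \<subseteq> S" "irred B" "M \<subseteq> B" for B
  proof -
    have "B \<in> \<A>" using that M(1) unfolding \<A>_def by blast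
    then show ?thesis using M(4) that(3) by blast
  qed
  then have "irreducible_component_of (subtopology zariski S) M"
    unfolding irreducible_component_of_def irreducible_in_zariski_iff using M(2,3) by blast
  then show thesis using M(1) by (rule that)
qed

text \<open>The Zariski closure of an irreducible set is irreducible and stays inside the closed set
  \<open>X\<close>, so a maximal irreducible subset is its own closure.\<close>

lemma irreducible_component_algebraic:
  assumes X: "algebraic_set X" and B: "irreducible_component_of (subtopology zariski X) B"
  shows "algebraic_set B" "irred B" "B \<subseteq> X"
proof -
  show irr: "irred B" and BX: "B \<subseteq> X"
    using B unfolding irreducible_component_of_def irreducible_in_zariski_iff by blast+
  define V where "V = {z. \<forall>f\<in>{f. complex_poly_fun f \<and> (\<forall>z\<in>B. f z = 0)}. f z = 0}"
  have V: "algebraic_set V" unfolding algebraic_set_def V_def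
    by (intro exI[of _ "{f. complex_poly_fun f \<and> (\<forall>z\<in>B. f z = 0)}"]) auto
  have BV: "B \<subseteq> V" unfolding V_def by blast
  have "V \<subseteq> X"
  proof
    fix z assume z: "z \<in> V"
    show "z \<in> X"
    proof (rule ccontr)
      assume "z \<notin> X"
      then obtain f where f: "complex_poly_fun f" "\<And>w. w \<in> X \<Longrightarrow> f w = 0" "f z \<noteq> 0"
        using algebraic_set_separate[OF X] by blast
      then show False using z BX unfolding V_def by blast
    qed
  qed
  moreover have "irred V"
    unfolding irred_def
  proof (intro conjI allI impI)
    show "V \<noteq> {}" using irr BV unfolding irred_def by blast
    fix f g :: "complex ^ 'a \<Rightarrow> complex"
    assume f: "complex_poly_fun f" and g: "complex_poly_fun g" and fg: "\<forall>z\<in>V. f z * g z = 0"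
    have "(\<forall>z\<in>B. f z = 0) \<or> (\<forall>z\<in>B. g z = 0)" using irredD[OF irr f g] fg BV by blast
    then show "(\<forall>z\<in>V. f z = 0) \<or> (\<forall>z\<in>V. g z = 0)" using f g unfolding V_def by blast
  qed
  ultimately have "V = B"
    using B BV unfolding irreducible_component_of_def irreducible_in_zariski_iff by blast
  then show "algebraic_set B" using V by simp
qed

lemma pure_dim_component_chain:
  fixes X :: "(complex ^ 'm) set"
  assumes "has_pure_dim X k" "irreducible_component_of (subtopology zariski X) B"
  obtains Z where "irred_chain k Z" "Z k \<subseteq> B"
proof -
  have irr: "irred B" and BX: "B \<subseteq> X"
    using assms(2) unfolding irreducible_component_of_def irreducible_in_zariski_iff by blast+
  have top: "subtopology (subtopology zariski X) B = subtopology zariski B"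
    using BX by (simp add: subtopology_subtopology Int_absorb1)
  define L where "L = {enat n | n. \<exists>Z. (\<forall>i\<le>n. closedin (subtopology zariski B) (Z i) \<and>
      irreducible_in (subtopology zariski B) (Z i)) \<and> (\<forall>i<n. Z i \<subset> Z (Suc i))}"
  have "krull_dim (subtopology (subtopology zariski X) B) = enat k"
    using assms unfolding has_pure_dim_def pure_dim_def by simp
  then have Sup: "Sup L = enat k" unfolding top krull_dim_def L_def .
  have "closedin (subtopology zariski B) B"
    using closedin_topspace[of "subtopology zariski B"] by simp
  moreover have "irreducible_in (subtopology zariski B) B"
    using irr by (simp add: irreducible_in_zariski_iff)
  ultimately have "enat 0 \<in> L"
    unfolding L_def by (intro CollectI exI[of _ 0] conjI exI[of _ "\<lambda>_. B"]) auto
  then have "L \<noteq> {}" by blast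
  \<comment> \<open>The supremum is the finite number \<open>k\<close>, so there are finitely many
    lengths and the supremum is attained by a chain.\<close>
  moreover have "finite L"
  proof (rule ccontr)
    assume "infinite L"
    then have "Sup L = \<infinity>" using \<open>L \<noteq> {}\<close> by (simp add: Sup_enat_def)
    with Sup show False by simp
  qed
  ultimately have "enat k \<in> L" using Sup Max_in[of L] by (simp add: Sup_enat_def)
  then obtain Z where Z: "\<And>i. i \<le> k \<Longrightarrow> closedin (subtopology zariski B) (Z i)"
    "\<And>i. i \<le> k \<Longrightarrow> irreducible_in (subtopology zariski B) (Z i)" "\<And>i. i < k \<Longrightarrow> Z i \<subset> Z (Suc i)"
    unfolding L_def by auto
  have "irred_chain k Z"
    unfolding irred_chain_def
  proof (intro conjI allI impI)
    show "irred (Z i)" if "i \<le> k" for i using Z(2)[OF that] by (simp add: irreducible_in_zariski_iff)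
    fix i assume i: "i < k"
    show "Z i \<subseteq> Z (Suc i)" using Z(3)[OF i] by blast
    obtain z where z: "z \<in> Z (Suc i)" "z \<notin> Z i" using Z(3)[OF i] by blast
    have "z \<in> B" using z(1) Z(2)[of "Suc i"] i by (auto simp: irreducible_in_zariski_iff)
    from closedin_zariski_separate[OF Z(1)[of i] this z(2)] i z(1)
    show "\<exists>f. complex_poly_fun f \<and> (\<forall>z\<in>Z i. f z = 0) \<and> (\<exists>z\<in>Z (Suc i). f z \<noteq> 0)"
      by (metis less_imp_le)
  qed
  moreover have "Z k \<subseteq> B" using Z(2)[of k] by (simp add: irreducible_in_zariski_iff)
  ultimately show thesis by (rule that)
qed

text \<open>The whole chain lies in one irreducible component, one that contains its largest member,
  and stays a chain of closed sets there.\<close>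

lemma pure_dim_chain_bound:
  fixes S :: "(complex ^ 'm) set"
  assumes "has_pure_dim S k" "irred_chain n Z" "\<And>i. i \<le> n \<Longrightarrow> closedin (subtopology zariski S) (Z i)"
  shows "n \<le> k"
proof -
  have sub: "Z i \<subseteq> Z n" if "i \<le> n" for i
  proof (rule inc_induct[OF that])
    fix j assume "j < n" "Z (Suc j) \<subseteq> Z n"
    then show "Z j \<subseteq> Z n" using assms(2) unfolding irred_chain_def by blast
  qed simp
  have "Z n \<subseteq> S" using closedin_subset[OF assms(3)[of n]] by simp
  moreover have "irred (Z n)" using assms(2) unfolding irred_chain_def by blast
  ultimately obtain B where B: "irreducible_component_of (subtopology zariski S) B" "Z n \<subseteq> B"
    using irreducible_component_exists by metis
  have BS: "B \<subseteq> S"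
    using B(1) unfolding irreducible_component_of_def irreducible_in_zariski_iff by blast
  have top: "subtopology (subtopology zariski S) B = subtopology zariski B"
    using BS by (simp add: subtopology_subtopology Int_absorb1)
  have "closedin (subtopology zariski B) (Z i) \<and> irreducible_in (subtopology zariski B) (Z i)" if i: "i \<le> n" for i
  proof -
    have ZB: "Z i \<subseteq> B" using sub[OF i] B(2) by blast
    obtain V where "algebraic_set V" "Z i = V \<inter> S"
      using assms(3)[OF i] unfolding closedin_zariski_subspace by blast
    then have "algebraic_set V \<and> Z i = V \<inter> B" using ZB BS by blast
    then have "closedin (subtopology zariski B) (Z i)" unfolding closedin_zariski_subspace by blast
    moreover have "irred (Z i)" using assms(2) i unfolding irred_chain_def by blast
    ultimately show ?thesis using ZB by (simp add: irreducible_in_zariski_iff)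
  qed
  moreover have "Z i \<subset> Z (Suc i)" if "i < n" for i
    using assms(2) that unfolding irred_chain_def by blast
  ultimately have "enat n \<le> krull_dim (subtopology zariski B)"
    unfolding krull_dim_def by (intro Sup_upper) blast
  moreover have "krull_dim (subtopology zariski B) = enat k"
    using assms(1) B(1) unfolding has_pure_dim_def pure_dim_def top[symmetric] by simp
  ultimately show ?thesis by simp
qed

subsection \<open>Cutting a cone by hyperplanes\<close>

lemma clform_avoiding:
  fixes T :: "(complex ^ 'm) set"
  assumes "finite T" "0 \<notin> T"
  shows "\<exists>l. clform l \<and> (\<forall>p\<in>T. l p \<noteq> 0)"
  using assms
proof (induction rule: finite_induct)
  case empty
  then show ?case using clform_coord by blast
next
  case (insert p T)
  then obtain l where l: "clform l" "\<forall>q\<in>T. l q \<noteq> 0" by auto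
  obtain i where i: "p $ i \<noteq> 0"
    using insert.prems by (auto simp: Finite_Cartesian_Product.vec_eq_iff)
  have "finite {c. \<exists>q\<in>insert p T. l q + c * q $ i = 0}"
  proof -
    \<comment> \<open>For each point at most one \<open>c\<close> is bad: where \<open>q $ i\<close>
      is zero, \<open>q\<close> is an old point and \<open>l q\<close> is not zero.\<close>
    have "{c. l q + c * q $ i = 0} \<subseteq> {- l q / q $ i}" if "q \<in> insert p T" for q
    proof
      fix c assume "c \<in> {c. l q + c * q $ i = 0}"
      then have c: "l q + c * q $ i = 0" by simp
      then have "q $ i \<noteq> 0" using that l(2) i by auto
      then show "c \<in> {- l q / q $ i}" using c by (simp add: field_simps eq_neg_iff_add_eq_0)
    qed
    then have "finite {c. l q + c * q $ i = 0}" if "q \<in> insert p T" for q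
      using that by (meson finite.emptyI finite_insert finite_subset)
    then have "finite (\<Union>q\<in>insert p T. {c. l q + c * q $ i = 0})"
      using insert.hyps(1) by blast
    moreover have "{c. \<exists>q\<in>insert p T. l q + c * q $ i = 0} = (\<Union>q\<in>insert p T. {c. l q + c * q $ i = 0})"
      by blast
    ultimately show ?thesis by simp
  qed
  moreover have "infinite (UNIV :: complex set)" by (rule infinite_UNIV_char_0)
  ultimately obtain c where "c \<notin> {c. \<exists>q\<in>insert p T. l q + c * q $ i = 0}"
    using ex_new_if_finite by blast
  moreover have "clform (\<lambda>z. l z + c * z $ i)"
    using l(1) by (simp add: clform_def algebra_simps)
  ultimately show ?case by (intro exI[of _ "\<lambda>z. l z + c * z $ i"]) blast
qed

lemma algebraic_set_kernel:
  assumes "clin Q" shows "algebraic_set {z. Q z = 0}"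
proof -
  have "algebraic_set {z. \<forall>i. Q z $ i = 0}"
    by (intro algebraic_setI clform_complex_poly_fun clform_comp[OF clform_coord assms])
  then show ?thesis by (simp add: Finite_Cartesian_Product.vec_eq_iff)
qed

lemma algebraic_set_line: "algebraic_set (range (\<lambda>s. s *s (v :: complex ^ 'm)))"
proof (cases "v = 0")
  case True
  have "range (\<lambda>s. s *s v) = {z. \<forall>i. z $ i = 0}"
    using True by (auto simp: Finite_Cartesian_Product.vec_eq_iff)
  then show ?thesis by (simp add: algebraic_setI complex_poly_fun.coord)
next
  case False
  then obtain j where j: "v $ j \<noteq> 0" by (auto simp: Finite_Cartesian_Product.vec_eq_iff)
  have "range (\<lambda>s. s *s v) = {z. \<forall>i. z $ i * v $ j - z $ j * v $ i = 0}"
  proof (intro equalityI subsetI)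
    fix z assume "z \<in> {z. \<forall>i. z $ i * v $ j - z $ j * v $ i = 0}"
    then have "z = (z $ j / v $ j) *s v"
      using j by (simp add: Finite_Cartesian_Product.vec_eq_iff field_simps)
    then show "z \<in> range (\<lambda>s. s *s v)" by blast
  qed auto
  moreover have "algebraic_set {z. \<forall>i. z $ i * v $ j - z $ j * v $ i = 0}"
    by (intro algebraic_setI complex_poly_fun_diff complex_poly_fun.intros)
  ultimately show ?thesis by (simp only:)
qed

lemma irred_line: "irred (range (\<lambda>s. s *s v))"
  unfolding irred_def
proof (intro conjI allI impI)
  fix f g :: "complex ^ 'a \<Rightarrow> complex"
  assume f: "complex_poly_fun f" and g: "complex_poly_fun g"
    and fg: "\<forall>z\<in>range (\<lambda>s. s *s v). f z * g z = 0"
  obtain D c Q where "expansion f v D c Q" using top_form[OF f] by metis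
  note Q = expansionD(4)[OF this, of 0]
  obtain D' c' Q' where "expansion g v D' c' Q'" using top_form[OF g] by metis
  note Q' = expansionD(4)[OF this, of 0]
  have "poly (Q 0 * Q' 0) s = 0" for s
  proof -
    have "f (s *s v) * g (s *s v) = 0" using fg by blast
    then show ?thesis using Q[of s] Q'[of s] by simp
  qed
  then have "Q 0 * Q' 0 = 0" using poly_all_0_iff_0 by blast
  then have "Q 0 = 0 \<or> Q' 0 = 0" by simp
  then show "(\<forall>z\<in>range (\<lambda>s. s *s v). f z = 0) \<or> (\<forall>z\<in>range (\<lambda>s. s *s v). g z = 0)"
    using Q Q' by auto
qed auto

text \<open>A generic hyperplane contains none of the finitely many nonzero components of the current
  section, so every further cut shortens all chains that end in a set other than \<open>{0}\<close>.\<close>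

lemma cone_section:
  fixes S :: "(complex ^ 'm) set"
  assumes cone: "\<And>v c. v \<in> S \<Longrightarrow> c *s v \<in> S"
    and bound: "\<And>n Z. irred_chain n Z \<Longrightarrow> (\<And>i. i \<le> n \<Longrightarrow> closedin (subtopology zariski S) (Z i)) \<Longrightarrow> n \<le> k"
  obtains Q :: "complex ^ 'm \<Rightarrow> complex ^ 'm"
  where "clin Q" "vec.dim (range Q) \<le> k" "\<And>v. v \<in> S \<Longrightarrow> Q v = 0 \<Longrightarrow> v = 0"
proof -
  let ?cl = "closedin (subtopology zariski S)"
  \<comment> \<open>Invariant after \<open>i\<close> cuts: a chain inside the kernel that does not
    end in \<open>{0}\<close> has room for at most \<open>k - i\<close> steps.\<close>
  have ex: "\<exists>Q :: complex ^ 'm \<Rightarrow> complex ^ 'm. clin Q \<and> vec.dim (range Q) \<le> i \<and>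
     (\<forall>n Z. irred_chain n Z \<longrightarrow> (\<forall>i\<le>n. ?cl (Z i)) \<longrightarrow> (\<forall>z\<in>Z n. Q z = 0) \<longrightarrow> Z n \<noteq> {0} \<longrightarrow> n + i \<le> k)"
    if "i \<le> k" for i
    using that
  proof (induction i)
    case 0
    have "vec.dim (range (\<lambda>_ :: complex ^ 'm. 0 :: complex ^ 'm)) \<le> 0"
      using vec.subset_le_dim[of "range (\<lambda>_ :: complex ^ 'm. 0)" "{}"]
        vec.dim_eq_card_independent[OF vec.independent_empty] by simp
    moreover have "clin (\<lambda>_ :: complex ^ 'm. 0 :: complex ^ 'm)" by (simp add: clin_def)
    ultimately show ?case using bound by (intro exI[of _ "\<lambda>_. 0"]) auto
  next
    case (Suc i)
    then obtain Q :: "complex ^ 'm \<Rightarrow> complex ^ 'm" where Q: "clin Q" "vec.dim (range Q) \<le> i"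
      and chains: "\<And>n Z. irred_chain n Z \<Longrightarrow> \<forall>i\<le>n. ?cl (Z i) \<Longrightarrow> \<forall>z\<in>Z n. Q z = 0 \<Longrightarrow> Z n \<noteq> {0} \<Longrightarrow> n + i \<le> k"
      by auto
    define A where "A = {z. Q z = 0} \<inter> S"
    have "?cl A" unfolding A_def closedin_zariski_subspace using algebraic_set_kernel[OF Q(1)] by blast
    then obtain F where F: "finite F" "A = \<Union>F" "\<And>W. W \<in> F \<Longrightarrow> irred W" "\<And>W. W \<in> F \<Longrightarrow> ?cl W"
      using closedin_zariski_decomposition[of S A] by blast
    have "\<forall>W\<in>F - {{0}}. \<exists>p. p \<in> W \<and> p \<noteq> 0"
    proof
      fix W assume W: "W \<in> F - {{0}}"
      then have "W \<noteq> {}" using F(3)[of W] unfolding irred_def by blast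
      then show "\<exists>p. p \<in> W \<and> p \<noteq> 0" using W by blast
    qed
    from bchoice[OF this] obtain p where p: "\<forall>W\<in>F - {{0}}. p W \<in> W \<and> p W \<noteq> 0" ..
    have "finite (p ` (F - {{0}}))" "0 \<notin> p ` (F - {{0}})" using F(1) p by auto
    from clform_avoiding[OF this] obtain l where l: "clform l" "\<forall>q\<in>p ` (F - {{0}}). l q \<noteq> 0" by blast
    \<comment> \<open>The form \<open>l\<close> is added to \<open>Q\<close> along a vector outside
      the range, which makes the new kernel the intersection of both kernels at the cost of one in
      the rank; if no such vector exists, \<open>Q\<close> is already injective.\<close>
    obtain Q' :: "complex ^ 'm \<Rightarrow> complex ^ 'm" where Q': "clin Q'" "vec.dim (range Q') \<le> Suc i"
      and kernel: "\<And>z. Q' z = 0 \<Longrightarrow> Q z = 0 \<and> l z = 0"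
    proof (cases "range Q = UNIV")
      case True
      then have "inj Q" using vec.linear_surj_imp_inj[OF clin_linear[OF Q(1)]] by blast
      show thesis
      proof (rule that[OF Q(1)])
        show "vec.dim (range Q) \<le> Suc i" using Q(2) by simp
        fix z assume z: "Q z = 0"
        then have "Q z = Q 0" by (simp add: clin_0[OF Q(1)])
        then have "z = 0" using \<open>inj Q\<close> by (simp add: inj_eq)
        then show "Q z = 0 \<and> l z = 0" using z clform_0[OF l(1)] by simp
      qed
    next
      case False
      then obtain w where w: "w \<notin> range Q" by blast
      define Q' where "Q' z = Q z + l z *s w" for z
      have "clin Q'"
        using Q(1) l(1) unfolding clin_def clform_def Q'_def
        by (simp add: vec.scale_left_distrib vec.scale_right_distrib)
      moreover have "range Q' \<subseteq> vec.span (insert w (range Q))"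
        unfolding Q'_def by (auto intro!: vec.span_add vec.span_scale intro: vec.span_base)
      then have "vec.dim (range Q') \<le> Suc i"
        using vec.dim_mono[of "range Q'" "insert w (range Q)"] Q(2) by (simp add: vec.dim_insert split: if_splits)
      moreover have "Q z = 0 \<and> l z = 0" if "Q' z = 0" for z
      proof -
        have "l z = 0"
        proof (rule ccontr)
          assume lz: "l z \<noteq> 0"
          have "Q ((- 1 / l z) *s z) = (- 1 / l z) *s Q z" by (rule clin_scale[OF Q(1)])
          also have "Q z = - (l z *s w)" using that unfolding Q'_def by (simp add: eq_neg_iff_add_eq_0)
          also have "(- 1 / l z) *s - (l z *s w) = w" using lz by (simp add: vec.scale_minus_right)
          finally show False using w by (metis rangeI)
        qed
        then show ?thesis using that unfolding Q'_def by simp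
      qed
      ultimately show thesis using that[of Q'] by blast
    qed
    have "n + Suc i \<le> k"
      if Z: "irred_chain n Z" "\<forall>i\<le>n. ?cl (Z i)" "\<forall>z\<in>Z n. Q' z = 0" "Z n \<noteq> {0}" for n Z
    proof -
      have ZS: "Z n \<subseteq> S" using Z(2) closedin_subset[of "subtopology zariski S" "Z n"] by auto
      have irrZ: "irred (Z n)" using Z(1) unfolding irred_chain_def by blast
      have "Z n \<subseteq> \<Union>F" using Z(3) kernel ZS unfolding F(2)[symmetric] A_def by blast
      then obtain W where W: "W \<in> F" "Z n \<subseteq> W"
        using irred_subset_finite_Union[OF irrZ ZS F(1,4)] by blast
      have "W \<noteq> {0}"
      proof
        assume "W = {0}"
        then show False using W(2) Z(4) irrZ unfolding irred_def by blast
      qed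
      then have pW: "p W \<in> W" "l (p W) \<noteq> 0" using W(1) p l(2) by auto
      \<comment> \<open>The chain is prolonged by the component \<open>W\<close>; the new hyperplane
        contains \<open>Z n\<close> but misses \<open>p W\<close>, so the step is strict.\<close>
      define Z' where "Z' = Z(Suc n := W)"
      have "irred_chain (Suc n) Z'"
        unfolding irred_chain_def
      proof (intro conjI allI impI)
        show "irred (Z' j)" if "j \<le> Suc n" for j
          using that Z(1) F(3)[OF W(1)] unfolding Z'_def irred_chain_def by auto
        fix j assume j: "j < Suc n"
        show "Z' j \<subseteq> Z' (Suc j)"
          using j Z(1) W(2) unfolding Z'_def irred_chain_def by (cases "j = n") auto
        show "\<exists>f. complex_poly_fun f \<and> (\<forall>z\<in>Z' j. f z = 0) \<and> (\<exists>z\<in>Z' (Suc j). f z \<noteq> 0)"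
        proof (cases "j = n")
          case True
          then show ?thesis
            using clform_complex_poly_fun[OF l(1)] Z(3) kernel pW unfolding Z'_def
            by (intro exI[of _ l]) auto
        next
          case False
          then show ?thesis using j Z(1) unfolding Z'_def irred_chain_def by simp
        qed
      qed
      moreover have "\<forall>j\<le>Suc n. ?cl (Z' j)" using Z(2) F(4)[OF W(1)] unfolding Z'_def by auto
      moreover have "\<forall>z\<in>Z' (Suc n). Q z = 0" using W(1) F(2) unfolding Z'_def A_def by auto
      moreover have "Z' (Suc n) \<noteq> {0}" using \<open>W \<noteq> {0}\<close> unfolding Z'_def by simp
      ultimately show ?thesis using chains[of "Suc n" Z'] by simp
    qed
    then show ?case using Q' by blast
  qed
  from ex[OF order.refl] obtain Q :: "complex ^ 'm \<Rightarrow> complex ^ 'm" where Q: "clin Q" "vec.dim (range Q) \<le> k"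
    and chains: "\<And>n Z. irred_chain n Z \<Longrightarrow> \<forall>i\<le>n. ?cl (Z i) \<Longrightarrow> \<forall>z\<in>Z n. Q z = 0 \<Longrightarrow> Z n \<noteq> {0} \<Longrightarrow> n + k \<le> k"
    by auto
  have "v = 0" if v: "v \<in> S" "Q v = 0" for v
  proof (rule ccontr)
    assume "v \<noteq> 0"
    then obtain i where i: "v $ i \<noteq> 0" by (auto simp: Finite_Cartesian_Product.vec_eq_iff)
    \<comment> \<open>The line through a nonzero \<open>v\<close> would lie in the cone and in the
      kernel, and \<open>{0}\<close> below it gives a chain with one step where none is
      left.\<close>
    define Z where "Z j = (if j = 0 then range (\<lambda>s. s *s (0 :: complex ^ 'm)) else range (\<lambda>s. s *s v))" for j :: nat
    have "irred_chain 1 Z"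
      unfolding irred_chain_def
    proof (intro conjI allI impI)
      show "irred (Z j)" for j unfolding Z_def
        using irred_line[of 0] irred_line[of v] by (cases "j = 0") (simp_all only: if_True if_False simp_thms)
      fix j :: nat assume "j < 1"
      then have [simp]: "j = 0" by simp
      have v1: "v \<in> range (\<lambda>s. s *s v)" by (rule range_eqI[of _ _ 1]) simp
      show "Z j \<subseteq> Z (Suc j)" unfolding Z_def by (auto intro: range_eqI[of _ _ 0])
      show "\<exists>f. complex_poly_fun f \<and> (\<forall>z\<in>Z j. f z = 0) \<and> (\<exists>z\<in>Z (Suc j). f z \<noteq> 0)"
        unfolding Z_def using v1 i by (intro exI[of _ "\<lambda>z. z $ i"]) (auto intro: complex_poly_fun.coord)
    qed
    moreover have "?cl (Z j)" for j
    proof -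
      have "Z j \<subseteq> S"
        using cone[OF v(1)] cone[OF v(1), of 0] unfolding Z_def by auto
      moreover have "algebraic_set (Z j)" unfolding Z_def
        using algebraic_set_line[of 0] algebraic_set_line[of v]
        by (cases "j = 0") (simp_all only: if_True if_False simp_thms)
      ultimately show ?thesis unfolding closedin_zariski_subspace by blast
    qed
    moreover have "\<forall>z\<in>Z 1. Q z = 0" unfolding Z_def using v(2) by (auto simp: clin_scale[OF Q(1)])
    moreover have "Z 1 \<noteq> {0}"
    proof -
      have "v \<in> Z 1" unfolding Z_def by (auto intro: range_eqI[of _ _ 1])
      then show ?thesis using \<open>v \<noteq> 0\<close> by blast
    qed
    ultimately show False using chains[of 1 Z] by simp
  qed
  with Q show thesis by (rule that)
qed

subsection \<open>A projection that is finite on \<open>X\<close> and injective far out\<close>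

lemma scaleR_eq_of_real: "c *\<^sub>R (x :: complex ^ 'm) = of_real c *s x"
  unfolding Finite_Cartesian_Product.vec_eq_iff by (simp add: scaleR_conv_of_real[symmetric])

lemma norm_complex_scale: "norm (c *s (x :: complex ^ 'm)) = cmod c * norm x"
  by (simp add: norm_vec_def L2_set_def norm_mult power_mult_distrib real_sqrt_mult flip: sum_distrib_left)

lemma clin_bounded_linear:
  assumes "clin (P :: complex ^ 'm \<Rightarrow> complex ^ 'n)" shows "bounded_linear P"
proof -
  have "linear P"
    by (rule linearI) (simp_all add: clin_add[OF assms] scaleR_eq_of_real clin_scale[OF assms])
  then show ?thesis by (simp add: linear_conv_bounded_linear)
qed

lemma clin_bound:
  assumes "clin (P :: complex ^ 'm \<Rightarrow> complex ^ 'n)"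
  obtains K where "K > 0" "\<And>x. norm (P x) \<le> K * norm x"
  using bounded_linear.pos_bounded[OF clin_bounded_linear[OF assms]] by (metis mult.commute)

text \<open>For linear \<open>Q\<close>: its values on unit secant directions between distant points
  are bounded away from zero. This uniform form, unlike mere injectivity, is stable under
  perturbation and controls growth.\<close>

definition far_injective :: "(complex ^ 'm) set \<Rightarrow> (complex ^ 'm \<Rightarrow> complex ^ 'm) \<Rightarrow> bool" where
  "far_injective X Q \<longleftrightarrow> (\<exists>C R. \<forall>p\<in>X. \<forall>q\<in>X. norm p \<ge> R \<longrightarrow> norm q \<ge> R \<longrightarrow>
     norm (p - q) \<le> C * norm (Q (p - q)))"

lemma far_injectiveE:
  assumes "far_injective X Q"
  obtains C R where "C > 0" "\<And>p q. p \<in> X \<Longrightarrow> q \<in> X \<Longrightarrow> norm p \<ge> R \<Longrightarrow> norm q \<ge> R \<Longrightarrow>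
     norm (p - q) \<le> C * norm (Q (p - q))"
proof -
  obtain C R where C: "\<And>p q. p \<in> X \<Longrightarrow> q \<in> X \<Longrightarrow> norm p \<ge> R \<Longrightarrow> norm q \<ge> R \<Longrightarrow>
     norm (p - q) \<le> C * norm (Q (p - q))"
    using assms unfolding far_injective_def by blast
  have "norm (p - q) \<le> max C 1 * norm (Q (p - q))"
    if "p \<in> X" "q \<in> X" "norm p \<ge> R" "norm q \<ge> R" for p q
    using C[OF that] by (rule order_trans) (intro mult_right_mono, auto)
  then show thesis by (intro that[of "max C 1" R]) auto
qed

lemma far_injective_perturb:
  assumes "far_injective X Q"
  obtains e where "e > 0" "\<And>Q'. (\<And>x. norm (Q' x - Q x) \<le> e * norm x) \<Longrightarrow> far_injective X Q'"
proof -
  obtain C R where C: "C > 0" "\<And>p q. p \<in> X \<Longrightarrow> q \<in> X \<Longrightarrow> norm p \<ge> R \<Longrightarrow> norm q \<ge> R \<Longrightarrow>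
     norm (p - q) \<le> C * norm (Q (p - q))"
    using far_injectiveE[OF assms] by metis
  show thesis
  \<comment> \<open>With this size the perturbation costs at most half of
    \<open>norm (p - q)\<close>, which the left-hand side absorbs by doubling
    \<open>C\<close>.\<close>
  proof (rule that[of "1 / (2 * C)"])
    show "1 / (2 * C) > 0" using C(1) by simp
    fix Q' :: "complex ^ 'a \<Rightarrow> complex ^ 'a"
    assume Q': "\<And>x. norm (Q' x - Q x) \<le> 1 / (2 * C) * norm x"
    have "norm (p - q) \<le> (2 * C) * norm (Q' (p - q))"
      if pq: "p \<in> X" "q \<in> X" "norm p \<ge> R" "norm q \<ge> R" for p q
    proof -
      have "norm (Q (p - q)) \<le> norm (Q' (p - q)) + norm (Q' (p - q) - Q (p - q))"
        by (metis norm_minus_commute norm_triangle_sub)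
      also have "\<dots> \<le> norm (Q' (p - q)) + 1 / (2 * C) * norm (p - q)" using Q' by simp
      finally have "C * norm (Q (p - q)) \<le> C * (norm (Q' (p - q)) + 1 / (2 * C) * norm (p - q))"
        using C(1) by (intro mult_left_mono) auto
      also have "\<dots> = C * norm (Q' (p - q)) + norm (p - q) / 2" using C(1) by (simp add: field_simps)
      finally show ?thesis using C(2)[OF pq] by simp
    qed
    then show "far_injective X Q'" unfolding far_injective_def by blast
  qed
qed

lemma C5_infinity_scale:
  assumes "v \<in> C5_infinity X" shows "c *s v \<in> C5_infinity X"
proof -
  obtain p q :: "nat \<Rightarrow> complex ^ 'a" and t :: "nat \<Rightarrow> complex" where
    pq: "\<forall>j. p j \<in> X" "\<forall>j. q j \<in> X" "filterlim (\<lambda>j. norm (p j)) at_top sequentially"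
    "filterlim (\<lambda>j. norm (q j)) at_top sequentially" "(\<lambda>j. t j *s (p j - q j)) \<longlonglongrightarrow> v"
    using assms unfolding C5_infinity_def by blast
  have "clin (\<lambda>x :: complex ^ 'a. c *s x)"
    by (simp add: clin_def vec.scale_right_distrib mult.commute)
  from bounded_linear.tendsto[OF clin_bounded_linear[OF this] pq(5)]
  have "(\<lambda>j. (c * t j) *s (p j - q j)) \<longlonglongrightarrow> c *s v" by simp
  then show ?thesis using pq unfolding C5_infinity_def
    by (intro CollectI exI[of _ p] exI[of _ q] exI[of _ "\<lambda>j. c * t j"]) auto
qed

text \<open>Otherwise there are secants with endpoints going to infinity on which \<open>Q\<close>
  is relatively ever smaller. Their unit directions accumulate, on the compact sphere, at a unit
  vector that lies in the cone and is killed by \<open>Q\<close>.\<close>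

lemma far_injective_if_transversal:
  fixes X :: "(complex ^ 'm) set"
  assumes Q: "clin Q" and transversal: "\<And>v. v \<in> C5_infinity X \<Longrightarrow> Q v = 0 \<Longrightarrow> v = 0"
  shows "far_injective X Q"
proof (rule ccontr)
  assume "\<not> far_injective X Q"
  then have "\<forall>n :: nat. \<exists>p q. p \<in> X \<and> q \<in> X \<and> norm p \<ge> real n \<and> norm q \<ge> real n \<and>
      norm (p - q) > real n * norm (Q (p - q))"
    unfolding far_injective_def by (meson not_le)
  then obtain p q where pq: "\<And>n. p n \<in> X" "\<And>n. q n \<in> X" "\<And>n. norm (p n) \<ge> real n" "\<And>n. norm (q n) \<ge> real n"
    "\<And>n. norm (p n - q n) > real n * norm (Q (p n - q n))" by metis
  have pos: "norm (p n - q n) > 0" for n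
    using pq(5)[of n] by (meson le_less_trans mult_nonneg_nonneg norm_ge_zero of_nat_0_le_iff)
  define t where "t n = complex_of_real (1 / norm (p n - q n))" for n
  define u where "u n = t n *s (p n - q n)" for n
  have "norm (u n) = 1" for n
    using pos[of n] unfolding u_def norm_complex_scale t_def norm_of_real by simp
  then have "u n \<in> sphere 0 1" for n by simp
  moreover have "compact (sphere (0 :: complex ^ 'm) 1)" by simp
  ultimately obtain v r where v: "v \<in> sphere 0 1" "strict_mono (r :: nat \<Rightarrow> nat)" "(u \<circ> r) \<longlonglongrightarrow> v"
    unfolding compact_def by blast
  have lim: "filterlim (\<lambda>j. norm (s (r j))) at_top sequentially" if "\<And>n. norm (s n) \<ge> real n"
    for s :: "nat \<Rightarrow> complex ^ 'm"
  proof (rule filterlim_at_top_mono[OF filterlim_real_sequentially])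
    show "\<forall>\<^sub>F j in sequentially. real j \<le> norm (s (r j))"
      using that seq_suble[OF v(2)] by (intro always_eventually allI) (meson of_nat_mono order_trans)
  qed
  have "v \<in> C5_infinity X"
    unfolding C5_infinity_def
    using pq lim[of p] lim[of q] v(3)
    by (intro CollectI exI[of _ "\<lambda>j. p (r j)"] exI[of _ "\<lambda>j. q (r j)"] exI[of _ "\<lambda>j. t (r j)"])
       (auto simp: u_def o_def)
  moreover have "Q v = 0"
  proof -
    have "(\<lambda>j. Q (u (r j))) \<longlonglongrightarrow> Q v"
      using bounded_linear.tendsto[OF clin_bounded_linear[OF Q] v(3)] by (simp add: o_def)
    moreover have "(\<lambda>j. Q (u (r j))) \<longlonglongrightarrow> 0"
    proof (rule Lim_null_comparison)
      have "norm (Q (u n)) \<le> 1 / real n" if "n > 0" for n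
      proof -
        have "norm (Q (u n)) = norm (Q (p n - q n)) / norm (p n - q n)"
          unfolding u_def clin_scale[OF Q] norm_complex_scale t_def norm_of_real by simp
        also have "\<dots> \<le> 1 / real n"
          using pq(5)[of n] pos[of n] that by (simp add: field_simps)
        finally show ?thesis .
      qed
      then have "norm (Q (u (r j))) \<le> 1 / real j" if "j > 0" for j
        using that seq_suble[OF v(2), of j]
        by (smt (verit, best) frac_le of_nat_0_less_iff of_nat_mono order_less_le_trans)
      then show "\<forall>\<^sub>F j in sequentially. norm (Q (u (r j))) \<le> 1 / real j"
        using eventually_gt_at_top[of "0 :: nat"] by (rule eventually_mono[rotated])
      show "(\<lambda>j. 1 / real j) \<longlonglongrightarrow> 0" by (rule lim_1_over_n)
    qed
    ultimately show ?thesis by (rule LIMSEQ_unique)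
  qed
  ultimately have "v = 0" by (rule transversal)
  with v(1) show False by simp
qed

text \<open>Finite and dominant implies onto: over a point of the range without preimage,
  \<open>lying_over\<close> would give an element of \<open>pull P\<close> that vanishes on
  \<open>X\<close> but not there, against \<open>dom\<close>.\<close>

lemma projection_surjective:
  fixes X :: "(complex ^ 'm) set"
  assumes X: "algebraic_set X" and P: "clin P" and PP: "\<And>z. P (P z) = P z"
    and fin: "finite_over (pull P) X"
    and dom: "\<And>g. complex_poly_fun g \<Longrightarrow> (\<And>z. z \<in> X \<Longrightarrow> g (P z) = 0) \<Longrightarrow> (\<And>z. g (P z) = 0)"
  obtains p where "p \<in> X" "P p = P x"
proof -
  have "\<exists>p\<in>X. \<forall>g\<in>pull P. g p = g x"
  proof (rule ccontr)
    assume "\<not> ?thesis"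
    then obtain g where g: "g \<in> pull P" "\<And>z. z \<in> X \<Longrightarrow> g z = 0" "g x \<noteq> 0"
      using lying_over[OF fun_subring_pull pull_complex_poly_fun[OF P] fin X, of x] by metis
    then obtain g' where "complex_poly_fun g'" "g = (\<lambda>z. g' (P z))" unfolding pull_def by blast
    then show False using dom[of g'] g by auto
  qed
  then obtain p where p: "p \<in> X" "\<And>g. g \<in> pull P \<Longrightarrow> g p = g x" by blast
  have "P p $ i = P x $ i" for i
  proof (rule p(2))
    show "(\<lambda>z. P z $ i) \<in> pull P"
      unfolding pull_def by (intro CollectI exI[of _ "\<lambda>z. z $ i"]) (simp add: complex_poly_fun.coord)
  qed
  then show thesis using p(1) by (intro that[of p]) (auto simp: Finite_Cartesian_Product.vec_eq_iff)
qed

lemma finite_over_identity: "finite_over (pull (\<lambda>z. z)) X"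
  unfolding finite_over_def
proof (intro exI[of _ "{\<lambda>_. 1}"] conjI allI impI)
  fix f :: "complex ^ 'a \<Rightarrow> complex" assume f: "complex_poly_fun f"
  have "(\<lambda>z. 0 + f z * (\<lambda>_. 1) z) \<in> gen (pull (\<lambda>z. z)) {\<lambda>_. 1}"
    by (rule gen.step[OF gen.zero]) (use f in \<open>auto simp: pull_def\<close>)
  then show "\<exists>h\<in>gen (pull (\<lambda>z. z)) {\<lambda>_. 1}. \<forall>z\<in>X. f z = h z" by auto
qed (auto intro: complex_poly_fun.const)

text \<open>Along the line from \<open>v\<close> in direction \<open>w\<close>, \<open>h\<close> is
  a polynomial in the parameter with degree \<open>D\<close> coefficient \<open>h w\<close>, so it
  has only finitely many zeros.\<close>

lemma small_direction:
  assumes h: "homog D h" "h w \<noteq> 0" and d: "d > 0"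
  obtains e :: complex where "cmod e < d" "h (v + e *s w) \<noteq> 0"
proof -
  obtain Q where "expansion h w D (h w) Q" using homog_expand[OF h(1)] by blast
  note Q = expansionD[OF this]
  have "Q v \<noteq> 0" using Q(3)[of v] h(2) by auto
  then have "finite {t. poly (Q v) t = 0}" by (rule poly_roots_finite)
  moreover have "infinite (complex_of_real ` {0<..<d})"
    using d by (simp add: finite_image_iff inj_on_def)
  ultimately obtain e where "e \<in> complex_of_real ` {0<..<d}" "poly (Q v) e \<noteq> 0"
    by (metis (mono_tags, lifting) finite_subset mem_Collect_eq subsetI)
  then show thesis using Q(4)[of v] by (intro that[of e]) auto
qed

text \<open>Noether normalisation along directions close to the kernel of \<open>Q\<close>: each step perturbs \<open>Q\<close>
  only slightly, so it remains injective far out. A relation is available as long as the rank of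
  \<open>P\<close> exceeds that of \<open>Q\<close>, for otherwise \<open>X\<close> would contain distant points with the same image
  under \<open>Q\<close>.\<close>

lemma far_injective_normalization:
  fixes X :: "(complex ^ 'm) set"
  assumes X: "algebraic_set X"
    and "clin P" "\<And>z. P (P z) = P z" "finite_over (pull P) X"
    and "clin Q" "\<And>z. Q (P z) = Q z" "far_injective X Q"
  shows "\<exists>P'. clin P' \<and> (\<forall>z. P' (P' z) = P' z) \<and> finite_over (pull P') X \<and>
     vec.dim (range P') \<le> vec.dim (range Q) \<and> far_injective X P'"
  using assms(2-)
proof (induction "vec.dim (range P)" arbitrary: P Q rule: less_induct)
  case less
  note P = less.prems(1,2) and fin = less.prems(3) and Q = less.prems(4,5)
  obtain C R where C: "C > 0" "\<And>p q. p \<in> X \<Longrightarrow> q \<in> X \<Longrightarrow> norm p \<ge> R \<Longrightarrow> norm q \<ge> R \<Longrightarrow>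
     norm (p - q) \<le> C * norm (Q (p - q))"
    using far_injectiveE[OF less.prems(6)] by metis
  obtain KP where KP: "KP > 0" "\<And>x. norm (P x) \<le> KP * norm x" using clin_bound[OF P(1)] by metis
  obtain KQ where KQ: "KQ > 0" "\<And>x. norm (Q x) \<le> KQ * norm x" using clin_bound[OF Q(1)] by metis
  show ?case
  proof (cases "vec.dim (range P) \<le> vec.dim (range Q)")
    case True
    \<comment> \<open>\<open>Q\<close> factors through \<open>P\<close>, so the lower bound for
      \<open>Q\<close> passes to \<open>P\<close> up to the norm bound of \<open>Q\<close>.\<close>
    have "norm (p - q) \<le> (C * KQ) * norm (P (p - q))"
      if pq: "p \<in> X" "q \<in> X" "norm p \<ge> R" "norm q \<ge> R" for p q
    proof -
      have "norm (p - q) \<le> C * norm (Q (P (p - q)))" using C(2)[OF pq] Q(2) by simp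
      also have "\<dots> \<le> C * (KQ * norm (P (p - q)))" using C(1) KQ(2) by (intro mult_left_mono) auto
      finally show ?thesis by simp
    qed
    then have "far_injective X P" unfolding far_injective_def by blast
    then show ?thesis using True P fin by blast
  next
    case False
    have "\<exists>v0. P v0 = v0 \<and> v0 \<noteq> 0 \<and> Q v0 = 0"
    proof (rule ccontr)
      assume none: "\<not> ?thesis"
      have "inj_on Q (range P)"
      proof (rule inj_onI)
        fix x y assume "x \<in> range P" "y \<in> range P" "Q x = Q y"
        then have "P (x - y) = x - y" "Q (x - y) = 0"
          using P(2) by (auto simp: clin_diff[OF P(1)] clin_diff[OF Q(1)])
        then show "x = y" using none by (metis eq_iff_diff_eq_0)
      qed
      then have "inj_on Q (vec.span (range P))"
        using subspace_range_clin[OF P(1)] by (metis vec.span_eq_iff)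
      then have "vec.dim (Q ` range P) = vec.dim (range P)"
        by (rule vec.dim_image_eq[OF clin_linear[OF Q(1)]])
      moreover have "vec.dim (Q ` range P) \<le> vec.dim (range Q)" by (rule vec.dim_subset) auto
      ultimately show False using False by simp
    qed
    then obtain v0 where v0: "P v0 = v0" "v0 \<noteq> 0" "Q v0 = 0" by blast
    have "\<exists>g. complex_poly_fun g \<and> (\<forall>z\<in>X. g (P z) = 0) \<and> (\<exists>z. g (P z) \<noteq> 0)"
    proof (rule ccontr)
      assume none: "\<not> ?thesis"
      \<comment> \<open>Without a relation \<open>X\<close> projects onto the range of
        \<open>P\<close>, in particular onto the line of \<open>v0\<close>, which \<open>Q\<close>
        kills.\<close>
      have point: "\<exists>p\<in>X. P p = s *s v0" for s
      proof -
        obtain p where "p \<in> X" "P p = P (s *s v0)"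
          using projection_surjective[OF X P fin, of "s *s v0"] none by metis
        then show ?thesis using v0(1) by (auto simp: clin_scale[OF P(1)])
      qed
      \<comment> \<open>Large enough that a point over \<open>a v0\<close> with real
        \<open>a\<close> at least \<open>S\<close> has norm at least \<open>R\<close>;
        \<open>S + 1\<close> then gives a second, different such point.\<close>
      define S where "S = (1 + \<bar>R\<bar>) * KP / norm v0"
      have far: "norm p \<ge> R" if "P p = of_real a *s v0" "a \<ge> S" for p a
      proof -
        have "S > 0" unfolding S_def using KP(1) v0(2) by simp
        then have "norm (P p) = a * norm v0" using that by (simp add: norm_complex_scale)
        moreover have "a * norm v0 \<ge> (1 + \<bar>R\<bar>) * KP"
          using that(2) v0(2) unfolding S_def by (simp add: divide_le_eq)
        ultimately have "(1 + \<bar>R\<bar>) * KP \<le> norm p * KP" using KP(2)[of p] by (simp add: mult.commute)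
        then have "1 + \<bar>R\<bar> \<le> norm p" using KP(1) by simp
        then show ?thesis by linarith
      qed
      obtain p1 where p1: "p1 \<in> X" "P p1 = of_real S *s v0" using point by blast
      obtain p2 where p2: "p2 \<in> X" "P p2 = of_real (S + 1) *s v0" using point by blast
      have "Q p1 = 0" using Q(2)[of p1] v0(3) unfolding p1(2) clin_scale[OF Q(1)] by simp
      moreover have "Q p2 = 0" using Q(2)[of p2] v0(3) unfolding p2(2) clin_scale[OF Q(1)] by simp
      ultimately have "Q (p1 - p2) = 0" by (simp add: clin_diff[OF Q(1)])
      then have "norm (p1 - p2) \<le> 0" using C(2)[OF p1(1) p2(1) far[OF p1(2)] far[OF p2(2)]] by simp
      then have "p1 = p2" by simp
      then have "(of_real (S + 1) - of_real S) *s v0 = (0 :: complex ^ 'm)"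
        using p1(2) p2(2) by (simp add: vec.scale_left_diff_distrib)
      then show False using v0(2) by simp
    qed
    then obtain g where g: "complex_poly_fun g" "\<exists>z. g (P z) \<noteq> 0" "\<And>z. z \<in> X \<Longrightarrow> g (P z) = 0" by blast
    obtain D h w where h: "homog D h" "P w = w" "h w \<noteq> 0"
      and el: "\<And>v l. P v = v \<Longrightarrow> h v \<noteq> 0 \<Longrightarrow> clform l \<Longrightarrow> finite_over (pull (\<lambda>z. P z - l (P z) *s v)) X"
      using normalization_step[OF P fin g] by blast
    obtain i where i: "v0 $ i \<noteq> 0" using v0(2) by (auto simp: Finite_Cartesian_Product.vec_eq_iff)
    define m where "m z = z $ i / v0 $ i" for z :: "complex ^ 'm"
    have m: "clform m" unfolding m_def clform_def by (simp add: add_divide_distrib)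
    have m_bound: "cmod (m (P z)) \<le> KP / cmod (v0 $ i) * norm z" for z
    proof -
      have "cmod (m (P z)) \<le> norm (P z) / cmod (v0 $ i)"
        unfolding m_def norm_divide by (intro divide_right_mono Finite_Cartesian_Product.norm_nth_le) auto
      also have "\<dots> \<le> (KP * norm z) / cmod (v0 $ i)" by (intro divide_right_mono KP) auto
      finally show ?thesis by simp
    qed
    obtain e where e: "e > 0" "\<And>Q'. (\<And>x. norm (Q' x - Q x) \<le> e * norm x) \<Longrightarrow> far_injective X Q'"
      using far_injective_perturb[OF less.prems(6)] by blast
    \<comment> \<open>Bound for \<open>l\<close> after \<open>P\<close>; the factor 2 pays for
      dividing by \<open>m v\<close>, of modulus at least 1/2.\<close>
    define M where "M = 2 * (KP / cmod (v0 $ i))"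
    have M: "M > 0" unfolding M_def using KP(1) i by simp
    \<comment> \<open>The first entry keeps \<open>m v\<close> within 1/2 of
      \<open>m v0 = 1\<close>, the second keeps \<open>Q'\<close> within \<open>e\<close> of
      \<open>Q\<close>; adding 1 avoids division by zero.\<close>
    define d where "d = min (1 / (2 * (cmod (m w) + 1))) (e / (M * (norm (Q w) + 1)))"
    have "d > 0" unfolding d_def using e(1) M by (simp add: add_nonneg_pos)
    then obtain c where c: "cmod c < d" "h (v0 + c *s w) \<noteq> 0"
      using small_direction[OF h(1,3)] by metis
    define v where "v = v0 + c *s w"
    have Pv: "P v = v" unfolding v_def using v0(1) h(2) by (simp add: clin_add[OF P(1)] clin_scale[OF P(1)])
    have Qv: "Q v = c *s Q w" unfolding v_def using v0(3) by (simp add: clin_add[OF Q(1)] clin_scale[OF Q(1)])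
    have "m v = 1 + c * m w"
      unfolding v_def using i by (simp add: clform_add[OF m] clform_scale[OF m]) (simp add: m_def)
    moreover have "cmod (c * m w) \<le> 1 / 2"
    proof -
      have "cmod c * (cmod (m w) + 1) \<le> 1 / (2 * (cmod (m w) + 1)) * (cmod (m w) + 1)"
        using c(1) unfolding d_def by (intro mult_right_mono) auto
      also have "\<dots> = 1 / 2" by (simp add: field_simps add_nonneg_eq_0_iff)
      finally show ?thesis by (simp add: norm_mult algebra_simps) (smt (verit) norm_ge_zero)
    qed
    ultimately have mv: "cmod (m v) \<ge> 1 / 2"
      using norm_triangle_ineq2[of 1 "- (c * m w)"] by simp
    then have mv0: "m v \<noteq> 0" by auto
    define l where "l z = m z / m v" for z
    have l: "clform l" "l v = 1"
      using m mv0 unfolding l_def clform_def by (simp_all add: add_divide_distrib)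
    define P' where "P' z = P z - l (P z) *s v" for z
    note P' = clin_eliminate_direction[OF P Pv l, folded P'_def]
    \<comment> \<open>Composition with \<open>P'\<close> restores the invariant that
      \<open>Q'\<close> factors through \<open>P'\<close> and cannot raise the rank. The change is a
      multiple of \<open>Q v\<close>, which is small because \<open>Q\<close> kills
      \<open>v0\<close> and only \<open>c\<close> times \<open>Q w\<close> is left.\<close>
    define Q' where "Q' z = Q (P' z)" for z
    have Q': "clin Q'" using P'(1) Q(1) unfolding clin_def Q'_def by simp
    have "norm (Q' z - Q z) \<le> e * norm z" for z
    proof -
      have "Q' z - Q z = - (l (P z) *s Q v)"
        unfolding Q'_def P'_def using Q(2) by (simp add: clin_diff[OF Q(1)] clin_scale[OF Q(1)])
      then have "norm (Q' z - Q z) = cmod (l (P z)) * (cmod c * norm (Q w))"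
        by (simp only: norm_minus_cancel norm_complex_scale Qv)
      also have "\<dots> \<le> (M * norm z) * (e / M)"
      proof (rule mult_mono)
        have "cmod (l (P z)) = cmod (m (P z)) / cmod (m v)" by (simp add: l_def norm_divide)
        also have "\<dots> \<le> (KP / cmod (v0 $ i) * norm z) / (1 / 2)"
          using m_bound[of z] mv KP(1) by (intro frac_le) auto
        finally show "cmod (l (P z)) \<le> M * norm z" unfolding M_def by (simp add: mult_ac)
        have "cmod c * norm (Q w) \<le> e / (M * (norm (Q w) + 1)) * (norm (Q w) + 1)"
          using c(1) e(1) M unfolding d_def by (intro mult_mono) auto
        also have "\<dots> = e / M" using M by (simp add: field_simps add_nonneg_eq_0_iff)
        finally show "cmod c * norm (Q w) \<le> e / M" .
      qed (use M in auto)
      also have "\<dots> = e * norm z" using M by simp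
      finally show ?thesis .
    qed
    then have "far_injective X Q'" by (rule e(2))
    moreover have "Q' (P' z) = Q' z" for z unfolding Q'_def using P'(2) by simp
    moreover have "finite_over (pull P') X" using el[OF Pv _ l(1)] c(2) unfolding v_def[symmetric] P'_def by blast
    ultimately obtain P'' where P'': "clin P''" "\<forall>z. P'' (P'' z) = P'' z" "finite_over (pull P'') X"
      "vec.dim (range P'') \<le> vec.dim (range Q')" "far_injective X P''"
      using less.hyps[OF P'(5) P'(1,2) _ Q'] by blast
    have "vec.dim (range Q') \<le> vec.dim (range Q)" unfolding Q'_def by (rule vec.dim_subset) auto
    then show ?thesis using P'' by (meson order_trans)
  qed
qed

lemma far_injective_projection_exists:
  fixes X :: "(complex ^ 'm) set"
  assumes "algebraic_set X" "has_pure_dim (C5_infinity X) k"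
  obtains P where "clin P" "\<And>z. P (P z) = P z" "finite_over (pull P) X" "vec.dim (range P) \<le> k"
    "far_injective X P"
proof -
  show thesis
  proof (rule cone_section[of "C5_infinity X" k])
    show "c *s v \<in> C5_infinity X" if "v \<in> C5_infinity X" for v c
      using that by (rule C5_infinity_scale)
    show "n \<le> k" if "irred_chain n Z"
      "\<And>i. i \<le> n \<Longrightarrow> closedin (subtopology zariski (C5_infinity X)) (Z i)" for n Z
      using pure_dim_chain_bound[OF assms(2) that] .
    fix Q :: "complex ^ 'm \<Rightarrow> complex ^ 'm"
    assume Q: "clin Q" "vec.dim (range Q) \<le> k" "\<And>v. v \<in> C5_infinity X \<Longrightarrow> Q v = 0 \<Longrightarrow> v = 0"
    have "clin (\<lambda>z :: complex ^ 'm. z)" by (simp add: clin_def)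
    from far_injective_normalization[OF assms(1) this refl finite_over_identity Q(1) refl
        far_injective_if_transversal[OF Q(1,3)]]
    show thesis using that Q(2) by (meson order_trans)
  qed
qed

subsection \<open>Polynomials in one variable\<close>

text \<open>Writing the polynomial as \<open>b + z B1\<close>, the hypothesis bounds
  \<open>B1\<close> far out; a nonconstant \<open>B1\<close> would be unbounded there.\<close>

lemma poly_linear_growth:
  fixes B :: "complex poly"
  assumes "\<And>s. cmod (poly B s) \<le> K * (1 + cmod s)"
  shows "\<exists>\<alpha> \<beta>. B = [:\<alpha>, \<beta>:]"
proof -
  obtain b B1 where B: "B = pCons b B1" by (cases B) auto
  obtain \<beta> p where B1: "B1 = pCons \<beta> p" by (cases B1) auto
  have "p = 0"
  proof (rule ccontr)
    assume "p \<noteq> 0"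
    from poly_infinity[OF this, of "cmod b + 2 * \<bar>K\<bar> + 1" \<beta>]
    obtain r where r: "\<And>z. r \<le> cmod z \<Longrightarrow> cmod b + 2 * \<bar>K\<bar> + 1 \<le> cmod (poly (pCons \<beta> p) z)" by blast
    define z where "z = complex_of_real (1 + \<bar>r\<bar>)"
    have z: "cmod z = 1 + \<bar>r\<bar>" unfolding z_def norm_of_real by simp
    have "cmod z * cmod (poly B1 z) = cmod (poly B z - b)" by (simp add: B norm_mult)
    also have "\<dots> \<le> cmod (poly B z) + cmod b" by (rule norm_triangle_ineq4)
    also have "\<dots> \<le> \<bar>K\<bar> * (1 + cmod z) + cmod b"
      using assms[of z] abs_ge_self[of K] by (smt (verit) mult_right_mono norm_ge_zero)
    also have "\<dots> \<le> cmod z * (2 * \<bar>K\<bar> + cmod b)"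
    proof -
      have "\<bar>K\<bar> * (1 + cmod z) \<le> \<bar>K\<bar> * (2 * cmod z)" using z by (intro mult_left_mono) auto
      moreover have "1 * cmod b \<le> cmod z * cmod b" using z by (intro mult_right_mono) auto
      ultimately show ?thesis by (simp add: algebra_simps)
    qed
    finally have "cmod (poly B1 z) \<le> 2 * \<bar>K\<bar> + cmod b" using z by (simp add: mult_le_cancel_left)
    moreover have "r \<le> cmod z" using z by linarith
    ultimately show False using r[of z] unfolding B1 by linarith
  qed
  then show ?thesis using B B1 by blast
qed

text \<open>By the estimate every root of \<open>A\<close> is a root of \<open>B\<close>, and the
  common linear factor can be cancelled on both sides until \<open>A\<close> is constant.\<close>

lemma poly_quotient_linear_growth:
  fixes A B :: "complex poly"
  assumes "A \<noteq> 0" "\<And>s. cmod (poly B s) \<le> K * (1 + cmod s) * cmod (poly A s)"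
  shows "\<exists>\<alpha> \<beta>. B = [:\<alpha>, \<beta>:] * A"
  using assms
proof (induction "degree A" arbitrary: A B)
  case 0
  then obtain c where c: "A = [:c:]" "c \<noteq> 0" by (metis degree_eq_zeroE pCons_0_0)
  have "cmod (poly B s) \<le> (K * cmod c) * (1 + cmod s)" for s
    using 0(3)[of s] by (simp add: c mult_ac)
  from poly_linear_growth[OF this] obtain \<alpha> \<beta> where "B = [:\<alpha>, \<beta>:]" by blast
  then have "B = [:\<alpha> / c, \<beta> / c:] * A" using c by simp
  then show ?case by blast
next
  case (Suc n)
  then have "\<not> constant (poly A)" by (metis constant_degree nat.distinct(1))
  then obtain r where r: "poly A r = 0" using fundamental_theorem_of_algebra by blast
  then have "poly B r = 0" using Suc.prems(2)[of r] by simp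
  then obtain B1 where B1: "B = [:-r, 1:] * B1" by (auto simp: poly_eq_0_iff_dvd)
  obtain A1 where A1: "A = [:-r, 1:] * A1" using r by (auto simp: poly_eq_0_iff_dvd)
  have "A1 \<noteq> 0" using Suc.prems(1) A1 by auto
  have "n = degree A1"
    using Suc.hyps(2) degree_mult_eq[of "[:-r, 1:]" A1] \<open>A1 \<noteq> 0\<close> unfolding A1 by (simp del: mult_pCons_left)
  have off: "cmod (poly B1 s) \<le> K * (1 + cmod s) * cmod (poly A1 s)" if "s \<noteq> r" for s
  proof -
    have "cmod (s - r) * cmod (poly B1 s) \<le> cmod (s - r) * (K * (1 + cmod s) * cmod (poly A1 s))"
    proof -
      have "poly A s = (s - r) * poly A1 s" "poly B s = (s - r) * poly B1 s"
        by (simp_all add: A1 B1 algebra_simps)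
      then show ?thesis using Suc.prems(2)[of s] by (simp add: norm_mult mult_ac)
    qed
    then show ?thesis using that by (simp add: mult_le_cancel_left)
  qed
  \<comment> \<open>Cancelling \<open>s - r\<close> loses the estimate at \<open>r\<close> itself;
    it is recovered by continuity.\<close>
  define h where "h s = K * (1 + cmod s) * cmod (poly A1 s) - cmod (poly B1 s)" for s
  have "(h \<longlongrightarrow> h r) (at r)"
    unfolding h_def by (intro tendsto_intros poly_isCont[unfolded isCont_def])
  moreover have "\<forall>\<^sub>F s in at r. 0 \<le> h s"
    using off unfolding h_def eventually_at_filter by (intro always_eventually) auto
  ultimately have "0 \<le> h r" by (rule tendsto_lowerbound) simp
  then have "cmod (poly B1 s) \<le> K * (1 + cmod s) * cmod (poly A1 s)" for s
    using off[of s] unfolding h_def by (cases "s = r") auto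
  from Suc.hyps(1)[OF \<open>n = degree A1\<close> \<open>A1 \<noteq> 0\<close> this] obtain \<alpha> \<beta> where "B1 = [:\<alpha>, \<beta>:] * A1" by blast
  then have "B = [:\<alpha>, \<beta>:] * A" unfolding A1 B1 by (simp only: mult_ac)
  then show ?case by blast
qed

text \<open>\<open>q\<close> is a multiple of \<open>(x - c) ^ Suc n\<close>, so the sum of its
  roots gives \<open>c\<close> as a quotient of two coefficients of \<open>q\<close>; this is the
  source of the rational expressions for the coordinates.\<close>

lemma coeff_unique_root:
  fixes q :: "complex poly"
  assumes "degree q = Suc n" "\<And>y. poly q y = 0 \<Longrightarrow> y = c"
  shows "coeff q n = - of_nat (Suc n) * c * coeff q (Suc n)"
  using assms
proof (induction n arbitrary: q)
  case (0 q)
  then have "\<not> constant (poly q)" by (metis constant_degree nat.distinct(1))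
  then obtain y where "poly q y = 0" using fundamental_theorem_of_algebra by blast
  then have "poly q c = 0" using 0(2) by blast
  then show ?case using 0(1) by (simp add: poly_altdef eq_neg_iff_add_eq_0 add.commute mult.commute)
next
  case (Suc n q)
  then have "\<not> constant (poly q)" by (metis constant_degree nat.distinct(1))
  then obtain y where "poly q y = 0" using fundamental_theorem_of_algebra by blast
  then have "poly q c = 0" using Suc.prems(2) by blast
  then obtain q1 where q1: "q = [:-c, 1:] * q1" by (auto simp: poly_eq_0_iff_dvd)
  have "q1 \<noteq> 0" using Suc.prems(1) q1 by auto
  then have "degree q1 = Suc n"
    using Suc.prems(1) degree_mult_eq[of "[:-c, 1:]" q1] unfolding q1 by (simp del: mult_pCons_left)
  moreover from this have IH: "coeff q1 n = - of_nat (Suc n) * c * coeff q1 (Suc n)"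
    using Suc.IH[of q1] Suc.prems(2) unfolding q1 by (simp del: mult_pCons_left)
  ultimately have "coeff q1 (Suc (Suc n)) = 0" by (simp add: coeff_eq_0)
  then show ?case unfolding q1 by (simp add: IH algebra_simps)
qed

subsection \<open>Coordinates are affine functions of the projection\<close>

text \<open>Encodes the differential at \<open>x0\<close> by linear coefficients along lines. It
  serves to show that slopes found separately on each line depend linearly on the direction.\<close>

lemma directional_derivative:
  fixes x0 :: "complex ^ 'm"
  assumes "complex_poly_fun f"
  shows "\<exists>D. clform D \<and> (\<forall>w. \<exists>Q. (\<forall>t. f (x0 + t *s w) = poly Q t) \<and> coeff Q 1 = D w)"
  using assms
proof induction
  case (const c)
  have "clform (\<lambda>_. 0)" by (simp add: clform_def)
  then show ?case by (intro exI[of _ "\<lambda>_. 0"] conjI allI exI[of _ "[:c:]"]) auto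
next
  case (coord i)
  show ?case
    by (rule exI[of _ "\<lambda>w. w $ i"], intro conjI clform_coord allI)
       (rule_tac x = "[:x0 $ i, w $ i:]" in exI, simp)
next
  case (add f g)
  then obtain D E where D: "clform D" "\<And>w. \<exists>Q. (\<forall>t. f (x0 + t *s w) = poly Q t) \<and> coeff Q 1 = D w"
    and E: "clform E" "\<And>w. \<exists>Q. (\<forall>t. g (x0 + t *s w) = poly Q t) \<and> coeff Q 1 = E w" by blast
  have "\<exists>Q. (\<forall>t. f (x0 + t *s w) + g (x0 + t *s w) = poly Q t) \<and> coeff Q 1 = D w + E w" for w
  proof -
    obtain Q Q' where "\<forall>t. f (x0 + t *s w) = poly Q t" "coeff Q 1 = D w"
      "\<forall>t. g (x0 + t *s w) = poly Q' t" "coeff Q' 1 = E w" using D(2) E(2) by metis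
    then show ?thesis by (intro exI[of _ "Q + Q'"]) simp
  qed
  moreover have "clform (\<lambda>w. D w + E w)" using D(1) E(1) by (simp add: clform_def algebra_simps)
  ultimately show ?case by (intro exI[of _ "\<lambda>w. D w + E w"]) blast
next
  case (mult f g)
  then obtain D E where D: "clform D" "\<And>w. \<exists>Q. (\<forall>t. f (x0 + t *s w) = poly Q t) \<and> coeff Q 1 = D w"
    and E: "clform E" "\<And>w. \<exists>Q. (\<forall>t. g (x0 + t *s w) = poly Q t) \<and> coeff Q 1 = E w" by blast
  have "\<exists>Q. (\<forall>t. f (x0 + t *s w) * g (x0 + t *s w) = poly Q t) \<and> coeff Q 1 = f x0 * E w + g x0 * D w" for w
  proof -
    obtain Q Q' where Q: "\<forall>t. f (x0 + t *s w) = poly Q t" "coeff Q 1 = D w"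
      "\<forall>t. g (x0 + t *s w) = poly Q' t" "coeff Q' 1 = E w" using D(2) E(2) by metis
    have "coeff Q 0 = f x0" "coeff Q' 0 = g x0"
      using Q(1)[rule_format, of 0] Q(3)[rule_format, of 0] by (simp_all add: poly_0_coeff_0)
    then show ?thesis using Q by (intro exI[of _ "Q * Q'"]) (simp add: coeff_mult algebra_simps)
  qed
  moreover have "clform (\<lambda>w. f x0 * E w + g x0 * D w)" using D(1) E(1) by (simp add: clform_def algebra_simps)
  ultimately show ?case by (intro exI[of _ "\<lambda>w. f x0 * E w + g x0 * D w"]) blast
qed

text \<open>On every line through \<open>x0\<close> the quotient \<open>b / a\<close> is an affine
  function of the parameter; its slope at \<open>x0\<close> is computed by the quotient rule and
  hence linear in the direction.\<close>

lemma quotient_affine: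
  fixes a b :: "complex ^ 'm \<Rightarrow> complex"
  assumes a: "complex_poly_fun a" and b: "complex_poly_fun b" and x0: "a x0 \<noteq> 0"
    and bound: "\<And>x. cmod (b x) \<le> K * (1 + norm x) * cmod (a x)"
  obtains c l where "clform l" "\<And>x. b x = (c + l x) * a x"
proof -
  obtain Da where Da: "clform Da" "\<And>w. \<exists>Q. (\<forall>t. a (x0 + t *s w) = poly Q t) \<and> coeff Q 1 = Da w"
    using directional_derivative[OF a] by blast
  obtain Db where Db: "clform Db" "\<And>w. \<exists>Q. (\<forall>t. b (x0 + t *s w) = poly Q t) \<and> coeff Q 1 = Db w"
    using directional_derivative[OF b] by blast
  define \<alpha> where "\<alpha> = b x0 / a x0"
  define \<beta> where "\<beta> w = (Db w - \<alpha> * Da w) / a x0" for w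
  have \<beta>: "clform \<beta>" using Da(1) Db(1) by (simp add: clform_def \<beta>_def algebra_simps add_divide_distrib diff_divide_distrib)
  have key: "b (x0 + w) = (\<alpha> + \<beta> w) * a (x0 + w)" for w
  proof -
    obtain A where A: "\<And>t. a (x0 + t *s w) = poly A t" "coeff A 1 = Da w" using Da(2) by blast
    obtain B where B: "\<And>t. b (x0 + t *s w) = poly B t" "coeff B 1 = Db w" using Db(2) by blast
    have A0: "coeff A 0 = a x0" and B0: "coeff B 0 = b x0"
      using A(1)[of 0] B(1)[of 0] by (simp_all add: poly_0_coeff_0)
    then have "A \<noteq> 0" using x0 by auto
    \<comment> \<open>Comes from bounding \<open>1 + norm (x0 + s w)\<close> by
      \<open>(1 + norm x0 + norm w) (1 + cmod s)\<close>; the absolute value spares a sign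
      argument.\<close>
    define K' where "K' = \<bar>K\<bar> * (1 + norm x0 + norm w)"
    have "cmod (poly B s) \<le> K' * (1 + cmod s) * cmod (poly A s)" for s
    proof -
      have "norm (x0 + s *s w) \<le> norm x0 + cmod s * norm w"
        using norm_triangle_ineq[of x0 "s *s w"] by (simp add: norm_complex_scale)
      moreover have "0 \<le> cmod s * norm x0" "0 \<le> norm w" "0 \<le> cmod s" by simp_all
      moreover have "(1 + norm x0 + norm w) * (1 + cmod s)
          = 1 + norm x0 + norm w + cmod s + cmod s * norm x0 + cmod s * norm w"
        by (simp add: algebra_simps)
      ultimately have "1 + norm (x0 + s *s w) \<le> (1 + norm x0 + norm w) * (1 + cmod s)"
        by linarith
      then have "\<bar>K\<bar> * (1 + norm (x0 + s *s w)) \<le> \<bar>K\<bar> * ((1 + norm x0 + norm w) * (1 + cmod s))"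
        by (rule mult_left_mono) simp
      moreover have "K * (1 + norm (x0 + s *s w)) \<le> \<bar>K\<bar> * (1 + norm (x0 + s *s w))"
        by (intro mult_right_mono) (auto simp: add_nonneg_nonneg)
      ultimately have "K * (1 + norm (x0 + s *s w)) \<le> K' * (1 + cmod s)"
        unfolding K'_def by (simp add: mult.assoc)
      then have "K * (1 + norm (x0 + s *s w)) * cmod (poly A s) \<le> K' * (1 + cmod s) * cmod (poly A s)"
        by (rule mult_right_mono) simp
      then show ?thesis using bound[of "x0 + s *s w"] unfolding A(1) B(1) by linarith
    qed
    from poly_quotient_linear_growth[OF \<open>A \<noteq> 0\<close> this] obtain \<alpha>' \<beta>' where AB: "B = [:\<alpha>', \<beta>':] * A" by blast
    have "b x0 = \<alpha>' * a x0" using A0 B0 unfolding AB by (simp add: coeff_mult)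
    then have "\<alpha>' = \<alpha>" unfolding \<alpha>_def using x0 by simp
    have "Db w = \<alpha>' * Da w + \<beta>' * a x0" using A(2) A0 B(2) unfolding AB by (simp add: coeff_mult)
    then have "\<beta>' = \<beta> w" unfolding \<beta>_def using x0 \<open>\<alpha>' = \<alpha>\<close> by simp
    show ?thesis
      using A(1)[of 1] B(1)[of 1] unfolding AB \<open>\<alpha>' = \<alpha>\<close> \<open>\<beta>' = \<beta> w\<close> by (simp add: algebra_simps)
  qed
  show thesis
  proof (rule that[OF \<beta>])
    show "b x = ((\<alpha> - \<beta> x0) + \<beta> x) * a x" for x
      using key[of "x - x0"] by (simp add: clform_diff[OF \<beta>] algebra_simps)
  qed
qed

text \<open>The norm of \<open>f\<close> lies in \<open>pull P\<close> and vanishes over all distant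
  points of the range. On lines in direction \<open>w\<close>, which leave every bounded set after
  projection, it has infinitely many zeros, so it is zero everywhere; but a function that is nonzero
  on \<open>B\<close> has a nonzero norm there.\<close>

lemma far_vanishing:
  fixes B :: "(complex ^ 'm) set"
  assumes P: "clin P" and PP: "\<And>z. P (P z) = P z" and w: "P w = w" "w \<noteq> 0"
    and B: "irred B" "finite_over (pull P) B" and surj: "\<And>x. \<exists>p\<in>B. P p = P x"
    and f: "complex_poly_fun f" and van: "\<And>p. p \<in> B \<Longrightarrow> norm (P p) \<ge> R \<Longrightarrow> f p = 0"
  shows "\<forall>p\<in>B. f p = 0"
proof (rule ccontr)
  assume "\<not> (\<forall>p\<in>B. f p = 0)"
  then have "\<exists>p\<in>B. f p \<noteq> 0" by blast
  from irred_norm[OF fun_subring_pull pull_complex_poly_fun[OF P] B f this]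
  obtain a where a: "a \<in> pull P" "\<exists>z\<in>B. a z \<noteq> 0" "\<And>z. z \<in> B \<Longrightarrow> f z = 0 \<Longrightarrow> a z = 0" by blast
  have far: "a x = 0" if "norm (P x) \<ge> R" for x
  proof -
    obtain p where p: "p \<in> B" "P p = P x" using surj by blast
    then have "a p = 0" using a(3) van that by simp
    then show ?thesis using pull_apply[OF a(1) p(2)] by simp
  qed
  have "complex_poly_fun a" using a(1) pull_complex_poly_fun[OF P] by blast
  then obtain D c Q where "expansion a w D c Q" using top_form by metis
  note Q = expansionD(4)[OF this]
  have "a x = 0" for x
  proof -
    have "poly (Q x) (of_real s) = 0" if "s \<ge> (\<bar>R\<bar> + norm (P x)) / norm w" for s
    proof -
      have "\<bar>R\<bar> + norm (P x) \<le> s * norm w" using that w(2) by (simp add: divide_le_eq)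
      moreover have "0 \<le> s" using that by (rule order_trans[rotated]) simp
      then have "norm (P (x + of_real s *s w) - P x) = s * norm w"
        by (simp add: clin_add[OF P] clin_scale[OF P] w(1) norm_complex_scale)
      ultimately have "R \<le> norm (P (x + of_real s *s w))"
        using norm_triangle_ineq4[of "P (x + of_real s *s w)" "P x"] by linarith
      then show ?thesis using far Q[of x "of_real s"] by simp
    qed
    then have "complex_of_real ` {(\<bar>R\<bar> + norm (P x)) / norm w..} \<subseteq> {t. poly (Q x) t = 0}" by auto
    moreover have "infinite (complex_of_real ` {(\<bar>R\<bar> + norm (P x)) / norm w..})"
      by (simp add: finite_image_iff inj_on_def infinite_Ici)
    ultimately have "Q x = 0" using poly_roots_finite finite_subset by metis
    then show ?thesis using Q[of x 0] by simp
  qed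
  then show False using a(2) by blast
qed

lemma far_injective_linear_growth:
  assumes P: "clin P" and far: "far_injective X P"
  obtains K where "\<And>p. p \<in> X \<Longrightarrow> norm p \<le> K * (1 + norm (P p))"
proof -
  obtain C R where C: "C > 0" "\<And>p q. p \<in> X \<Longrightarrow> q \<in> X \<Longrightarrow> norm p \<ge> R \<Longrightarrow> norm q \<ge> R \<Longrightarrow>
     norm (p - q) \<le> C * norm (P (p - q))"
    using far_injectiveE[OF far] by metis
  obtain M where M: "M \<ge> 0" "\<And>p. p \<in> X \<Longrightarrow> norm p \<ge> R \<Longrightarrow> norm p \<le> M + C * norm (P p)"
  proof (cases "\<exists>q\<in>X. norm q \<ge> R")
    case True
    then obtain q where q: "q \<in> X" "norm q \<ge> R" by blast
    have "norm p \<le> (norm q + C * norm (P q)) + C * norm (P p)" if p: "p \<in> X" "norm p \<ge> R" for p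
    proof -
      have "norm p \<le> norm q + norm (p - q)" by (metis norm_triangle_sub)
      also have "norm (p - q) \<le> C * norm (P p - P q)" using C(2)[OF p(1) q(1) p(2) q(2)] by (simp add: clin_diff[OF P])
      also have "\<dots> \<le> C * (norm (P p) + norm (P q))" using C(1) by (intro mult_left_mono norm_triangle_ineq4) auto
      finally show ?thesis by (simp add: algebra_simps)
    qed
    then show thesis using C(1) by (intro that[of "norm q + C * norm (P q)"]) auto
  next
    case False
    then show thesis by (intro that[of 0]) auto
  qed
  define T where "T = M + C + \<bar>R\<bar>"
  have T: "M + \<bar>R\<bar> \<le> T" "C \<le> T" unfolding T_def using M(1) C(1) by auto
  show thesis
  proof (rule that[of T])
    fix p assume p: "p \<in> X"
    have C_nonneg: "0 \<le> C * norm (P p)" using C(1) by simp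
    have "norm p \<le> M + C * norm (P p) + \<bar>R\<bar>"
    proof (cases "norm p \<ge> R")
      case True
      then show ?thesis using M(2)[OF p] by linarith
    next
      case False
      then show ?thesis using M(1) C_nonneg by linarith
    qed
    moreover have "C * norm (P p) \<le> T * norm (P p)" using T(2) by (rule mult_right_mono) simp
    moreover have "T * (1 + norm (P p)) = T + T * norm (P p)" by (simp add: distrib_left)
    ultimately show "norm p \<le> T * (1 + norm (P p))" using T(1) by linarith
  qed
qed

text \<open>Pseudo-division of \<open>b\<close> by the minimal relation \<open>a\<close>: the remainder is a relation of too small
  degree, hence zero.\<close>

lemma minimal_relation_divides:
  assumes sub: "fun_subring S" and dom: "\<forall>c\<in>S. (\<forall>z\<in>X. c z = 0) \<longrightarrow> (\<forall>z. c z = 0)"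
    and a: "\<And>i. a i \<in> S" "\<And>z. z \<in> X \<Longrightarrow> (\<Sum>i\<le>r. a i z * u z ^ i) = 0"
    and minimal: "\<And>N b. \<lbrakk>N \<ge> 1; \<And>i. b i \<in> S; \<exists>z. b N z \<noteq> 0; \<And>z. z \<in> X \<Longrightarrow> (\<Sum>i\<le>N. b i z * u z ^ i) = 0\<rbrakk>
        \<Longrightarrow> r \<le> N"
    and z0: "a r z0 \<noteq> 0" "(\<Sum>i\<le>r. a i z0 * u z0 ^ i) = 0"
    and b: "\<And>i. b i \<in> S" "\<And>z. z \<in> X \<Longrightarrow> (\<Sum>i\<le>N. b i z * u z ^ i) = 0"
  shows "(\<Sum>i\<le>N. b i z0 * u z0 ^ i) = 0"
  using b
proof (induction N arbitrary: b)
  case 0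
  then have "b 0 z0 = 0" using dom by simp
  then show ?case by simp
next
  case (Suc N)
  show ?case
  proof (cases "\<exists>z. b (Suc N) z \<noteq> 0")
    case False
    then have "(\<Sum>i\<le>N. b i z * u z ^ i) = 0" if "z \<in> X" for z using Suc.prems(2)[OF that] by simp
    then show ?thesis using False Suc.IH[OF Suc.prems(1)] by simp
  next
    case True
    then have r: "r \<le> Suc N" using minimal[of "Suc N" b] Suc.prems by simp
    define d where "d = Suc N - r"
    have d: "d \<le> Suc N" "Suc N - d = r" using r unfolding d_def by auto
    \<comment> \<open>The pseudo-remainder: \<open>b\<close> times the leading coefficient of
      \<open>a\<close>, minus the shifted \<open>a\<close> times that of \<open>b\<close>, so the
      degree \<open>Suc N\<close> terms cancel.\<close>
    define c where "c i z = a r z * b i z - b (Suc N) z * (if i < d then 0 else a (i - d) z)" for i z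
    have cS: "c i \<in> S" for i
    proof (cases "i < d")
      case True
      then show ?thesis
        using fun_subring_mult[OF sub a(1)[of r] Suc.prems(1)[of i]] by (simp add: c_def[abs_def])
    next
      case False
      then show ?thesis
        using fun_subring_diff[OF sub fun_subring_mult[OF sub a(1)[of r] Suc.prems(1)[of i]]
            fun_subring_mult[OF sub Suc.prems(1)[of "Suc N"] a(1)[of "i - d"]]]
        by (simp add: c_def[abs_def])
    qed
    have "c (Suc N) z = 0" for z using d by (simp add: c_def)
    then have "(\<Sum>i\<le>N. c i z * u z ^ i) = (\<Sum>i\<le>Suc N. c i z * u z ^ i)" for z by simp
    moreover have "(\<Sum>i\<le>Suc N. c i z * u z ^ i) = a r z * (\<Sum>i\<le>Suc N. b i z * u z ^ i)
        - b (Suc N) z * (\<Sum>i\<le>Suc N. (if i < d then 0 else a (i - d) z) * u z ^ i)" for z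
      unfolding c_def sum_distrib_left by (simp only: left_diff_distrib sum_subtractf mult.assoc)
    moreover have "(\<Sum>i\<le>Suc N. (if i < d then 0 else a (i - d) z) * u z ^ i)
        = u z ^ d * (\<Sum>i\<le>r. a i z * u z ^ i)" for z
      using sum_shift_power[OF d(1), of "\<lambda>i. a i z" "u z"] unfolding d(2) .
    ultimately have c_eq: "(\<Sum>i\<le>N. c i z * u z ^ i) = a r z * (\<Sum>i\<le>Suc N. b i z * u z ^ i)
        - b (Suc N) z * (u z ^ d * (\<Sum>i\<le>r. a i z * u z ^ i))" for z
      by (simp only:)
    have "(\<Sum>i\<le>N. c i z * u z ^ i) = 0" if "z \<in> X" for z
      unfolding c_eq using a(2)[OF that] Suc.prems(2)[OF that] by simp
    from Suc.IH[OF cS this] have "a r z0 * (\<Sum>i\<le>Suc N. b i z0 * u z0 ^ i) = 0"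
      unfolding c_eq z0(2) by simp
    then show ?thesis using z0(1) by simp
  qed
qed

text \<open>A relation of least degree \<open>r\<close> for the coordinate over
  \<open>pull P\<close> has all its roots attained by points of \<open>X\<close>, wherever its
  leading coefficient is nonzero. Over a distant point injectivity allows only one root, of
  multiplicity \<open>r\<close>, which the sum of the roots expresses by two coefficients.
  Irreducibility spreads this to all of \<open>X\<close>.\<close>

lemma degree_one_relation:
  fixes X :: "(complex ^ 'm) set"
  assumes X: "algebraic_set X" "irred X" and P: "clin P" and PP: "\<And>z. P (P z) = P z"
    and w: "P w = w" "w \<noteq> 0" and fin: "finite_over (pull P) X"
    and dom: "\<forall>g\<in>pull P. (\<forall>z\<in>X. g z = 0) \<longrightarrow> (\<forall>z. g z = 0)"
    and surj: "\<And>x. \<exists>p\<in>X. P p = P x" and far: "far_injective X P"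
  obtains a b where "a \<in> pull P" "b \<in> pull P" "\<exists>z. a z \<noteq> 0" "\<And>p. p \<in> X \<Longrightarrow> a p * p $ j = b p"
proof (cases "\<forall>z. z $ j = P z $ j")
  case True
  have "(\<lambda>z. P z $ j) \<in> pull P"
    unfolding pull_def by (intro CollectI exI[of _ "\<lambda>z. z $ j"]) (simp add: complex_poly_fun.coord)
  then show thesis
    using True by (intro that[of "\<lambda>_. 1" "\<lambda>z. P z $ j"]) (auto intro: fun_subring_const[OF fun_subring_pull])
next
  case False
  then obtain z1 where z1: "z1 $ j \<noteq> P z1 $ j" by blast
  \<comment> \<open>A vector in the kernel of \<open>P\<close> that moves coordinate
    \<open>j\<close>, so that the projection and coordinate \<open>j\<close> of a point can be
    prescribed independently.\<close>
  define w' where "w' = z1 - P z1"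
  have w': "P w' = 0" "w' $ j \<noteq> 0" unfolding w'_def using z1 by (simp_all add: clin_diff[OF P] PP)
  note S = fun_subring_pull[of P]
  define rel where "rel N b \<longleftrightarrow> N \<ge> 1 \<and> (\<forall>i. b i \<in> pull P) \<and> (\<exists>z. b N z \<noteq> 0) \<and>
     (\<forall>z\<in>X. (\<Sum>i\<le>N. b i z * (z $ j) ^ i) = 0)" for N b
  have "\<exists>N b. rel N b"
  proof -
    obtain n a where a: "\<And>i. a i \<in> pull P" "\<And>z. z \<in> X \<Longrightarrow> (z $ j) ^ n + (\<Sum>i<n. a i z * (z $ j) ^ i) = 0"
      using finite_over_integral[OF S fin complex_poly_fun.coord[of j]] by metis
    define b where "b = a(n := \<lambda>_. 1)"
    have "n \<noteq> 0"
    proof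
      assume "n = 0"
      moreover obtain z where "z \<in> X" using X(2) unfolding irred_def by blast
      ultimately show False using a(2)[of z] by simp
    qed
    moreover have "b i \<in> pull P" for i unfolding b_def using a(1) fun_subring_const[OF S] by simp
    moreover have "(\<Sum>i\<le>n. b i z * (z $ j) ^ i) = 0" if "z \<in> X" for z
    proof -
      have "(\<Sum>i<n. b i z * (z $ j) ^ i) = (\<Sum>i<n. a i z * (z $ j) ^ i)"
        by (rule sum.cong) (auto simp: b_def)
      then show ?thesis using a(2)[OF that]
        by (simp add: b_def add.commute flip: lessThan_Suc_atMost)
    qed
    ultimately have "rel n b" unfolding rel_def by (auto simp: b_def)
    then show ?thesis by blast
  qed
  then have "\<exists>r a. rel r a \<and> (\<forall>N b. rel N b \<longrightarrow> r \<le> N)"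
    using exists_least_iff[of "\<lambda>N. \<exists>b. rel N b"] by (metis not_le)
  then obtain r a where rel: "rel r a" and least: "\<And>N b. rel N b \<Longrightarrow> r \<le> N" by blast
  have r1: "r \<ge> 1" and aS: "\<And>i. a i \<in> pull P" and ar: "\<exists>z. a r z \<noteq> 0"
    and aX: "\<And>z. z \<in> X \<Longrightarrow> (\<Sum>i\<le>r. a i z * (z $ j) ^ i) = 0" using rel unfolding rel_def by blast+
  \<comment> \<open>\<open>lying_over\<close> is applied to the ring generated by
    \<open>pull P\<close> and the coordinate: an unattained pair of values would give a polynomial
    in the coordinate that vanishes on \<open>X\<close> but not at \<open>z0\<close>, which
    \<open>minimal_relation_divides\<close> excludes.\<close>
  have root_attained: "\<exists>p\<in>X. P p = P x \<and> p $ j = y"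
    if x: "a r x \<noteq> 0" and y: "(\<Sum>i\<le>r. a i x * y ^ i) = 0" for x y
  proof (rule ccontr)
    assume none: "\<not> ?thesis"
    define z0 where "z0 = P x + ((y - P x $ j) / w' $ j) *s w'"
    have z0: "P z0 = P x" "z0 $ j = y"
      unfolding z0_def using w' by (simp_all add: clin_add[OF P] clin_scale[OF P] PP)
    let ?T = "adjoin (pull P) (\<lambda>z. z $ j)"
    have incl: "pull P \<subseteq> ?T" by (rule adjoin_incl[OF S])
    have TP: "?T \<subseteq> Collect complex_poly_fun"
    proof
      fix f assume "f \<in> ?T"
      then obtain N b where fb: "f = (\<lambda>z. \<Sum>i\<le>N. b i z * (z $ j) ^ i)" "\<forall>i. b i \<in> pull P"
        unfolding adjoin_def by blast
      have "complex_poly_fun (b i)" for i using fb(2) pull_complex_poly_fun[OF P] by blast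
      then show "f \<in> Collect complex_poly_fun" unfolding fb(1)
        by (intro CollectI complex_poly_fun_sum complex_poly_fun.mult complex_poly_fun_power complex_poly_fun.coord)
    qed
    have sep: "\<exists>g\<in>?T. g p \<noteq> g z0" if p: "p \<in> X" for p
    proof (rule ccontr)
      assume "\<not> ?thesis"
      then have same: "\<forall>g\<in>?T. g p = g z0" by blast
      have "P p $ i = P z0 $ i" for i
      proof -
        have "(\<lambda>z. P z $ i) \<in> pull P"
          unfolding pull_def by (intro CollectI exI[of _ "\<lambda>z. z $ i"]) (simp add: complex_poly_fun.coord)
        from bspec[OF same subsetD[OF incl this]] show ?thesis .
      qed
      then have "P p = P x" using z0(1) by (simp add: Finite_Cartesian_Product.vec_eq_iff)
      moreover have "p $ j = y" using bspec[OF same adjoin_gen[OF S, of "\<lambda>z. z $ j"]] z0(2) by simp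
      ultimately show False using none p by blast
    qed
    obtain g where g: "g \<in> ?T" "\<And>z. z \<in> X \<Longrightarrow> g z = 0" "g z0 \<noteq> 0"
      using lying_over[OF fun_subring_adjoin[OF S] TP finite_over_mono[OF fin incl order.refl] X(1) sep]
      by blast
    obtain N b where b: "g = (\<lambda>z. \<Sum>i\<le>N. b i z * (z $ j) ^ i)" "\<forall>i. b i \<in> pull P"
      using g(1) unfolding adjoin_def by blast
    have az0: "a i z0 = a i x" for i using pull_apply[OF aS z0(1)] .
    have "(\<Sum>i\<le>N. b i z0 * (z0 $ j) ^ i) = 0"
    proof (rule minimal_relation_divides[OF S dom aS aX])
      show "r \<le> M" if "M \<ge> 1" "\<And>i. c i \<in> pull P" "\<exists>z. c M z \<noteq> 0"
        "\<And>z. z \<in> X \<Longrightarrow> (\<Sum>i\<le>M. c i z * (z $ j) ^ i) = 0" for M c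
        using that by (intro least[of M c]) (auto simp: rel_def)
      show "a r z0 \<noteq> 0" "(\<Sum>i\<le>r. a i z0 * (z0 $ j) ^ i) = 0" using x y by (simp_all add: az0 z0(2))
      show "b i \<in> pull P" for i using b(2) by blast
      show "(\<Sum>i\<le>N. b i z * (z $ j) ^ i) = 0" if "z \<in> X" for z using g(2)[OF that] unfolding b(1) .
    qed
    then show False using g(3) unfolding b(1) by simp
  qed
  obtain C R where C: "C > 0" "\<And>p q. p \<in> X \<Longrightarrow> q \<in> X \<Longrightarrow> norm p \<ge> R \<Longrightarrow> norm q \<ge> R \<Longrightarrow>
     norm (p - q) \<le> C * norm (P (p - q))"
    using far_injectiveE[OF far] by metis
  obtain KP where KP: "KP > 0" "\<And>x. norm (P x) \<le> KP * norm x" using clin_bound[OF P] by metis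
  obtain s where s: "r = Suc s" using r1 by (cases r) auto
  \<comment> \<open>The factor \<open>a r\<close> makes \<open>f\<close> vanish also where the
    leading coefficient does, so that only points with a genuine degree \<open>r\<close> equation
    remain.\<close>
  define f where "f z = a r z * (of_nat r * a r z * z $ j + a s z)" for z
  have aP: "complex_poly_fun (a i)" for i using aS pull_complex_poly_fun[OF P] by blast
  have f1: "complex_poly_fun (\<lambda>z. of_nat r * a r z * z $ j + a s z)"
    by (intro complex_poly_fun.intros aP)
  have "complex_poly_fun f" unfolding f_def by (intro complex_poly_fun.mult aP f1)
  \<comment> \<open>The threshold \<open>KP * R\<close> on the projection forces norm at least
    \<open>R\<close> for every point with the same projection.\<close>
  moreover have "f p = 0" if p: "p \<in> X" "norm (P p) \<ge> KP * R" for p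
  proof (cases "a r p = 0")
    case False
    define q where "q = (\<Sum>i\<le>r. monom (a i p) i)"
    have coeff: "coeff q i = (if i \<le> r then a i p else 0)" for i
      unfolding q_def coeff_sum by (simp add: if_distrib sum.delta cong: if_cong)
    have q_poly: "poly q y = (\<Sum>i\<le>r. a i p * y ^ i)" for y
      unfolding q_def poly_sum by (simp add: poly_monom)
    have "degree q = Suc s"
      unfolding s[symmetric] using False by (intro antisym degree_le le_degree) (auto simp: coeff)
    moreover have "y = p $ j" if y: "poly q y = 0" for y
    proof -
      obtain p' where p': "p' \<in> X" "P p' = P p" "p' $ j = y"
        using root_attained[OF False] y unfolding q_poly by blast
      have norms: "norm p \<ge> R" "norm p' \<ge> R"
        using p(2) p'(2) KP(2)[of p] KP(2)[of p'] KP(1) by (metis mult_le_cancel_left_pos order_trans)+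
      have "P (p - p') = 0" using p'(2) by (simp add: clin_diff[OF P])
      then have "norm (p - p') \<le> 0" using C(2)[OF p(1) p'(1) norms] by simp
      then show ?thesis using p'(3) by simp
    qed
    ultimately have "coeff q s = - of_nat (Suc s) * p $ j * coeff q (Suc s)"
      by (rule coeff_unique_root)
    then have "a s p = - of_nat r * p $ j * a r p" unfolding s[symmetric] by (simp add: coeff s)
    then show ?thesis unfolding f_def by (simp add: algebra_simps)
  qed (simp add: f_def)
  ultimately have "\<forall>p\<in>X. f p = 0"
    using far_vanishing[OF P PP w X(2) fin surj] by blast
  moreover have "\<not> (\<forall>z\<in>X. a r z = 0)" using ar dom aS[of r] by blast
  ultimately have rel1: "\<forall>z\<in>X. of_nat r * a r z * z $ j + a s z = 0"
    using irredD[OF X(2) aP[of r] f1] unfolding f_def by blast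
  show thesis
  proof (rule that)
    show "(\<lambda>z. of_nat r * a r z) \<in> pull P"
      by (intro fun_subring_mult[OF S] fun_subring_const[OF S] aS)
    show "(\<lambda>z. - a s z) \<in> pull P" by (intro fun_subring_uminus[OF S] aS)
    show "\<exists>z. of_nat r * a r z \<noteq> 0" using ar r1 by simp
    show "of_nat r * a r p * p $ j = - a s p" if "p \<in> X" for p
      using rel1 that by (simp add: eq_neg_iff_add_eq_0)
  qed
qed

text \<open>Surjectivity carries the linear growth of \<open>X\<close> over its projection to a
  bound of \<open>b\<close> by \<open>a\<close> on the whole space, so
  \<open>quotient_affine\<close> applies; irreducibility then cancels \<open>a\<close>.\<close>

lemma coordinate_affine:
  fixes X :: "(complex ^ 'm) set"
  assumes X: "algebraic_set X" "irred X" and P: "clin P" and PP: "\<And>z. P (P z) = P z"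
    and w: "P w = w" "w \<noteq> 0" and fin: "finite_over (pull P) X"
    and dom: "\<forall>g\<in>pull P. (\<forall>z\<in>X. g z = 0) \<longrightarrow> (\<forall>z. g z = 0)"
    and surj: "\<And>x. \<exists>p\<in>X. P p = P x" and far: "far_injective X P"
  shows "\<exists>c l. clform l \<and> (\<forall>p\<in>X. p $ j = c + l (P p))"
proof -
  obtain a b where ab: "a \<in> pull P" "b \<in> pull P" "\<exists>z. a z \<noteq> 0" "\<And>p. p \<in> X \<Longrightarrow> a p * p $ j = b p"
    using degree_one_relation[OF assms] by blast
  obtain K where K: "\<And>p. p \<in> X \<Longrightarrow> norm p \<le> K * (1 + norm (P p))"
    using far_injective_linear_growth[OF P far] by blast
  obtain KP where KP: "KP > 0" "\<And>x. norm (P x) \<le> KP * norm x" using clin_bound[OF P] by metis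
  have abP: "complex_poly_fun a" "complex_poly_fun b" using ab(1,2) pull_complex_poly_fun[OF P] by blast+
  have bound: "cmod (b x) \<le> (\<bar>K\<bar> * (1 + KP)) * (1 + norm x) * cmod (a x)" for x
  proof -
    obtain p where p: "p \<in> X" "P p = P x" using surj by blast
    have "cmod (p $ j) \<le> norm p" by (rule Finite_Cartesian_Product.norm_nth_le)
    also have "\<dots> \<le> K * (1 + norm (P x))" using K[OF p(1)] p(2) by simp
    also have "\<dots> \<le> \<bar>K\<bar> * ((1 + KP) * (1 + norm x))"
    proof (rule mult_mono)
      show "1 + norm (P x) \<le> (1 + KP) * (1 + norm x)"
        using KP(1) KP(2)[of x] by (simp add: algebra_simps add_increasing)
    qed auto
    finally have "cmod (p $ j) \<le> \<bar>K\<bar> * (1 + KP) * (1 + norm x)" by (simp add: mult.assoc)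
    then have "cmod (a x) * cmod (p $ j) \<le> cmod (a x) * (\<bar>K\<bar> * (1 + KP) * (1 + norm x))"
      by (rule mult_left_mono) simp
    moreover have "b x = a x * p $ j"
      using ab(4)[OF p(1)] pull_apply[OF ab(1) p(2)] pull_apply[OF ab(2) p(2)] by simp
    ultimately show ?thesis by (simp add: norm_mult mult_ac)
  qed
  obtain x0 where "a x0 \<noteq> 0" using ab(3) by blast
  then obtain c l where l: "clform l" "\<And>x. b x = (c + l x) * a x"
    using quotient_affine[OF abP _ bound] by metis
  have "a p * (p $ j - (c + l (P p))) = 0" if "p \<in> X" for p
  proof -
    have "a (P p) = a p" "b (P p) = b p"
      by (rule pull_apply[OF ab(1) PP], rule pull_apply[OF ab(2) PP])
    then show ?thesis using l(2)[of "P p"] ab(4)[OF that] by (simp add: algebra_simps)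
  qed
  moreover have "complex_poly_fun (\<lambda>p. p $ j - (c + l (P p)))"
    by (intro complex_poly_fun_diff complex_poly_fun.intros clform_complex_poly_fun clform_comp[OF l(1) P])
  moreover have "\<not> (\<forall>z\<in>X. a z = 0)" using ab(1,3) dom by blast
  ultimately have "\<forall>p\<in>X. p $ j - (c + l (P p)) = 0"
    using irredD[OF X(2) abP(1)] by blast
  then show ?thesis using l(1) by (intro exI[of _ c] exI[of _ l]) auto
qed

theorem theorem3p5:
  fixes X :: "(complex ^ 'm) set" and k :: nat
  assumes "algebraic_set X"
    and "\<not> bounded X"
    and "has_pure_dim X k"
    and "has_pure_dim (C5_infinity X) k"
  shows "complex_affine_subspace X"
proof -
  obtain P where P: "clin P" and PP: "\<And>z. P (P z) = P z" and fin: "finite_over (pull P) X"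
    and dim: "vec.dim (range P) \<le> k" and far: "far_injective X P"
    using far_injective_projection_exists[OF assms(1,4)] by metis
  obtain C R where C: "C > 0" "\<And>p q. p \<in> X \<Longrightarrow> q \<in> X \<Longrightarrow> norm p \<ge> R \<Longrightarrow> norm q \<ge> R \<Longrightarrow>
     norm (p - q) \<le> C * norm (P (p - q))"
    using far_injectiveE[OF far] by metis
  obtain KP where KP: "KP > 0" "\<And>x. norm (P x) \<le> KP * norm x" using clin_bound[OF P] by metis
  have unb: "\<exists>p\<in>X. norm p > r" for r using assms(2) unfolding bounded_iff by (meson not_le)
  \<comment> \<open>Two distant points of different norm have different projections, so the range of
    \<open>P\<close> is not zero.\<close>
  obtain w where w: "P w = w" "w \<noteq> 0"
  proof -
    obtain p where p: "p \<in> X" "norm p > R" using unb by blast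
    obtain q where q: "q \<in> X" "norm q > norm p" using unb by blast
    have "norm (p - q) \<le> C * norm (P (p - q))" using C(2)[OF p(1) q(1)] p(2) q(2) by simp
    moreover have "p \<noteq> q" using q(2) by auto
    ultimately have "P (p - q) \<noteq> 0" by auto
    then show thesis using PP by (intro that[of "P (p - q)"]) auto
  qed
  have component: "algebraic_set B \<and> irred B \<and> B \<subseteq> X \<and> finite_over (pull P) B \<and>
      (\<forall>g\<in>pull P. (\<forall>z\<in>B. g z = 0) \<longrightarrow> (\<forall>z. g z = 0)) \<and> (\<forall>x. \<exists>p\<in>B. P p = P x)"
    if comp: "irreducible_component_of (subtopology zariski X) B" for B
  proof -
    note B = irreducible_component_algebraic[OF assms(1) comp]
    have finB: "finite_over (pull P) B" by (rule finite_over_mono[OF fin order.refl B(3)])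
    obtain Z where Z: "irred_chain k Z" "Z k \<subseteq> B" using pure_dim_component_chain[OF assms(3) comp] by blast
    \<comment> \<open>The component carries a chain of length \<open>k\<close>, at least the rank of
      \<open>P\<close>: this is the equality case, and the projection is dominant on the
      component.\<close>
    from irred_chain_bound[OF P PP Z(1) finite_over_mono[OF finB order.refl Z(2)]]
    have dom: "\<forall>z. g (P z) = 0" if "complex_poly_fun g" "\<forall>z\<in>B. g (P z) = 0" for g
      using dim that Z(2) by (metis le_antisym subsetD)
    have "\<exists>p\<in>B. P p = P x" for x
      using projection_surjective[OF B(1) P PP finB, of x] dom by metis
    moreover have "\<forall>g\<in>pull P. (\<forall>z\<in>B. g z = 0) \<longrightarrow> (\<forall>z. g z = 0)"
      using dom unfolding pull_def by blast
    ultimately show ?thesis using B finB by blast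
  qed
  have component_at: "\<exists>B. irreducible_component_of (subtopology zariski X) B \<and> x \<in> B" if "x \<in> X" for x
  proof -
    have "irred {x}" unfolding irred_def by auto
    then show ?thesis using irreducible_component_exists[of "{x}" X] that by blast
  qed
  obtain x where "x \<in> X" using unb by blast
  then obtain B0 where B0: "irreducible_component_of (subtopology zariski X) B0" using component_at by blast
  \<comment> \<open>Far out, a point of \<open>B\<close> coincides with a point of \<open>B0\<close>
    that has the same projection; so polynomials vanishing on \<open>B0\<close> vanish on the far
    part of \<open>B\<close>, hence on \<open>B\<close>.\<close>
  have "B \<subseteq> B0" if B: "irreducible_component_of (subtopology zariski X) B" for B
  proof (rule subsetI, rule ccontr)
    fix y assume y: "y \<in> B" "y \<notin> B0"
    have B0': "algebraic_set B0" "B0 \<subseteq> X" "\<And>x. \<exists>p\<in>B0. P p = P x" using component[OF B0] by blast+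
    have B': "irred B" "B \<subseteq> X" "finite_over (pull P) B" "\<And>x. \<exists>p\<in>B. P p = P x" using component[OF B] by blast+
    obtain f where f: "complex_poly_fun f" "\<And>z. z \<in> B0 \<Longrightarrow> f z = 0" "f y \<noteq> 0"
      using algebraic_set_separate[OF B0'(1) y(2)] by blast
    have "f p = 0" if p: "p \<in> B" "norm (P p) \<ge> KP * R" for p
    proof -
      obtain q where q: "q \<in> B0" "P q = P p" using B0'(3) by blast
      have norms: "norm p \<ge> R" "norm q \<ge> R"
        using p(2) q(2) KP(2)[of p] KP(2)[of q] KP(1) by (metis mult_le_cancel_left_pos order_trans)+
      have "P (p - q) = 0" using q(2) by (simp add: clin_diff[OF P])
      then have "norm (p - q) \<le> 0" using C(2)[OF _ _ norms] p(1) q(1) B'(2) B0'(2) by auto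
      then show ?thesis using f(2) q(1) by simp
    qed
    then have "\<forall>p\<in>B. f p = 0" using far_vanishing[OF P PP w B'(1,3,4) f(1)] by blast
    then show False using y(1) f(3) by blast
  qed
  then have "X \<subseteq> B0" using component_at by blast
  moreover have "B0 \<subseteq> X" using component[OF B0] by blast
  ultimately have "X = B0" by blast
  then have irr: "irred X" and dom: "\<forall>g\<in>pull P. (\<forall>z\<in>X. g z = 0) \<longrightarrow> (\<forall>z. g z = 0)"
    and surj: "\<And>x. \<exists>p\<in>X. P p = P x"
    using component[OF B0] by blast+
  have "\<forall>j. \<exists>c l. clform l \<and> (\<forall>p\<in>X. p $ j = c + l (P p))"
    using coordinate_affine[OF assms(1) irr P PP w fin dom surj far] by blast
  then obtain c l where l: "\<And>j. clform (l j)" "\<And>j p. p \<in> X \<Longrightarrow> p $ j = c j + l j (P p)" by metis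
  define L where "L z = (\<chi> j. l j (P z))" for z
  have L: "clin L"
    unfolding clin_def L_def
    by (simp add: Finite_Cartesian_Product.vec_eq_iff clin_add[OF P] clin_scale[OF P] clform_add[OF l(1)] clform_scale[OF l(1)])
  have X_eq: "p = (\<chi> j. c j) + L p" if "p \<in> X" for p
    using l(2)[OF that] by (simp add: Finite_Cartesian_Product.vec_eq_iff L_def)
  have "X = (\<lambda>v. (\<chi> j. c j) + v) ` range L"
  proof (intro equalityI subsetI)
    fix p assume "p \<in> X"
    then show "p \<in> (\<lambda>v. (\<chi> j. c j) + v) ` range L" using X_eq[of p] by blast
  next
    fix p assume "p \<in> (\<lambda>v. (\<chi> j. c j) + v) ` range L"
    then obtain x where x: "p = (\<chi> j. c j) + L x" by blast
    obtain q where q: "q \<in> X" "P q = P x" using surj by blast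
    then have "L q = L x" by (simp add: L_def)
    then show "p \<in> X" using X_eq[OF q(1)] q(1) x by simp
  qed
  then show ?thesis
    unfolding complex_affine_subspace_def using subspace_range_clin[OF L] by blast
qed

end
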